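(* Consider the three-queue adaptive polling system described in the context. (i) If the service discipline in all queues is limited, with limits $l_1,l_2,l_3\ge1$, then the system is unstable if at least one of the following three inequalities holds: $$\rho_0+\frac{\lambda_2}{l_2}\zeta\ge1,$$ $$\rho_0+\frac{\lambda_1}{l_1}\,\frac{\zeta+\zeta^*}{2}+\frac{\lambda_2}{l_2}\,\frac{\zeta-\zeta^*}{2}\ge1,$$ $$\rho_0+\frac{\lambda_3}{l_3}\,\frac{\zeta+\zeta^*}{2}+\frac{\lambda_2}{l_2}\,\frac{\zeta-\zeta^*}{2}\ge1.$$ Moreover, the system is transient if at least one of these three inequalities is strict. (ii) If the service discipline in all queues is gated, or if it is exhaustive in all queues, then the system is unstable if $\rho_0\ge1$, and transient if $\rho_0>1$.
   Context: **The polling system.** A single server attends three infinite-buffer queues (stations) $1,2,3$. In queue $k$ the interarrival time between the $n$th and $(n+1)$st customers is $\tau_k(n)$, and the $n$th customer requires $\sigma_k(n)$ units of service time. The server moves in cycles, each starting at queue 1, and a cycle is either *standard* ($1\to2\to3\to1$) or *reduced* ($1\to3\to1$). The $n$th walking (switch-over) time from station $k$ to station $k+1\ (\mathrm{mod}\ 3)$ is $\xi_k(n)$, $k=1,2,3$; the walking times from station 1 directly to station 3 are $\xi_4(n)$. *Adaptive rule.* The first cycle is standard. If a cycle is standard and within it the server finds queue 2 non-empty and serves there, the next cycle is standard; if a cycle is standard and the server finds queue 2 empty, the next cycle is reduced. After a reduced cycle the next cycle is standard. *Service disciplines* (the same type in all queues). *Limited*: upon a visit to queue $k$ the server works until either a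 predefined number $l_k\ge1$ of customers is served or the queue becomes empty, whichever occurs first. *Gated*: upon a visit the server serves all the customers present at the moment of its arrival, and only those. *Exhaustive*: the server continues to serve until the queue becomes empty. **Stochastic assumptions.** All sequences $\{\tau_k(n)\}_n,\{\sigma_k(n)\}_n$ ($k=1,2,3$), $\{\xi_k(n)\}_n$ ($k=1,\dots,4$) are mutually independent, and each is i.i.d. with a finite first moment. Put $\lambda_k=1/\mathsf E\tau_k(1)>0$, $\mu_k=1/\mathsf E\sigma_k(1)>0$, $\beta_k=\lambda_k/\mu_k$ ($k=1,2,3$), $\rho_0=\sum_{k=1}^3\beta_k$, $\nu_k=1/\mathsf E\xi_k(1)$ ($k=1,\dots,4$), $\zeta=\nu_1^{-1}+\nu_2^{-1}+\nu_3^{-1}$, $\zeta^*=\nu_3^{-1}+\nu_4^{-1}$. It is assumed that $\zeta>\zeta^*$. For each $k=1,2,3$ it is assumed that $\mathbf P(\tau_k(1)>t)>0$ for all $t>0$, and that the distribution of $\tau_k(1)$ is spread-out: there are an integer $n>0$ and a non-negative function $g$ with $\int_0^\infty g(x)\,dx>0$ such that $\mathbf P(a\le\sum_{i=1}^n\tau_k(i)\le b)\ge\int_a^b g(x)\,dx$ for all $0\le a<b$. **Markov process.** The state at time $t$ is $X(t)=(Q(t),A(t),B(t),B^0(t),H(t),I(t),C(t))$, where $Q=(Q_1,Q_2,Q_3)$ with $Q_i(t)$ the number of customers waiting or in service at station $i$; $A=(A_1,A_2,A_3)$ with $A_i(t)$ the remaining interarrival time at queue $i$; $B(t)$ is the remaining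 service time of the customer in service (0 if the server is walking); $B^0(t)$ is the remaining walking time (0 if the server is in service); $H(t)$ is the station at which the server works or to which it is walking; $I(t)\in\{0,1\}$ switches from 0 to 1 when the server arrives at queue 2 and finds it empty, and from 1 to 0 when the server starts walking from queue 1 to queue 3 in a reduced cycle; if the server is in service, $C(t)$ is the number of service completions (limited disciplines), respectively of arrivals (gated disciplines), at queue $H(t)$ by time $t$ during the current visit, $C(t)=0$ when the server is walking, and $C\equiv0$ for exhaustive disciplines. $X$ is right-continuous with left limits and is a strong Markov process on a state space $\mathcal S\subset\mathbb R_+^{11}$. $X$ is *positive Harris recurrent* if it possesses a unique stationary distribution. The polling system is *stable* if $X$ is positive Harris recurrent, and *unstable* otherwise. An unstable polling system is *transient* if $|Q(t)|\to\infty$ almost surely as $t\to\infty$. *)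

theory Defs
  imports "HOL-Probability.Probability"
begin

text \<open>
  Stations are elements of the three-element type \<open>3\<close>, written \<open>1, 2, 3\<close>; there \<open>3 = 0\<close>, so
  \<open>k + 1\<close> is the station following \<open>k\<close> modulo 3. Walking links are elements of the type \<open>4\<close>:
  link \<open>k \<le> 3\<close> leads from station \<open>k\<close> to its successor, link \<open>4\<close> from station 1 directly to 3.
  Sequences are indexed from 0.
\<close>

datatype discipline = Limited "3 \<Rightarrow> nat" | Gated | Exhaustive

text \<open>\<open>(Q, A, B, B\<^sup>0, H, I, C)\<close>, with the integer-valued coordinates in discrete types.\<close>

type_synonym state =
  "(3 \<Rightarrow> nat) \<times> (3 \<Rightarrow> real) \<times> real \<times> real \<times> 3 \<times> nat \<times> nat"

fun queues :: "state \<Rightarrow> 3 \<Rightarrow> nat" where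
  "queues (q, a, b, b0, h, i, c) = q"

text \<open>
  \<open>may_serve d h n c\<close>: a server standing at station \<open>h\<close>, where \<open>n\<close> customers are present and the
  visit counter shows \<open>c\<close>, has a further customer to serve during this visit. The counter counts
  the services completed (limited) or the arrivals (gated) during the visit, so for the gated
  discipline \<open>n - c\<close> customers were already present when the visit began.
\<close>

fun may_serve :: "discipline \<Rightarrow> 3 \<Rightarrow> nat \<Rightarrow> nat \<Rightarrow> bool" where
  "may_serve (Limited l) h n c \<longleftrightarrow> 0 < n \<and> c < l h"
| "may_serve Gated h n c \<longleftrightarrow> c < n"
| "may_serve Exhaustive h n c \<longleftrightarrow> 0 < n"

text \<open>
  By right-continuity every running clock is strictly positive, so exactly one of \<open>b\<close>, \<open>b0\<close> is
  positive. The switch \<open>i\<close> is set upon arrival at an empty queue 2, which the server leaves at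
  once, and it is reset before queue 2 can be approached again; hence \<open>i = 1\<close> excludes \<open>h = 2\<close>.
\<close>

definition states :: "discipline \<Rightarrow> state set" where
  "states d = {(q, a, b, b0, h, i, c).
     (\<forall>k. 0 < a k) \<and> i \<in> {0, 1} \<and> (i = 1 \<longrightarrow> h \<noteq> 2) \<and>
     (0 < b \<and> b0 = 0 \<and> may_serve d h (q h) c \<and> (d = Exhaustive \<longrightarrow> c = 0) \<or>
      b = 0 \<and> 0 < b0 \<and> c = 0)}"

definition state_space :: "discipline \<Rightarrow> state measure" where
  "state_space d = restrict_space
     ((\<Pi>\<^sub>M k\<in>UNIV. count_space UNIV) \<Otimes>\<^sub>M (\<Pi>\<^sub>M k\<in>UNIV. borel) \<Otimes>\<^sub>M borel \<Otimes>\<^sub>M borel \<Otimes>\<^sub>M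
      count_space UNIV \<Otimes>\<^sub>M count_space UNIV \<Otimes>\<^sub>M count_space UNIV)
     (states d)"

subsection \<open>Dynamics for given interarrival, service and walking times\<close>

text \<open>
  A configuration is the state immediately after an event, at time \<open>clock\<close>, together with the
  numbers of interarrival, service and walking times used so far. Since service and walking
  times may vanish, several events can happen at one instant; the field \<open>serving\<close> then tells
  whether the server clock \<open>rem\<close> is a remaining service time or a remaining walking time.
\<close>

record config =
  clock :: real
  queue :: "3 \<Rightarrow> nat"
  arr :: "3 \<Rightarrow> real"
  serving :: bool
  rem :: real
  pos :: 3
  switch :: nat
  count :: nat
  used_arr :: "3 \<Rightarrow> nat"
  used_srv :: "3 \<Rightarrow> nat"
  used_walk :: "4 \<Rightarrow> nat"

fun init :: "state \<Rightarrow> config" where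
  "init (q, a, b, b0, h, i, c) =
     \<lparr>clock = 0, queue = q, arr = a, serving = (0 < b), rem = (if 0 < b then b else b0),
      pos = h, switch = i, count = c,
      used_arr = (\<lambda>_. 0), used_srv = (\<lambda>_. 0), used_walk = (\<lambda>_. 0)\<rparr>"

definition observe :: "config \<Rightarrow> state" where
  "observe s = (queue s, arr s, (if serving s then rem s else 0), (if serving s then 0 else rem s),
     pos s, switch s, count s)"

definition advance :: "real \<Rightarrow> config \<Rightarrow> config" where
  "advance u s = s\<lparr>clock := clock s + u, arr := (\<lambda>k. arr s k - u), rem := rem s - u\<rparr>"

definition arrival :: "discipline \<Rightarrow> (3 \<Rightarrow> nat \<Rightarrow> real) \<Rightarrow> 3 \<Rightarrow> config \<Rightarrow> config" where
  "arrival d \<tau> k s = s\<lparr>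
     queue := (queue s)(k := queue s k + 1),
     arr := (arr s)(k := \<tau> k (used_arr s k)),
     used_arr := (used_arr s)(k := used_arr s k + 1),
     count := (if d = Gated \<and> serving s \<and> pos s = k then count s + 1 else count s)\<rparr>"

definition start_service :: "(3 \<Rightarrow> nat \<Rightarrow> real) \<Rightarrow> config \<Rightarrow> config" where
  "start_service \<sigma> s = (let h = pos s in s\<lparr>
     serving := True,
     rem := \<sigma> h (used_srv s h),
     used_srv := (used_srv s)(h := used_srv s h + 1)\<rparr>)"

definition link :: "3 \<Rightarrow> nat \<Rightarrow> 4" where
  "link h i = (if h = 1 then (if i = 1 then 4 else 1) else if h = 2 then 2 else 3)"

definition leave :: "(4 \<Rightarrow> nat \<Rightarrow> real) \<Rightarrow> config \<Rightarrow> config" where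
  "leave \<xi> s = (let w = link (pos s) (switch s) in s\<lparr>
     serving := False,
     rem := \<xi> w (used_walk s w),
     pos := (if w = 4 then 3 else pos s + 1),
     switch := (if w = 4 then 0 else switch s),
     count := 0,
     used_walk := (used_walk s)(w := used_walk s w + 1)\<rparr>)"

definition serve_or_leave ::
  "discipline \<Rightarrow> (3 \<Rightarrow> nat \<Rightarrow> real) \<Rightarrow> (4 \<Rightarrow> nat \<Rightarrow> real) \<Rightarrow> config \<Rightarrow> config" where
  "serve_or_leave d \<sigma> \<xi> s =
     (if may_serve d (pos s) (queue s (pos s)) (count s) then start_service \<sigma> s else leave \<xi> s)"

definition complete_service :: "discipline \<Rightarrow> config \<Rightarrow> config" where
  "complete_service d s = s\<lparr>
     queue := (queue s)(pos s := queue s (pos s) - 1),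
     count := (case d of Limited l \<Rightarrow> count s + 1 | _ \<Rightarrow> count s)\<rparr>"

definition reach_station :: "config \<Rightarrow> config" where
  "reach_station s = s\<lparr>switch := (if pos s = 2 \<and> queue s 2 = 0 then 1 else switch s)\<rparr>"

definition server_event ::
  "discipline \<Rightarrow> (3 \<Rightarrow> nat \<Rightarrow> real) \<Rightarrow> (4 \<Rightarrow> nat \<Rightarrow> real) \<Rightarrow> config \<Rightarrow> config" where
  "server_event d \<sigma> \<xi> s =
     serve_or_leave d \<sigma> \<xi> (if serving s then complete_service d s else reach_station s)"

text \<open>
  Run all clocks until the first of them expires and carry out the corresponding event.
  Simultaneous arrivals and server events can have positive probability; arrivals then come first.
\<close>

definition step ::
  "discipline \<Rightarrow> (3 \<Rightarrow> nat \<Rightarrow> real) \<Rightarrow> (3 \<Rightarrow> nat \<Rightarrow> real) \<Rightarrow> (4 \<Rightarrow> nat \<Rightarrow> real) \<Rightarrow> config \<Rightarrow> config" where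
  "step d \<tau> \<sigma> \<xi> s =
     (let s' = advance (min (rem s) (Min (range (arr s)))) s in
      if arr s' 1 = 0 then arrival d \<tau> 1 s'
      else if arr s' 2 = 0 then arrival d \<tau> 2 s'
      else if arr s' 3 = 0 then arrival d \<tau> 3 s'
      else server_event d \<sigma> \<xi> s')"

text \<open>
  The state at time \<open>t\<close>, started in \<open>x\<close> at time 0. The \<open>LEAST\<close> exists unless infinitely many
  events happen by time \<open>t\<close>, which has probability 0 under the stochastic assumptions below.
\<close>

definition path ::
  "discipline \<Rightarrow> (3 \<Rightarrow> nat \<Rightarrow> real) \<Rightarrow> (3 \<Rightarrow> nat \<Rightarrow> real) \<Rightarrow> (4 \<Rightarrow> nat \<Rightarrow> real) \<Rightarrow>
    state \<Rightarrow> real \<Rightarrow> state" where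
  "path d \<tau> \<sigma> \<xi> x t =
     (let s = (\<lambda>n. (step d \<tau> \<sigma> \<xi> ^^ n) (init x));
          n = (LEAST n. t < clock (s (Suc n)))
      in observe (advance (t - clock (s n)) (s n)))"

subsection \<open>Stochastic assumptions\<close>

definition rate :: "'a measure \<Rightarrow> (nat \<Rightarrow> 'a \<Rightarrow> real) \<Rightarrow> real" where
  "rate M Y = 1 / (LINT \<omega>|M. Y 0 \<omega>)"

definition rho0 ::
  "'a measure \<Rightarrow> (3 \<Rightarrow> nat \<Rightarrow> 'a \<Rightarrow> real) \<Rightarrow> (3 \<Rightarrow> nat \<Rightarrow> 'a \<Rightarrow> real) \<Rightarrow> real" where
  "rho0 M \<tau> \<sigma> = (\<Sum>k\<in>UNIV. rate M (\<tau> k) / rate M (\<sigma> k))"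

text \<open>If a mean walking time is 0 then, as \<open>1 / 0 = 0\<close>, its summand is 0 as it should be.\<close>

definition zeta :: "'a measure \<Rightarrow> (4 \<Rightarrow> nat \<Rightarrow> 'a \<Rightarrow> real) \<Rightarrow> real" where
  "zeta M \<xi> = 1 / rate M (\<xi> 1) + 1 / rate M (\<xi> 2) + 1 / rate M (\<xi> 3)"

definition zeta_star :: "'a measure \<Rightarrow> (4 \<Rightarrow> nat \<Rightarrow> 'a \<Rightarrow> real) \<Rightarrow> real" where
  "zeta_star M \<xi> = 1 / rate M (\<xi> 3) + 1 / rate M (\<xi> 4)"

definition iid_times :: "'a measure \<Rightarrow> (nat \<Rightarrow> 'a \<Rightarrow> real) \<Rightarrow> bool" where
  "iid_times M Y \<longleftrightarrow>
     prob_space.indep_vars M (\<lambda>_. borel) Y UNIV \<and>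
     (\<forall>n. distr M borel (Y n) = distr M borel (Y 0)) \<and>
     (\<forall>n. AE \<omega> in M. 0 \<le> Y n \<omega>) \<and>
     integrable M (Y 0)"

definition spread_out :: "'a measure \<Rightarrow> (nat \<Rightarrow> 'a \<Rightarrow> real) \<Rightarrow> bool" where
  "spread_out M Y \<longleftrightarrow>
     (\<exists>n>0. \<exists>g::real \<Rightarrow> real. g \<in> borel_measurable borel \<and> (\<forall>x. 0 \<le> g x) \<and>
        0 < (\<integral>\<^sup>+x\<in>{0..}. ennreal (g x) \<partial>lborel) \<and>
        (\<forall>a b. 0 \<le> a \<longrightarrow> a < b \<longrightarrow>
           (\<integral>\<^sup>+x\<in>{a..b}. ennreal (g x) \<partial>lborel)
             \<le> emeasure M {\<omega> \<in> space M. a \<le> (\<Sum>i<n. Y i \<omega>) \<and> (\<Sum>i<n. Y i \<omega>) \<le> b}))"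

locale adaptive_polling = prob_space M
  for M :: "'a measure" +
  fixes \<tau> \<sigma> :: "3 \<Rightarrow> nat \<Rightarrow> 'a \<Rightarrow> real" and \<xi> :: "4 \<Rightarrow> nat \<Rightarrow> 'a \<Rightarrow> real"
  assumes independent:
      "indep_vars (\<lambda>_. borel)
        (\<lambda>(j, n). case j of Inl k \<Rightarrow> \<tau> k n | Inr (Inl k) \<Rightarrow> \<sigma> k n | Inr (Inr k) \<Rightarrow> \<xi> k n)
        (UNIV :: ((3 + 3 + 4) \<times> nat) set)"
    and iid_arr: "iid_times M (\<tau> k)"
    and iid_srv: "iid_times M (\<sigma> k)"
    and iid_walk: "iid_times M (\<xi> w)"
    and arr_rate_pos: "0 < rate M (\<tau> k)"
    and srv_rate_pos: "0 < rate M (\<sigma> k)"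
    and walk_means: "zeta_star M \<xi> < zeta M \<xi>"
    and arr_unbounded: "0 < t \<Longrightarrow> 0 < prob {\<omega> \<in> space M. t < \<tau> k 0 \<omega>}"
    and arr_spread_out: "spread_out M (\<tau> k)"

subsection \<open>Stability\<close>

definition X ::
  "discipline \<Rightarrow> (3 \<Rightarrow> nat \<Rightarrow> 'a \<Rightarrow> real) \<Rightarrow> (3 \<Rightarrow> nat \<Rightarrow> 'a \<Rightarrow> real) \<Rightarrow> (4 \<Rightarrow> nat \<Rightarrow> 'a \<Rightarrow> real) \<Rightarrow>
    state \<Rightarrow> real \<Rightarrow> 'a \<Rightarrow> state" where
  "X d \<tau> \<sigma> \<xi> x t \<omega> = path d (\<lambda>k n. \<tau> k n \<omega>) (\<lambda>k n. \<sigma> k n \<omega>) (\<lambda>k n. \<xi> k n \<omega>) x t"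

definition stationary ::
  "discipline \<Rightarrow> 'a measure \<Rightarrow> (3 \<Rightarrow> nat \<Rightarrow> 'a \<Rightarrow> real) \<Rightarrow> (3 \<Rightarrow> nat \<Rightarrow> 'a \<Rightarrow> real) \<Rightarrow>
    (4 \<Rightarrow> nat \<Rightarrow> 'a \<Rightarrow> real) \<Rightarrow> state measure \<Rightarrow> bool" where
  "stationary d M \<tau> \<sigma> \<xi> \<pi> \<longleftrightarrow>
     prob_space \<pi> \<and> sets \<pi> = sets (state_space d) \<and>
     (\<forall>t\<ge>0. \<forall>E\<in>sets (state_space d).
        (\<integral>\<^sup>+x. emeasure M {\<omega> \<in> space M. X d \<tau> \<sigma> \<xi> x t \<omega> \<in> E} \<partial>\<pi>) = emeasure \<pi> E)"

definition positive_harris_recurrent ::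
  "discipline \<Rightarrow> 'a measure \<Rightarrow> (3 \<Rightarrow> nat \<Rightarrow> 'a \<Rightarrow> real) \<Rightarrow> (3 \<Rightarrow> nat \<Rightarrow> 'a \<Rightarrow> real) \<Rightarrow>
    (4 \<Rightarrow> nat \<Rightarrow> 'a \<Rightarrow> real) \<Rightarrow> bool" where
  "positive_harris_recurrent d M \<tau> \<sigma> \<xi> \<longleftrightarrow> (\<exists>!\<pi>. stationary d M \<tau> \<sigma> \<xi> \<pi>)"

definition unstable ::
  "discipline \<Rightarrow> 'a measure \<Rightarrow> (3 \<Rightarrow> nat \<Rightarrow> 'a \<Rightarrow> real) \<Rightarrow> (3 \<Rightarrow> nat \<Rightarrow> 'a \<Rightarrow> real) \<Rightarrow>
    (4 \<Rightarrow> nat \<Rightarrow> 'a \<Rightarrow> real) \<Rightarrow> bool" where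
  "unstable d M \<tau> \<sigma> \<xi> \<longleftrightarrow> \<not> positive_harris_recurrent d M \<tau> \<sigma> \<xi>"

definition transient ::
  "discipline \<Rightarrow> 'a measure \<Rightarrow> (3 \<Rightarrow> nat \<Rightarrow> 'a \<Rightarrow> real) \<Rightarrow> (3 \<Rightarrow> nat \<Rightarrow> 'a \<Rightarrow> real) \<Rightarrow>
    (4 \<Rightarrow> nat \<Rightarrow> 'a \<Rightarrow> real) \<Rightarrow> bool" where
  "transient d M \<tau> \<sigma> \<xi> \<longleftrightarrow> unstable d M \<tau> \<sigma> \<xi> \<and>
     (\<forall>x\<in>states d. AE \<omega> in M.
        filterlim (\<lambda>t. \<Sum>k\<in>UNIV. queues (X d \<tau> \<sigma> \<xi> x t \<omega>) k) at_top at_top)"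

end

theory Submission
  imports Defs
begin

text \<open>
  Number the events of a path, and let \<open>T\<close> be the time, \<open>A\<^sub>k\<close> the arrivals at and \<open>D\<^sub>k\<close> the services
  begun at station \<open>k\<close>, and \<open>S\<close> and \<open>R\<close> the numbers of standard and reduced cycles, after \<open>n\<close> events.
  The server is always serving or walking. Hence, by the strong law of large numbers,
  \<open>T = \<Sum>k. D\<^sub>k / \<mu>\<^sub>k + \<zeta> S + \<zeta>* R + o(T)\<close> and \<open>A\<^sub>k = \<lambda>\<^sub>k T + o(T)\<close>, while \<open>D\<^sub>k = A\<^sub>k - Q\<^sub>k\<close> up to a constant.

  A standard cycle that finds queue 2 empty is followed by a reduced one, so queue 2 is found
  non-empty \<open>S - R\<close> times, and limited service gives \<open>D\<^sub>2 \<le> l\<^sub>2 (S - R)\<close> and \<open>D\<^sub>k \<le> l\<^sub>k (S + R)\<close> for \<open>k = 1, 3\<close>.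
  Write \<open>\<zeta> S + \<zeta>* R\<close> as \<open>\<zeta> (S - R) + (\<zeta> + \<zeta>*) R\<close>, or as
  \<open>(\<zeta> + \<zeta>*) / 2 * (S + R) + (\<zeta> - \<zeta>*) / 2 * (S - R)\<close>. Either way the walking time becomes
  \<open>\<Sum>k. \<gamma>\<^sub>k D\<^sub>k + F\<close> with a nondecreasing surplus \<open>F\<close>, which consists of unused service opportunities
  and, in the first case, of reduced cycles. For gated and exhaustive service \<open>\<gamma> = 0\<close>, and \<open>F\<close> is the
  whole walking time. In every case \<open>(L - 1) T + F \<le> o(T) + c |Q|\<close>, where \<open>L\<close> is the left-hand side of
  the inequality in question (\<open>load_balance\<close>, \<open>surplus_le_queues\<close>).

  If \<open>L > 1\<close>, the queues therefore grow linearly (\<open>queues_diverge\<close>).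

  If \<open>L \<ge> 1\<close> and \<open>\<pi>\<close> is a stationary distribution, start the process with \<open>\<pi>\<close>. Then \<open>|Q(t)|\<close> is
  tight, so that \<open>F\<close> grows sublinearly along a path at times at which the queues are bounded. On the
  other hand, from a state with short queues there is a fixed chance that the interarrival times
  drawn next are long and the next service and walking times are short. During the following block
  of time the server then walks much and serves little, which raises \<open>F\<close> by a fixed amount
  (\<open>few_services_many_walks\<close>, \<open>surplus_calm_blocks\<close>). Values not yet used are independent of what has
  happened (\<open>prob_calm_after\<close>), and the marginal at every time is \<open>\<pi>\<close>, so a positive fraction of all
  blocks is of this kind in the mean. This contradicts the sublinear growth
  (\<open>no_stationary_distribution\<close>).
\<close>

section \<open>The strong law of large numbers\<close>

text \<open>
  The maximum of \<open>0\<close> and the first \<open>m\<close> partial sums. The recursion strips the first term, so that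
  the maximum for the shifted sequence occurs inside the maximum for the sequence.
\<close>

primrec max_partial_sum :: "nat \<Rightarrow> (nat \<Rightarrow> real) \<Rightarrow> real" where
  "max_partial_sum 0 z = 0"
| "max_partial_sum (Suc m) z = max 0 (z 0 + max_partial_sum m (\<lambda>i. z (Suc i)))"

lemma max_partial_sum_mono: "max_partial_sum m z \<le> max_partial_sum (Suc m) z"
proof (induction m arbitrary: z)
  case (Suc m)
  show ?case using Suc[of "\<lambda>i. z (Suc i)"] by simp
qed simp

lemma sum_le_max_partial_sum: "n \<le> m \<Longrightarrow> (\<Sum>i<n. z i) \<le> max_partial_sum m z"
proof (induction m arbitrary: z n)
  case (Suc m)
  show ?case
  proof (cases n)
    case (Suc n')
    then show ?thesis
      using Suc.IH[of n' "\<lambda>i. z (Suc i)"] Suc.prems by (simp add: sum.lessThan_Suc_shift del: sum.lessThan_Suc)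
  qed simp
qed simp

lemma max_partial_sum_bounds: "0 \<le> max_partial_sum m z" "max_partial_sum m z \<le> (\<Sum>i<m. \<bar>z i\<bar>)"
proof -
  show "0 \<le> max_partial_sum m z" by (cases m) auto
  show "max_partial_sum m z \<le> (\<Sum>i<m. \<bar>z i\<bar>)"
  proof (induction m arbitrary: z)
    case (Suc m)
    have "0 \<le> (\<Sum>i<m. \<bar>z (Suc i)\<bar>)" by (intro sum_nonneg) auto
    then show ?case
      using Suc[of "\<lambda>i. z (Suc i)"] by (simp add: sum.lessThan_Suc_shift del: sum.lessThan_Suc)
  qed simp
qed

lemma measurable_max_partial_sum:
  "(\<And>i. (\<lambda>x. f x i) \<in> borel_measurable N) \<Longrightarrow> (\<lambda>x. max_partial_sum m (f x)) \<in> borel_measurable N"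
proof (induction m arbitrary: f)
  case (Suc m)
  note [measurable] = Suc.prems
  have [measurable]: "(\<lambda>x. max_partial_sum m (\<lambda>i. f x (Suc i))) \<in> borel_measurable N"
    by (rule Suc.IH) (rule Suc.prems)
  show ?case by simp
qed simp

text \<open>
  An i.i.d. sequence and its shift have the same joint distribution, a power of the common
  marginal.
\<close>

lemma (in prob_space) expectation_max_partial_sum_shift:
  assumes indep: "indep_vars (\<lambda>_. borel) Z UNIV"
    and ident: "\<And>n. distr M borel (Z n) = distr M borel (Z 0)"
  shows "expectation (\<lambda>\<omega>. max_partial_sum m (\<lambda>i. Z (Suc i) \<omega>)) = expectation (\<lambda>\<omega>. max_partial_sum m (\<lambda>i. Z i \<omega>))"
proof -
  have rv [measurable]: "Z n \<in> borel_measurable M" for n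
    using indep by (auto simp: indep_vars_def)
  have ident': "(\<lambda>i. distr M borel (Z i)) = (\<lambda>i. distr M borel (Z 0))"
    by (rule ext) (rule ident)
  have 1: "distr M (Pi\<^sub>M UNIV (\<lambda>_. borel)) (\<lambda>\<omega>. \<lambda>i\<in>UNIV. Z i \<omega>) = Pi\<^sub>M UNIV (\<lambda>i. distr M borel (Z 0))"
    using indep_vars_iff_distr_eq_PiM[of UNIV Z "\<lambda>_. borel"] indep unfolding ident' by simp
  have "distr M (Pi\<^sub>M UNIV (\<lambda>_. borel)) (\<lambda>\<omega>. \<lambda>i\<in>UNIV. Z (Suc i) \<omega>)
      = distr (distr M (Pi\<^sub>M UNIV (\<lambda>_. borel)) (\<lambda>\<omega>. \<lambda>i\<in>UNIV. Z i \<omega>)) (Pi\<^sub>M UNIV (\<lambda>_. borel)) (\<lambda>z. \<lambda>i\<in>UNIV. z (Suc i))"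
    by (subst distr_distr) (auto simp: o_def intro!: measurable_PiM_single')
  also have "\<dots> = distr (Pi\<^sub>M UNIV (\<lambda>i. distr M borel (Z 0))) (Pi\<^sub>M UNIV (\<lambda>i. distr M borel (Z 0))) (\<lambda>z. \<lambda>i\<in>UNIV. z (Suc i))"
    unfolding 1 by (intro distr_cong refl sets_PiM_cong) auto
  also have "\<dots> = Pi\<^sub>M UNIV (\<lambda>i. distr M borel (Z 0))"
    by (rule distr_PiM_reindex[where f = Suc, OF prob_space_distr]) auto
  finally have 2: "distr M (Pi\<^sub>M UNIV (\<lambda>_. borel)) (\<lambda>\<omega>. \<lambda>i\<in>UNIV. Z (Suc i) \<omega>) = Pi\<^sub>M UNIV (\<lambda>i. distr M borel (Z 0))" .
  have m: "max_partial_sum m \<in> borel_measurable (Pi\<^sub>M UNIV (\<lambda>_. borel))"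
    by (rule measurable_max_partial_sum) simp
  have "expectation (\<lambda>\<omega>. max_partial_sum m (\<lambda>i\<in>UNIV. Z (Suc i) \<omega>))
      = integral\<^sup>L (distr M (Pi\<^sub>M UNIV (\<lambda>_. borel)) (\<lambda>\<omega>. \<lambda>i\<in>UNIV. Z (Suc i) \<omega>)) (max_partial_sum m)"
    by (subst integral_distr[OF _ m]) (auto intro!: measurable_PiM_single')
  also have "\<dots> = integral\<^sup>L (distr M (Pi\<^sub>M UNIV (\<lambda>_. borel)) (\<lambda>\<omega>. \<lambda>i\<in>UNIV. Z i \<omega>)) (max_partial_sum m)"
    unfolding 1 2 ..
  also have "\<dots> = expectation (\<lambda>\<omega>. max_partial_sum m (\<lambda>i\<in>UNIV. Z i \<omega>))"
    by (subst integral_distr[OF _ m]) (auto intro!: measurable_PiM_single')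
  finally show ?thesis by (simp add: restrict_UNIV)
qed

text \<open>
  Let \<open>F\<close> be the maximum for the sequence and \<open>G\<close> the one for its shift. Where \<open>F > 0\<close>, the first
  term contributes to \<open>F\<close>, hence \<open>F - G \<le> Z\<^sub>0\<close>; elsewhere \<open>F - G \<le> 0\<close>. As \<open>F\<close> and \<open>G\<close> have the
  same mean, integration gives the inequality.
\<close>

lemma (in prob_space) hopf_maximal_inequality:
  assumes indep: "indep_vars (\<lambda>_. borel) Z UNIV"
    and ident: "\<And>n. distr M borel (Z n) = distr M borel (Z 0)"
    and int: "integrable M (Z 0)"
  shows "0 \<le> expectation (\<lambda>\<omega>. Z 0 \<omega> * indicator {\<omega>. 0 < max_partial_sum m (\<lambda>i. Z i \<omega>)} \<omega>)"
proof -
  have rv [measurable]: "Z n \<in> borel_measurable M" for n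
    using indep by (auto simp: indep_vars_def)
  have int': "integrable M (Z n)" for n
  proof -
    have *: "integrable (distr M borel (Z k)) (\<lambda>x. x) \<longleftrightarrow> integrable M (Z k)" for k
      by (rule integrable_distr_eq) auto
    show ?thesis using *[of n] *[of 0] int unfolding ident[of n] by simp
  qed
  define F G where "F \<omega> = max_partial_sum m (\<lambda>i. Z i \<omega>)" and "G \<omega> = max_partial_sum m (\<lambda>i. Z (Suc i) \<omega>)" for \<omega>
  have mF [measurable]: "F \<in> borel_measurable M" and mG [measurable]: "G \<in> borel_measurable M"
    unfolding F_def G_def by (auto intro!: measurable_max_partial_sum)
  have iF: "integrable M F"
    by (rule Bochner_Integration.integrable_bound[of _ "\<lambda>\<omega>. \<Sum>i<m. \<bar>Z i \<omega>\<bar>"])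
       (auto simp: F_def max_partial_sum_bounds int' intro!: AE_I2 order_trans[OF max_partial_sum_bounds(2)])
  have iG: "integrable M G"
    by (rule Bochner_Integration.integrable_bound[of _ "\<lambda>\<omega>. \<Sum>i<m. \<bar>Z (Suc i) \<omega>\<bar>"])
       (auto simp: G_def max_partial_sum_bounds int' intro!: AE_I2 order_trans[OF max_partial_sum_bounds(2)])
  have "0 = expectation F - expectation G"
    using expectation_max_partial_sum_shift[OF indep ident, of m] by (simp add: F_def[abs_def] G_def[abs_def])
  also have "\<dots> = expectation (\<lambda>\<omega>. F \<omega> - G \<omega>)"
    using iF iG by simp
  also have "\<dots> \<le> expectation (\<lambda>\<omega>. Z 0 \<omega> * indicator {\<omega>. 0 < F \<omega>} \<omega>)"
  proof (rule integral_mono)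
    show "integrable M (\<lambda>\<omega>. Z 0 \<omega> * indicator {\<omega>. 0 < F \<omega>} \<omega>)"
      by (rule Bochner_Integration.integrable_bound[OF int]) (auto simp: indicator_def)
    fix \<omega>
    show "F \<omega> - G \<omega> \<le> Z 0 \<omega> * indicator {\<omega>. 0 < F \<omega>} \<omega>"
    proof (cases "0 < F \<omega>")
      case True
      then obtain k where m: "m = Suc k" by (cases m) (auto simp: F_def)
      then have "F \<omega> = Z 0 \<omega> + max_partial_sum k (\<lambda>i. Z (Suc i) \<omega>)"
        using True by (auto simp: F_def)
      moreover have "max_partial_sum k (\<lambda>i. Z (Suc i) \<omega>) \<le> G \<omega>"
        unfolding G_def m by (rule max_partial_sum_mono)
      ultimately show ?thesis using True by simp
    next
      case False
      then show ?thesis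
        using max_partial_sum_bounds(1)[of m "\<lambda>i. Z (Suc i) \<omega>"] by (simp add: G_def)
    qed
  qed (use iF iG in auto)
  finally show ?thesis by (simp add: F_def)
qed

lemma sum_lessThan_add:
  fixes z :: "nat \<Rightarrow> real"
  shows "(\<Sum>i<k + n. z i) = (\<Sum>i<n. z i) + (\<Sum>i<k. z (i + n))"
  by (induction k) auto

text \<open>
  Dropping the first \<open>n\<close> terms changes all later partial sums by one and the same amount, so
  unboundedness is a tail event.
\<close>

lemma (in prob_space) prob_unbounded_partial_sums_0_1:
  fixes Z :: "nat \<Rightarrow> 'a \<Rightarrow> real"
  assumes indep: "indep_vars (\<lambda>_. borel) Z UNIV"
  defines "B \<equiv> {\<omega>\<in>space M. \<forall>c::nat. \<exists>n. real c < (\<Sum>i<n. Z i \<omega>)}"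
  shows "prob B = 0 \<or> prob B = 1"
proof (rule kolmogorov_0_1_law)
  let ?A = "\<lambda>i. sigma_sets (space M) {Z i -` A \<inter> space M | A. A \<in> sets borel}"
  show "sigma_algebra (space M) (?A i)" for i
    by (rule sigma_algebra_sigma_sets) auto
  show "indep_sets ?A UNIV"
    using indep by (simp add: indep_vars_def)
  show "B \<in> tail_events ?A"
    unfolding tail_events_def
  proof (intro INT_I)
    fix n :: nat
    define N where "N = sigma (space M) (\<Union>i\<in>{n..}. ?A i)"
    have sub: "(\<Union>i\<in>{n..}. ?A i) \<subseteq> Pow (space M)"
      using sigma_sets_into_sp[of "{Z i -` A \<inter> space M | A. A \<in> sets borel}" "space M" for i] by blast
    have sp: "space N = space M" and st: "sets N = sigma_sets (space M) (\<Union>i\<in>{n..}. ?A i)"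
      using sub by (auto simp: N_def)
    have mZ [measurable]: "Z (i + n) \<in> borel_measurable N" for i
    proof (rule measurableI)
      fix A :: "real set" assume "A \<in> sets borel"
      then have "Z (i + n) -` A \<inter> space M \<in> ?A (i + n)" by (intro sigma_sets.Basic) auto
      then show "Z (i + n) -` A \<inter> space N \<in> sets N"
        unfolding st sp by (intro sigma_sets.Basic) auto
    qed simp
    \<comment> \<open>The two families of partial sums differ by at most the sum of \<open>\<bar>Z i \<omega>\<bar>\<close> over \<open>i < n\<close>.\<close>
    have "B = {\<omega>\<in>space N. \<forall>c::nat. \<exists>k. real c < (\<Sum>i<k. Z (i + n) \<omega>)}"
    proof (intro set_eqI iffI)
      fix \<omega> assume \<omega>: "\<omega> \<in> B"
      show "\<omega> \<in> {\<omega>\<in>space N. \<forall>c::nat. \<exists>k. real c < (\<Sum>i<k. Z (i + n) \<omega>)}"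
      proof (clarsimp simp: sp, intro conjI allI)
        show "\<omega> \<in> space M" using \<omega> by (simp add: B_def)
        fix c :: nat
        obtain c' :: nat where c': "real c + (\<Sum>i<n. \<bar>Z i \<omega>\<bar>) < real c'"
          using reals_Archimedean2 by blast
        obtain k where k: "real c' < (\<Sum>i<k. Z i \<omega>)" using \<omega> by (auto simp: B_def)
        have "k > n"
        proof (rule ccontr)
          assume "\<not> n < k"
          then have "(\<Sum>i<k. \<bar>Z i \<omega>\<bar>) \<le> (\<Sum>i<n. \<bar>Z i \<omega>\<bar>)"
            by (intro sum_mono2) auto
          moreover have "(\<Sum>i<k. Z i \<omega>) \<le> (\<Sum>i<k. \<bar>Z i \<omega>\<bar>)"
            by (intro sum_mono) auto
          ultimately show False using c' k by simp
        qed
        then have "(\<Sum>i<k. Z i \<omega>) = (\<Sum>i<n. Z i \<omega>) + (\<Sum>i<k-n. Z (i + n) \<omega>)"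
          using sum_lessThan_add[of "\<lambda>i. Z i \<omega>" "k - n" n] by simp
        moreover have "(\<Sum>i<n. Z i \<omega>) \<le> (\<Sum>i<n. \<bar>Z i \<omega>\<bar>)" by (intro sum_mono) auto
        ultimately have "real c < (\<Sum>i<k-n. Z (i + n) \<omega>)" using c' k by linarith
        then show "\<exists>k. real c < (\<Sum>i<k. Z (i + n) \<omega>)" ..
      qed
    next
      fix \<omega> assume \<omega>: "\<omega> \<in> {\<omega>\<in>space N. \<forall>c::nat. \<exists>k. real c < (\<Sum>i<k. Z (i + n) \<omega>)}"
      show "\<omega> \<in> B"
      proof (clarsimp simp: B_def, intro conjI allI)
        show "\<omega> \<in> space M" using \<omega> by (simp add: sp)
        fix c :: nat
        obtain c' :: nat where c': "real c + (\<Sum>i<n. \<bar>Z i \<omega>\<bar>) < real c'"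
          using reals_Archimedean2 by blast
        obtain k where k: "real c' < (\<Sum>i<k. Z (i + n) \<omega>)" using \<omega> by auto
        have "(\<Sum>i<k+n. Z i \<omega>) = (\<Sum>i<n. Z i \<omega>) + (\<Sum>i<k. Z (i + n) \<omega>)"
          by (rule sum_lessThan_add)
        moreover have "- (\<Sum>i<n. Z i \<omega>) \<le> (\<Sum>i<n. \<bar>Z i \<omega>\<bar>)" 
          unfolding sum_negf[symmetric] by (intro sum_mono) auto
        ultimately have "real c < (\<Sum>i<k+n. Z i \<omega>)" using c' k by linarith
        then show "\<exists>k. real c < (\<Sum>i<k. Z i \<omega>)" ..
      qed
    qed
    also have "\<dots> \<in> sets N" by measurable
    finally show "B \<in> sigma_sets (space M) (\<Union>i\<in>{n..}. ?A i)" by (simp add: st)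
  qed
qed

text \<open>
  If the partial sums were unbounded almost surely, some partial sum would be positive almost
  surely, the indicator in the maximal inequality would increase to 1, and the mean would be
  nonnegative.
\<close>

lemma (in prob_space) AE_bounded_partial_sums:
  fixes Z :: "nat \<Rightarrow> 'a \<Rightarrow> real"
  assumes indep: "indep_vars (\<lambda>_. borel) Z UNIV"
    and ident: "\<And>n. distr M borel (Z n) = distr M borel (Z 0)"
    and int: "integrable M (Z 0)" and neg: "expectation (Z 0) < 0"
  shows "AE \<omega> in M. \<exists>c. \<forall>n. (\<Sum>i<n. Z i \<omega>) \<le> c"
proof -
  have rv [measurable]: "Z n \<in> borel_measurable M" for n
    using indep by (auto simp: indep_vars_def)
  define B where "B = {\<omega>\<in>space M. \<forall>c::nat. \<exists>n. real c < (\<Sum>i<n. Z i \<omega>)}"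
  have B [measurable]: "B \<in> sets M" unfolding B_def by measurable
  have "prob B \<noteq> 1"
  proof
    assume "prob B = 1"
    then have ae: "AE \<omega> in M. \<omega> \<in> B" by (simp add: prob_eq_1)
    have [measurable]: "(\<lambda>\<omega>. max_partial_sum m (\<lambda>i. Z i \<omega>)) \<in> borel_measurable M" for m
      by (rule measurable_max_partial_sum) simp
    have "(\<lambda>m. expectation (\<lambda>\<omega>. Z 0 \<omega> * indicator {\<omega>. 0 < max_partial_sum m (\<lambda>i. Z i \<omega>)} \<omega>)) \<longlonglongrightarrow> expectation (Z 0)"
    proof (rule integral_dominated_convergence[where w = "\<lambda>\<omega>. \<bar>Z 0 \<omega>\<bar>"])
      show "AE \<omega> in M. (\<lambda>m. Z 0 \<omega> * indicator {\<omega>. 0 < max_partial_sum m (\<lambda>i. Z i \<omega>)} \<omega>) \<longlonglongrightarrow> Z 0 \<omega>"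
        using ae
      proof eventually_elim
        fix \<omega> assume "\<omega> \<in> B"
        then obtain n where n: "0 < (\<Sum>i<n. Z i \<omega>)" by (force simp: B_def dest: spec[of _ 0])
        then have "0 < max_partial_sum m (\<lambda>i. Z i \<omega>)" if "n \<le> m" for m
          using sum_le_max_partial_sum[OF that, of "\<lambda>i. Z i \<omega>"] by linarith
        then have "eventually (\<lambda>m. Z 0 \<omega> * indicator {\<omega>. 0 < max_partial_sum m (\<lambda>i. Z i \<omega>)} \<omega> = Z 0 \<omega>) sequentially"
          by (intro eventually_sequentiallyI[of n]) simp
        then show "(\<lambda>m. Z 0 \<omega> * indicator {\<omega>. 0 < max_partial_sum m (\<lambda>i. Z i \<omega>)} \<omega>) \<longlonglongrightarrow> Z 0 \<omega>"
          by (rule tendsto_eventually)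
      qed
    qed (use int in \<open>auto simp: indicator_def\<close>)
    then have "0 \<le> expectation (Z 0)"
      by (rule LIMSEQ_le_const) (auto intro!: hopf_maximal_inequality[OF indep ident int])
    then show False using neg by simp
  qed
  then have "prob B = 0"
    using prob_unbounded_partial_sums_0_1[OF indep] by (simp add: B_def)
  then have "AE \<omega> in M. \<omega> \<notin> B" by (simp add: AE_iff_measurable[OF B] emeasure_eq_measure prob_eq_0)
  then show ?thesis
  proof (rule AE_mp, intro AE_I2 impI)
    fix \<omega> assume "\<omega> \<in> space M" "\<omega> \<notin> B"
    then obtain c :: nat where "\<forall>n. \<not> real c < (\<Sum>i<n. Z i \<omega>)" by (auto simp: B_def)
    then show "\<exists>c. \<forall>n. (\<Sum>i<n. Z i \<omega>) \<le> c" by (intro exI[of _ "real c"]) (auto simp: not_less)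
  qed
qed

text \<open>
  The strong law of large numbers in the form \<open>y\<^sub>0 + \<dots> + y\<^sub>n\<^sub>-\<^sub>1 = m n + o(n)\<close>, with an additive
  constant in place of \<open>n \<ge> n\<^sub>0\<close>: such estimates hold for all \<open>n\<close> and can be evaluated at any
  number of values used so far.
\<close>

definition linear_growth :: "real \<Rightarrow> (nat \<Rightarrow> real) \<Rightarrow> bool" where
  "linear_growth m y \<longleftrightarrow> (\<forall>\<epsilon>>0. \<exists>c. \<forall>n. \<bar>(\<Sum>i<n. y i) - m * real n\<bar> \<le> \<epsilon> * real n + c)"

text \<open>
  The sequences \<open>\<plusminus>(Y - EY) - \<epsilon>\<close> have negative mean, so their partial sums are bounded above.
\<close>

lemma (in prob_space) AE_linear_growth:
  assumes indep: "indep_vars (\<lambda>_. borel) Y UNIV"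
    and ident: "\<And>n. distr M borel (Y n) = distr M borel (Y 0)"
    and int: "integrable M (Y 0)"
  shows "AE \<omega> in M. linear_growth (expectation (Y 0)) (\<lambda>n. Y n \<omega>)"
proof -
  have rv [measurable]: "Y n \<in> borel_measurable M" for n
    using indep by (auto simp: indep_vars_def)
  let ?m = "expectation (Y 0)"
  have *: "AE \<omega> in M. \<exists>c. \<forall>n. (\<Sum>i<n. s * (Y i \<omega> - ?m) - e) \<le> c" if "0 < e" for e s :: real
  proof (rule AE_bounded_partial_sums)
    show "indep_vars (\<lambda>_. borel) (\<lambda>i \<omega>. s * (Y i \<omega> - ?m) - e) UNIV"
      by (rule indep_vars_compose2[OF indep]) simp
    show "distr M borel (\<lambda>\<omega>. s * (Y n \<omega> - ?m) - e) = distr M borel (\<lambda>\<omega>. s * (Y 0 \<omega> - ?m) - e)" for n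
    proof -
      have "distr M borel (\<lambda>\<omega>. s * (Y k \<omega> - ?m) - e) = distr (distr M borel (Y k)) borel (\<lambda>y. s * (y - ?m) - e)" for k
        by (subst distr_distr) (auto simp: o_def)
      then show ?thesis by (simp only: ident[of n])
    qed
    show "integrable M (\<lambda>\<omega>. s * (Y 0 \<omega> - ?m) - e)" using int by auto
    show "expectation (\<lambda>\<omega>. s * (Y 0 \<omega> - ?m) - e) < 0" using int that by (simp add: prob_space)
  qed
  have "AE \<omega> in M. \<forall>j::nat. (\<exists>c. \<forall>n. (\<Sum>i<n. 1 * (Y i \<omega> - ?m) - 1 / Suc j) \<le> c) \<and> (\<exists>c. \<forall>n. (\<Sum>i<n. (-1) * (Y i \<omega> - ?m) - 1 / Suc j) \<le> c)"
    unfolding AE_all_countable AE_conj_iff by (intro allI conjI *) auto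
  then show ?thesis
  proof eventually_elim
    fix \<omega> assume H: "\<forall>j::nat. (\<exists>c. \<forall>n. (\<Sum>i<n. 1 * (Y i \<omega> - ?m) - 1 / Suc j) \<le> c) \<and> (\<exists>c. \<forall>n. (\<Sum>i<n. (-1) * (Y i \<omega> - ?m) - 1 / Suc j) \<le> c)"
    show "linear_growth ?m (\<lambda>n. Y n \<omega>)"
      unfolding linear_growth_def
    proof (intro allI impI)
      fix \<epsilon> :: real assume "0 < \<epsilon>"
      then obtain j :: nat where j: "1 / Suc j < \<epsilon>" by (metis nat_approx_posE)
      obtain c where c: "\<And>n. (\<Sum>i<n. 1 * (Y i \<omega> - ?m) - 1 / Suc j) \<le> c" using H by blast
      obtain d where d: "\<And>n. (\<Sum>i<n. (-1) * (Y i \<omega> - ?m) - 1 / Suc j) \<le> d" using H by blast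
      show "\<exists>c. \<forall>n. \<bar>(\<Sum>i<n. Y i \<omega>) - ?m * real n\<bar> \<le> \<epsilon> * real n + c"
      proof (intro exI[of _ "max c d"] allI)
        fix n
        have "real n * (1 / Suc j) \<le> real n * \<epsilon>" using j by (intro mult_left_mono) auto
        then show "\<bar>(\<Sum>i<n. Y i \<omega>) - ?m * real n\<bar> \<le> \<epsilon> * real n + max c d"
          using c[of n] d[of n]
          by (simp add: sum_subtractf sum_negf sum.distrib sum_distrib_left[symmetric] algebra_simps abs_le_iff le_max_iff_disj)
            linarith
      qed
    qed
  qed
qed

section \<open>The embedded chain and its invariants\<close>

text \<open>
  The part of the description of the state space that is preserved by every event. Clocks may be
  zero here, because several events can happen at one instant.
\<close>

definition admissible :: "discipline \<Rightarrow> config \<Rightarrow> bool" where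
  "admissible d s \<longleftrightarrow> (\<forall>k. 0 \<le> arr s k) \<and> 0 \<le> rem s \<and>
     (if serving s then may_serve d (pos s) (queue s (pos s)) (count s) else count s = 0) \<and>
     (switch s = 0 \<or> switch s = 1 \<and> pos s \<noteq> 2)"

definition chain ::
  "discipline \<Rightarrow> (3 \<Rightarrow> nat \<Rightarrow> real) \<Rightarrow> (3 \<Rightarrow> nat \<Rightarrow> real) \<Rightarrow> (4 \<Rightarrow> nat \<Rightarrow> real) \<Rightarrow>
    state \<Rightarrow> nat \<Rightarrow> config" where
  "chain d \<tau> \<sigma> \<xi> x n = (step d \<tau> \<sigma> \<xi> ^^ n) (init x)"

lemma chain_simps: "chain d \<tau> \<sigma> \<xi> x 0 = init x"
    "chain d \<tau> \<sigma> \<xi> x (Suc n) = step d \<tau> \<sigma> \<xi> (chain d \<tau> \<sigma> \<xi> x n)"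
  by (simp_all add: chain_def)

definition next_event :: "config \<Rightarrow> real" where
  "next_event s = min (rem s) (Min (range (arr s)))"

lemma next_event_le: "next_event s \<le> rem s" "next_event s \<le> arr s k"
  by (auto simp: next_event_def min_le_iff_disj)

lemma next_event_cases:
  obtains k where "next_event s = arr s k" | "next_event s = rem s" "\<And>k. rem s < arr s k"
proof -
  have "Min (range (arr s)) \<in> range (arr s)" by (rule Min_in) auto
  then obtain k where k: "Min (range (arr s)) = arr s k" by (rule imageE)
  show thesis
  proof (cases "Min (range (arr s)) \<le> rem s")
    case True
    then show thesis using that(1)[of k] k by (auto simp: next_event_def min_def)
  next
    case False
    moreover have "Min (range (arr s)) \<le> arr s j" for j by (rule Min_le) auto
    ultimately have "rem s < arr s j" for j by (meson less_le_trans not_le)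
    then show thesis using that(2) False by (auto simp: next_event_def)
  qed
qed

text \<open>
  Holds trivially for gated and exhaustive service. It makes a visit to a non-empty queue serve at
  least one customer under every discipline.
\<close>

definition has_limits_ge_1 :: "discipline \<Rightarrow> bool" where
  "has_limits_ge_1 d \<longleftrightarrow> (\<forall>l k. d = Limited l \<longrightarrow> 1 \<le> l k)"

lemma may_serve_fresh: "has_limits_ge_1 d \<Longrightarrow> may_serve d k n 0 \<longleftrightarrow> 0 < n"
  by (cases d) (auto simp: has_limits_ge_1_def dest!: spec[of _ k] less_le_trans[of 0 1])

lemma may_serve_pos: "may_serve d k n c \<Longrightarrow> 0 < n"
  by (cases d) auto

text \<open>
  All later invariants are checked along these five transitions.
\<close>

lemma step_cases:
  assumes "admissible d s" "has_limits_ge_1 d"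
  obtains
    (arrival) k where "\<And>j. arr s k \<le> arr s j" "arr s k \<le> rem s"
      "step d \<tau> \<sigma> \<xi> s = arrival d \<tau> k (advance (arr s k) s)"
  | (next_service) "serving s" "\<And>j. rem s < arr s j"
      "may_serve d (pos s) (queue s (pos s) - 1) (case d of Limited l \<Rightarrow> count s + 1 | _ \<Rightarrow> count s)"
      "step d \<tau> \<sigma> \<xi> s = start_service \<sigma> (complete_service d (advance (rem s) s))"
  | (end_of_visit) "serving s" "\<And>j. rem s < arr s j"
      "step d \<tau> \<sigma> \<xi> s = leave \<xi> (complete_service d (advance (rem s) s))"
  | (start_of_visit) "\<not> serving s" "\<And>j. rem s < arr s j" "0 < queue s (pos s)"
      "step d \<tau> \<sigma> \<xi> s = start_service \<sigma> (reach_station (advance (rem s) s))"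
  | (empty_visit) "\<not> serving s" "\<And>j. rem s < arr s j" "queue s (pos s) = 0"
      "step d \<tau> \<sigma> \<xi> s = leave \<xi> (reach_station (advance (rem s) s))"
proof (cases rule: next_event_cases[of s])
  case (1 k)
  have "\<exists>j. arr s j = next_event s \<and> step d \<tau> \<sigma> \<xi> s = arrival d \<tau> j (advance (next_event s) s)"
    using exhaust_3[of k] 1
    by (auto simp: step_def Let_def advance_def next_event_def[symmetric])
  then obtain j where "arr s j = next_event s" "step d \<tau> \<sigma> \<xi> s = arrival d \<tau> j (advance (next_event s) s)"
    by blast
  then show thesis using that(1)[of j] next_event_le[of s] by auto
next
  case 2
  have *: "step d \<tau> \<sigma> \<xi> s = server_event d \<sigma> \<xi> (advance (rem s) s)"
    using 2(1) 2(2)[of 1] 2(2)[of 2] 2(2)[of 3]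
    by (auto simp: step_def Let_def advance_def next_event_def[symmetric])
  have c: "\<not> serving s \<Longrightarrow> count s = 0" using assms(1) by (auto simp: admissible_def)
  show thesis
  proof (cases "serving s")
    case True
    show thesis
    proof (cases "may_serve d (pos s) (queue s (pos s) - 1) (case d of Limited l \<Rightarrow> count s + 1 | _ \<Rightarrow> count s)")
      case True
      then show thesis
        using that(2)[OF \<open>serving s\<close> 2(2) True] * \<open>serving s\<close>
        by (cases d) (simp_all add: server_event_def serve_or_leave_def complete_service_def advance_def)
    next
      case False
      then show thesis
        using that(3)[OF \<open>serving s\<close> 2(2)] * \<open>serving s\<close>
        by (cases d) (auto simp: server_event_def serve_or_leave_def complete_service_def advance_def)
    qed
  next
    case False
    show thesis
    proof (cases "0 < queue s (pos s)")
      case True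
      then show thesis
        using that(4)[OF False 2(2)] * False c[OF False] may_serve_fresh[OF assms(2)]
        by (simp add: server_event_def serve_or_leave_def reach_station_def advance_def)
    next
      case False
      then show thesis
        using that(5)[OF \<open>\<not> serving s\<close> 2(2)] * \<open>\<not> serving s\<close> c may_serve_fresh[OF assms(2)]
        by (simp add: server_event_def serve_or_leave_def reach_station_def advance_def)
    qed
  qed
qed

lemmas event_defs = arrival_def advance_def start_service_def leave_def complete_service_def
  reach_station_def link_def Let_def

text \<open>
  No event changes this quantity and the next three. They say that the elapsed time is the total of the service and
  walking times used, up to the residual one; that the arrival epochs of a queue are sums of
  interarrival times; that customers are conserved; and that the links are used in the order
  prescribed by the cycles. A customer counts as served, in \<open>used_srv\<close>, when the service begins.
\<close>

definition time_balance :: "(3 \<Rightarrow> nat \<Rightarrow> real) \<Rightarrow> (4 \<Rightarrow> nat \<Rightarrow> real) \<Rightarrow> config \<Rightarrow> real" where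
  "time_balance \<sigma> \<xi> s = clock s + rem s - (\<Sum>k\<in>UNIV. \<Sum>i<used_srv s k. \<sigma> k i) - (\<Sum>w\<in>UNIV. \<Sum>i<used_walk s w. \<xi> w i)"

definition arrival_balance :: "(3 \<Rightarrow> nat \<Rightarrow> real) \<Rightarrow> 3 \<Rightarrow> config \<Rightarrow> real" where
  "arrival_balance \<tau> k s = clock s + arr s k - (\<Sum>i<used_arr s k. \<tau> k i)"

definition customer_balance :: "3 \<Rightarrow> config \<Rightarrow> int" where
  "customer_balance k s = int (queue s k) + int (used_srv s k) - int (used_arr s k)
     - (if serving s \<and> pos s = k then 1 else 0)"

definition walk_balance :: "config \<Rightarrow> int \<times> int" where
  "walk_balance s = (int (used_walk s 1) - int (used_walk s 2) - (if pos s = 2 then 1 else 0),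
     int (used_walk s 2) + int (used_walk s 4) - int (used_walk s 3) - (if pos s = 3 then 1 else 0))"

definition used_total :: "config \<Rightarrow> nat" where
  "used_total s = (\<Sum>k\<in>UNIV. used_arr s k) + (\<Sum>k\<in>UNIV. used_srv s k) + (\<Sum>w\<in>UNIV. used_walk s w)"

context
  fixes d :: discipline and \<tau> \<sigma> :: "3 \<Rightarrow> nat \<Rightarrow> real" and \<xi> :: "4 \<Rightarrow> nat \<Rightarrow> real"
  assumes nonneg: "\<And>k n. 0 \<le> \<tau> k n" "\<And>k n. 0 \<le> \<sigma> k n" "\<And>w n. 0 \<le> \<xi> w n"
    and limits: "has_limits_ge_1 d"
begin

lemma admissible_step:
  assumes "admissible d s"
  shows "admissible d (step d \<tau> \<sigma> \<xi> s)"
  using assms limits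
proof (cases rule: step_cases[where \<tau> = \<tau> and \<sigma> = \<sigma> and \<xi> = \<xi>])
  case (arrival k)
  then show ?thesis
    using assms nonneg(1) by (cases d) (auto simp: admissible_def event_defs)
next
  case next_service
  then show ?thesis
    using assms nonneg(2) by (cases d) (auto simp: admissible_def event_defs less_imp_le)
next
  case end_of_visit
  then show ?thesis
    using assms nonneg(3) exhaust_3[of "pos s"] by (auto simp: admissible_def event_defs less_imp_le)
next
  case start_of_visit
  then show ?thesis
    using assms nonneg(2) may_serve_fresh[OF limits] by (auto simp: admissible_def event_defs less_imp_le)
next
  case empty_visit
  then show ?thesis
    using assms nonneg(3) exhaust_3[of "pos s"] by (auto simp: admissible_def event_defs less_imp_le)
qed


text \<open>
  In the last claim, the switch is set only by the visit whose departure uses link 2, and it is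
  reset only by a departure over link 4; hence reduced cycles never outnumber standard ones by more
  than the initial value of the switch.
\<close>

lemma balances_step:
  assumes "admissible d s"
  shows "time_balance \<sigma> \<xi> (step d \<tau> \<sigma> \<xi> s) = time_balance \<sigma> \<xi> s"
    and "arrival_balance \<tau> k (step d \<tau> \<sigma> \<xi> s) = arrival_balance \<tau> k s"
    and "customer_balance k (step d \<tau> \<sigma> \<xi> s) = customer_balance k s"
    and "walk_balance (step d \<tau> \<sigma> \<xi> s) = walk_balance s"
    and "used_total (step d \<tau> \<sigma> \<xi> s) = Suc (used_total s)"
    and "used_walk (step d \<tau> \<sigma> \<xi> s) 4 + switch (step d \<tau> \<sigma> \<xi> s) + used_walk s 2
      \<le> used_walk s 4 + switch s + used_walk (step d \<tau> \<sigma> \<xi> s) 2"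
proof -
  note defs = event_defs time_balance_def arrival_balance_def customer_balance_def walk_balance_def used_total_def sum_3 sum_4
  have "time_balance \<sigma> \<xi> (step d \<tau> \<sigma> \<xi> s) = time_balance \<sigma> \<xi> s \<and> arrival_balance \<tau> k (step d \<tau> \<sigma> \<xi> s) = arrival_balance \<tau> k s \<and>
    customer_balance k (step d \<tau> \<sigma> \<xi> s) = customer_balance k s \<and> walk_balance (step d \<tau> \<sigma> \<xi> s) = walk_balance s \<and>
    used_total (step d \<tau> \<sigma> \<xi> s) = Suc (used_total s) \<and>
    used_walk (step d \<tau> \<sigma> \<xi> s) 4 + switch (step d \<tau> \<sigma> \<xi> s) + used_walk s 2
      \<le> used_walk s 4 + switch s + used_walk (step d \<tau> \<sigma> \<xi> s) 2"
    using assms limits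
  proof (cases rule: step_cases[where \<tau> = \<tau> and \<sigma> = \<sigma> and \<xi> = \<xi>])
    case (arrival j)
    then show ?thesis
      using exhaust_3[of j] by (auto simp: defs)
  next
    case next_service
    moreover have "0 < queue s (pos s)" using assms next_service(1) by (auto simp: admissible_def dest: may_serve_pos)
    ultimately show ?thesis
      using exhaust_3[of "pos s"] by (auto simp: defs)
  next
    case end_of_visit
    moreover have "0 < queue s (pos s)" using assms end_of_visit(1) by (auto simp: admissible_def dest: may_serve_pos)
    ultimately show ?thesis
      using assms exhaust_3[of "pos s"] by (auto simp: defs admissible_def)
  next
    case start_of_visit
    then show ?thesis
      using exhaust_3[of "pos s"] by (auto simp: defs)
  next
    case empty_visit
    then show ?thesis
      using assms exhaust_3[of "pos s"] by (auto simp: defs admissible_def)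
  qed
  then show "time_balance \<sigma> \<xi> (step d \<tau> \<sigma> \<xi> s) = time_balance \<sigma> \<xi> s"
    and "arrival_balance \<tau> k (step d \<tau> \<sigma> \<xi> s) = arrival_balance \<tau> k s"
    and "customer_balance k (step d \<tau> \<sigma> \<xi> s) = customer_balance k s"
    and "walk_balance (step d \<tau> \<sigma> \<xi> s) = walk_balance s"
    and "used_total (step d \<tau> \<sigma> \<xi> s) = Suc (used_total s)"
    and "used_walk (step d \<tau> \<sigma> \<xi> s) 4 + switch (step d \<tau> \<sigma> \<xi> s) + used_walk s 2
      \<le> used_walk s 4 + switch s + used_walk (step d \<tau> \<sigma> \<xi> s) 2"
    by auto
qed
end

text \<open>
  For station 2 only the visits that found customers are counted: a visit that found the queue empty
  is recorded by the switch at first, and by link 4 from the beginning of the reduced cycle that it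
  causes.
\<close>

definition busy_departures :: "3 \<Rightarrow> config \<Rightarrow> int" where
  "busy_departures k s =
     (if k = 1 then int (used_walk s 1) + int (used_walk s 4)
      else if k = 2 then int (used_walk s 2) - int (used_walk s 4) - int (switch s)
      else int (used_walk s 3))"

text \<open>
  The number of services that the limit would have permitted during the visits so far, minus the
  number of services begun. During a visit only the services up to the current one are permitted.
\<close>

definition spare_capacity :: "(3 \<Rightarrow> nat) \<Rightarrow> 3 \<Rightarrow> config \<Rightarrow> int" where
  "spare_capacity l k s = int (l k) * busy_departures k s - int (used_srv s k)
     + (if serving s \<and> pos s = k then int (count s) + 1 else 0)"

text \<open>
  The beginning of a service raises the permitted and the begun services by one. Leaving station
  \<open>k\<close> adds what remains of the limit \<open>l k\<close>, and an empty visit adds all of it, except at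
  station 2, where an empty visit sets the switch and so is not counted.
\<close>

lemma spare_capacity_step:
  assumes "admissible (Limited l) s" "\<And>k. 1 \<le> l k"
  shows "spare_capacity l k s \<le> spare_capacity l k (step (Limited l) \<tau> \<sigma> \<xi> s)"
proof -
  note defs = event_defs spare_capacity_def busy_departures_def
  have lim: "has_limits_ge_1 (Limited l)" using assms(2) by (auto simp: has_limits_ge_1_def)
  show ?thesis
    using assms(1) lim
  proof (cases rule: step_cases[where \<tau> = \<tau> and \<sigma> = \<sigma> and \<xi> = \<xi>])
    case (arrival j)
    then show ?thesis
      by (auto simp: defs)
  next
    case next_service
    then show ?thesis
      using exhaust_3[of "pos s"] by (auto simp: defs)
  next
    case end_of_visit
    moreover have "count s < l (pos s)" using assms end_of_visit(1) by (auto simp: admissible_def)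
    ultimately show ?thesis
      using assms exhaust_3[of "pos s"] by (auto simp: defs admissible_def algebra_simps)
  next
    case start_of_visit
    then show ?thesis
      using assms exhaust_3[of "pos s"] by (auto simp: defs admissible_def)
  next
    case empty_visit
    then show ?thesis
      using assms exhaust_3[of "pos s"] exhaust_3[of k] by (auto simp: defs admissible_def algebra_simps)
  qed
qed

section \<open>The balance of time and work\<close>

text \<open>
  \<open>f n \<le> g n + o(n)\<close>. Chains of such estimates replace the passage to the limit in the balance of
  time and work, including the divisions by \<open>n\<close>.
\<close>

definition sublinearly_le :: "(nat \<Rightarrow> real) \<Rightarrow> (nat \<Rightarrow> real) \<Rightarrow> bool" (infix "\<lesssim>\<^sub>o" 50) where
  "f \<lesssim>\<^sub>o g \<longleftrightarrow> (\<forall>\<epsilon>>0. \<exists>c. \<forall>n. f n \<le> g n + \<epsilon> * real n + c)"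

lemma sublinearly_leI: "(\<And>n. f n \<le> g n + c) \<Longrightarrow> f \<lesssim>\<^sub>o g"
proof (unfold sublinearly_le_def, intro allI impI exI)
  fix \<epsilon> :: real and n assume "\<And>n. f n \<le> g n + c" "0 < \<epsilon>"
  then show "f n \<le> g n + \<epsilon> * real n + c" using mult_nonneg_nonneg[of \<epsilon> "real n"] by (smt (verit) of_nat_0_le_iff)
qed

lemma sublinearly_le_add:
  assumes "f \<lesssim>\<^sub>o g" "f' \<lesssim>\<^sub>o g'"
  shows "(\<lambda>n. f n + f' n) \<lesssim>\<^sub>o (\<lambda>n. g n + g' n)"
proof (unfold sublinearly_le_def, intro allI impI)
  fix \<epsilon> :: real assume "0 < \<epsilon>"
  then have e: "0 < \<epsilon> / 2" by simp
  obtain c c' where c: "\<And>n. f n \<le> g n + \<epsilon> / 2 * real n + c" and c': "\<And>n. f' n \<le> g' n + \<epsilon> / 2 * real n + c'"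
    using assms e unfolding sublinearly_le_def by meson
  have "f n + f' n \<le> g n + g' n + \<epsilon> * real n + (c + c')" for n
    using c[of n] c'[of n] by (simp add: field_simps)
  then show "\<exists>c. \<forall>n. f n + f' n \<le> g n + g' n + \<epsilon> * real n + c" by blast
qed

lemma sublinearly_le_trans [trans]:
  assumes "f \<lesssim>\<^sub>o g" "g \<lesssim>\<^sub>o h" shows "f \<lesssim>\<^sub>o h"
proof (unfold sublinearly_le_def, intro allI impI)
  fix \<epsilon> :: real assume "0 < \<epsilon>"
  then obtain c where c: "\<And>n. f n + g n \<le> g n + h n + \<epsilon> * real n + c"
    using sublinearly_le_add[OF assms] unfolding sublinearly_le_def by meson
  have "f n \<le> h n + \<epsilon> * real n + c" for n using c[of n] by simp
  then show "\<exists>c. \<forall>n. f n \<le> h n + \<epsilon> * real n + c" by blast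
qed

lemma sublinearly_le_scale:
  assumes "f \<lesssim>\<^sub>o g" "0 \<le> a" shows "(\<lambda>n. a * f n) \<lesssim>\<^sub>o (\<lambda>n. a * g n)"
proof (unfold sublinearly_le_def, intro allI impI)
  fix \<epsilon> :: real assume \<epsilon>: "0 < \<epsilon>"
  then have "0 < \<epsilon> / (a + 1)" using assms(2) by simp
  then obtain c where c: "\<And>n. f n \<le> g n + \<epsilon> / (a + 1) * real n + c"
    using assms(1) unfolding sublinearly_le_def by meson
  have "a * f n \<le> a * g n + \<epsilon> * real n + a * c" for n
  proof -
    have "a * f n \<le> a * (g n + \<epsilon> / (a + 1) * real n + c)"
      using c assms(2) by (intro mult_left_mono) auto
    also have "\<dots> = a * g n + a / (a + 1) * (\<epsilon> * real n) + a * c" by (simp add: algebra_simps)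
    also have "a / (a + 1) * (\<epsilon> * real n) \<le> 1 * (\<epsilon> * real n)"
      using assms(2) \<epsilon> by (intro mult_right_mono) auto
    finally show ?thesis by simp
  qed
  then show "\<exists>c. \<forall>n. a * f n \<le> a * g n + \<epsilon> * real n + c" by blast
qed

lemma sublinearly_le_sum:
  assumes "finite I" "\<And>i. i \<in> I \<Longrightarrow> f i \<lesssim>\<^sub>o g i"
  shows "(\<lambda>n. \<Sum>i\<in>I. f i n) \<lesssim>\<^sub>o (\<lambda>n. \<Sum>i\<in>I. g i n)"
  using assms
proof (induction I rule: finite_induct)
  case empty
  show ?case by (rule sublinearly_leI[of _ _ 0]) simp
next
  case (insert i I)
  then have "(\<lambda>n. f i n + (\<Sum>i\<in>I. f i n)) \<lesssim>\<^sub>o (\<lambda>n. g i n + (\<Sum>i\<in>I. g i n))"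
    by (intro sublinearly_le_add) auto
  then show ?case using insert.hyps by simp
qed

lemma linear_growth_sublinearly:
  assumes "linear_growth m y" "\<And>n. u n \<le> n"
  shows "(\<lambda>n. m * real (u n)) \<lesssim>\<^sub>o (\<lambda>n. \<Sum>i<u n. y i)" and "(\<lambda>n. \<Sum>i<u n. y i) \<lesssim>\<^sub>o (\<lambda>n. m * real (u n))"
proof -
  have "\<exists>c. \<forall>n. \<bar>(\<Sum>i<u n. y i) - m * real (u n)\<bar> \<le> \<epsilon> * real n + c" if e: "0 < \<epsilon>" for \<epsilon>
  proof -
    obtain c where c: "\<forall>n. \<bar>(\<Sum>i<n. y i) - m * real n\<bar> \<le> \<epsilon> * real n + c"
      using assms(1) e unfolding linear_growth_def by blast
    have "\<bar>(\<Sum>i<u n. y i) - m * real (u n)\<bar> \<le> \<epsilon> * real n + c" for n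
    proof -
      have "\<epsilon> * real (u n) \<le> \<epsilon> * real n" using e assms(2)[of n] by (intro mult_left_mono) auto
      then show ?thesis using c[rule_format, of "u n"] by linarith
    qed
    then show ?thesis by blast
  qed
  note bound = this
  have "\<exists>c. \<forall>n. m * real (u n) \<le> (\<Sum>i<u n. y i) + \<epsilon> * real n + c \<and> (\<Sum>i<u n. y i) \<le> m * real (u n) + \<epsilon> * real n + c"
    if "0 < \<epsilon>" for \<epsilon>
  proof -
    obtain c where c: "\<forall>n. \<bar>(\<Sum>i<u n. y i) - m * real (u n)\<bar> \<le> \<epsilon> * real n + c"
      using bound[OF \<open>0 < \<epsilon>\<close>] by blast
    show ?thesis
    proof (intro exI[of _ c] allI)
      fix n
      show "m * real (u n) \<le> (\<Sum>i<u n. y i) + \<epsilon> * real n + c \<and> (\<Sum>i<u n. y i) \<le> m * real (u n) + \<epsilon> * real n + c"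
        using c[rule_format, of n] by linarith
    qed
  qed
  then show "(\<lambda>n. m * real (u n)) \<lesssim>\<^sub>o (\<lambda>n. \<Sum>i<u n. y i)" "(\<lambda>n. \<Sum>i<u n. y i) \<lesssim>\<^sub>o (\<lambda>n. m * real (u n))"
    unfolding sublinearly_le_def by blast+
qed

text \<open>
  A single term is a difference of two partial sums, hence \<open>o(n)\<close>; this bounds residual times.
\<close>

lemma linear_growth_term:
  assumes "linear_growth m y" "0 < \<epsilon>"
  shows "\<exists>c. \<forall>n. \<forall>i<n. y i \<le> \<epsilon> * real n + c"
proof -
  have "0 < \<epsilon> / 2" using assms by simp
  then obtain c where c: "\<And>n. \<bar>(\<Sum>i<n. y i) - m * real n\<bar> \<le> \<epsilon> / 2 * real n + c"
    using assms(1) unfolding linear_growth_def by meson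
  have "y i \<le> \<epsilon> * real n + (2 * c + \<bar>m\<bar>)" if "i < n" for i n
  proof -
    have "y i \<le> m + \<epsilon> / 2 * real i + \<epsilon> / 2 * real (Suc i) + 2 * c"
      using c[of i] c[of "Suc i"] unfolding abs_le_iff by (simp add: algebra_simps)
    moreover have "\<epsilon> / 2 * real i \<le> \<epsilon> / 2 * real n" "\<epsilon> / 2 * real (Suc i) \<le> \<epsilon> / 2 * real n"
      using that assms(2) by (intro mult_left_mono; simp)+
    moreover have "\<epsilon> / 2 * real n + \<epsilon> / 2 * real n = \<epsilon> * real n" by simp
    ultimately show ?thesis by linarith
  qed
  then show ?thesis by blast
qed

lemma used_mono_step:
  "used_arr s k \<le> used_arr (step d \<tau> \<sigma> \<xi> s) k"
  "used_srv s k \<le> used_srv (step d \<tau> \<sigma> \<xi> s) k"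
  "used_walk s w \<le> used_walk (step d \<tau> \<sigma> \<xi> s) w"
  by (auto simp: step_def server_event_def serve_or_leave_def event_defs)

lemma clock_step: "clock (step d \<tau> \<sigma> \<xi> s) = clock s + next_event s"
  by (simp add: step_def server_event_def serve_or_leave_def event_defs next_event_def)

text \<open>
  One realisation of the interarrival, service and walking times, together with an initial state.
\<close>

locale sample_path =
  fixes d :: discipline and \<tau> \<sigma> :: "3 \<Rightarrow> nat \<Rightarrow> real" and \<xi> :: "4 \<Rightarrow> nat \<Rightarrow> real" and x :: state
  assumes nonneg: "\<And>k n. 0 \<le> \<tau> k n" "\<And>k n. 0 \<le> \<sigma> k n" "\<And>w n. 0 \<le> \<xi> w n"
    and limits: "has_limits_ge_1 d"
    and start: "x \<in> states d"
begin

abbreviation s :: "nat \<Rightarrow> config" where "s \<equiv> chain d \<tau> \<sigma> \<xi> x"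

lemma admissible_chain: "admissible d (s n)"
proof (induction n)
  case 0
  show ?case using start by (cases x) (auto simp: chain_simps admissible_def states_def less_imp_le)
qed (auto simp: chain_simps intro!: admissible_step nonneg limits)

lemma clock_chain_mono: "m \<le> n \<Longrightarrow> clock (s m) \<le> clock (s n)"
proof (rule lift_Suc_mono_le[of "\<lambda>n. clock (s n)"])
  fix n
  show "clock (s n) \<le> clock (s (Suc n))"
    using admissible_chain[of n]
    by (auto simp: chain_simps clock_step admissible_def next_event_def intro!: Min.boundedI)
qed

lemma clock_chain_0: "clock (s 0) = 0"
  by (cases x) (simp add: chain_simps)

lemma used_chain_0: "used_arr (s 0) k = 0" "used_srv (s 0) k = 0" "used_walk (s 0) w = 0"
  by (cases x, simp add: chain_simps)+

lemma used_chain_mono: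
  assumes "m \<le> n"
  shows "used_arr (s m) k \<le> used_arr (s n) k" "used_srv (s m) k \<le> used_srv (s n) k"
    "used_walk (s m) w \<le> used_walk (s n) w"
  by (rule lift_Suc_mono_le[OF _ assms], simp add: chain_simps(2) used_mono_step)+

lemma balances_chain:
  shows "time_balance \<sigma> \<xi> (s n) = time_balance \<sigma> \<xi> (s 0)"
    and "arrival_balance \<tau> k (s n) = arrival_balance \<tau> k (s 0)"
    and "customer_balance k (s n) = customer_balance k (s 0)"
    and "walk_balance (s n) = walk_balance (s 0)"
    and "used_total (s n) = n"
proof -
  note step = balances_step[OF nonneg limits admissible_chain]
  show "time_balance \<sigma> \<xi> (s n) = time_balance \<sigma> \<xi> (s 0)"
    by (induction n) (simp_all add: chain_simps(2) step(1))
  show "arrival_balance \<tau> k (s n) = arrival_balance \<tau> k (s 0)"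
    by (induction n) (simp_all add: chain_simps(2) step(2))
  show "customer_balance k (s n) = customer_balance k (s 0)"
    by (induction n) (simp_all add: chain_simps(2) step(3))
  show "walk_balance (s n) = walk_balance (s 0)"
    by (induction n) (simp_all add: chain_simps(2) step(4))
  show "used_total (s n) = n"
    by (induction n) (simp_all add: chain_simps(2) step(5), simp add: used_total_def used_chain_0)
qed

lemma time_eq:
  "clock (s n) + rem (s n) = rem (s 0) + (\<Sum>k\<in>UNIV. \<Sum>i<used_srv (s n) k. \<sigma> k i) + (\<Sum>w\<in>UNIV. \<Sum>i<used_walk (s n) w. \<xi> w i)"
  using balances_chain(1)[of n] by (simp add: time_balance_def used_chain_0 clock_chain_0)

lemma arrival_eq: "clock (s n) + arr (s n) k = arr (s 0) k + (\<Sum>i<used_arr (s n) k. \<tau> k i)"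
  using balances_chain(2)[of k n] by (simp add: arrival_balance_def used_chain_0 clock_chain_0)


lemma customer_eq:
  "int (queue (s n) k) + int (used_srv (s n) k) - (if serving (s n) \<and> pos (s n) = k then 1 else 0)
    = int (queue (s 0) k) - (if serving (s 0) \<and> pos (s 0) = k then 1 else 0) + int (used_arr (s n) k)"
  using balances_chain(3)[of k n] by (simp add: customer_balance_def used_chain_0)

lemma used_srv_le: "used_srv (s n) k \<le> used_arr (s n) k + queue (s 0) k + 1"
  using customer_eq[of n k] by (auto split: if_splits)

lemma used_arr_le: "used_arr (s n) k \<le> used_srv (s n) k + queue (s n) k + 1"
  using customer_eq[of n k] by (auto split: if_splits)

lemma walks_eq:
  "int (used_walk (s n) 1) - int (used_walk (s n) 2) = (if pos (s n) = 2 then 1 else 0) - (if pos (s 0) = 2 then 1 else 0)"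
  "int (used_walk (s n) 2) + int (used_walk (s n) 4) - int (used_walk (s n) 3) = (if pos (s n) = 3 then 1 else 0) - (if pos (s 0) = 3 then 1 else 0)"
  using balances_chain(4)[of n] by (auto simp: walk_balance_def used_chain_0)

lemma switch_le: "switch (s n) \<le> 1"
  using admissible_chain[of n] by (auto simp: admissible_def)

lemma reduced_le_diff:
  assumes "m \<le> n"
  shows "used_walk (s n) 4 + switch (s n) + used_walk (s m) 2 \<le> used_walk (s m) 4 + switch (s m) + used_walk (s n) 2"
  using assms
proof (induction n rule: dec_induct)
  case (step n)
  then show ?case using balances_step(6)[of \<tau> \<sigma> \<xi>, OF nonneg limits admissible_chain[of n]] by (simp add: chain_simps(2))
qed simp

lemma reduced_le: "used_walk (s n) 4 \<le> used_walk (s n) 2 + 1"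
  using reduced_le_diff[of 0 n] switch_le[of 0] by (simp add: used_chain_0)

text \<open>
  The left-hand side is the epoch of the latest arrival at queue \<open>k\<close>.
\<close>

lemma last_arrival:
  "0 < used_arr (s n) k \<Longrightarrow> arr (s 0) k + (\<Sum>i<used_arr (s n) k - 1. \<tau> k i) \<le> clock (s n)"
proof (induction n)
  case (Suc n)
  show ?case
    using admissible_chain[of n] limits
  proof (cases rule: step_cases[where \<tau> = \<tau> and \<sigma> = \<sigma> and \<xi> = \<xi>])
    case (arrival j)
    have clk: "clock (s (Suc n)) = clock (s n) + arr (s n) j"
      using arrival(3) by (simp add: chain_simps(2) event_defs)
    show ?thesis
    proof (cases "j = k")
      case True
      then show ?thesis using arrival(3) arrival_eq[of n k] clk by (simp add: chain_simps(2) event_defs)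
    next
      case False
      then have "used_arr (s (Suc n)) k = used_arr (s n) k" using arrival(3) by (simp add: chain_simps(2) event_defs)
      then show ?thesis using Suc clock_chain_mono[of n "Suc n"] by simp
    qed
  qed (use Suc clock_chain_mono[of n "Suc n"] in \<open>force simp: chain_simps(2) event_defs\<close>)+
qed (simp add: used_chain_0)

text \<open>
  A residual time is at most the initial one or one of the values used so far.
\<close>

lemma rem_le:
  assumes "0 \<le> B" "\<And>k i. i < used_srv (s n) k \<Longrightarrow> \<sigma> k i \<le> B" "\<And>w i. i < used_walk (s n) w \<Longrightarrow> \<xi> w i \<le> B"
  shows "rem (s n) \<le> rem (s 0) + B"
  using assms(2,3)
proof (induction n)
  case (Suc n)
  have r0: "0 \<le> rem (s 0)" using admissible_chain[of 0] by (simp add: admissible_def)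
  have IH: "rem (s n) \<le> rem (s 0) + B"
    using Suc.prems used_chain_mono[of n "Suc n"] by (intro Suc.IH) (meson less_le_trans le_SucI order_refl)+
  have srv: "rem (s (Suc n)) \<le> rem (s 0) + B"
    if "step d \<tau> \<sigma> \<xi> (s n) = start_service \<sigma> s'" "used_srv s' = used_srv (s n)" for s'
    using Suc.prems(1)[of "used_srv (s n) (pos s')" "pos s'"] that r0 by (simp add: chain_simps(2) event_defs)
  have walk: "rem (s (Suc n)) \<le> rem (s 0) + B"
    if "step d \<tau> \<sigma> \<xi> (s n) = leave \<xi> s'" "used_walk s' = used_walk (s n)" for s'
    using Suc.prems(2)[of "used_walk (s n) (link (pos s') (switch s'))" "link (pos s') (switch s')"] that r0
    by (simp add: chain_simps(2) leave_def Let_def)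
  show ?case
    using admissible_chain[of n] limits
  proof (cases rule: step_cases[where \<tau> = \<tau> and \<sigma> = \<sigma> and \<xi> = \<xi>])
    case (arrival j)
    then show ?thesis using IH admissible_chain[of n] by (simp add: chain_simps(2) event_defs admissible_def) (smt (verit))
  next
    case next_service show ?thesis by (rule srv[OF next_service(4)]) (simp add: event_defs)
  next
    case end_of_visit show ?thesis by (rule walk[OF end_of_visit(3)]) (simp add: event_defs)
  next
    case start_of_visit show ?thesis by (rule srv[OF start_of_visit(4)]) (simp add: event_defs)
  next
    case empty_visit show ?thesis by (rule walk[OF empty_visit(4)]) (simp add: event_defs)
  qed
qed (use assms(1) in simp)

end

text \<open>
  A realisation that obeys the law of large numbers in all ten sequences. Events are numbered by
  \<open>n\<close>, and errors are measured in \<open>n\<close>; \<open>events_le_clock\<close> turns them into errors measured in time.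
\<close>

locale lln_path = sample_path +
  fixes m\<tau> m\<sigma> :: "3 \<Rightarrow> real" and m\<xi> :: "4 \<Rightarrow> real"
  assumes growth: "\<And>k. linear_growth (m\<tau> k) (\<tau> k)" "\<And>k. linear_growth (m\<sigma> k) (\<sigma> k)" "\<And>w. linear_growth (m\<xi> w) (\<xi> w)"
    and means: "\<And>k. 0 < m\<tau> k" "\<And>k. 0 \<le> m\<sigma> k" "\<And>w. 0 \<le> m\<xi> w" "0 < m\<xi> 1 + m\<xi> 2 + m\<xi> 3"
begin

abbreviation T :: "nat \<Rightarrow> real" where "T n \<equiv> clock (s n)"

lemma clock_nonneg: "0 \<le> T n"
  using clock_chain_mono[of 0 n] by (simp add: clock_chain_0)

lemma used_le: "used_arr (s n) k \<le> n" "used_srv (s n) k \<le> n" "used_walk (s n) w \<le> n"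
  using balances_chain(5)[of n] exhaust_3[of k] exhaust_4[of w]
  by (auto simp: used_total_def sum_3 sum_4)

lemma arrivals_le: "(\<lambda>n. m\<tau> k * real (used_arr (s n) k)) \<lesssim>\<^sub>o T"
proof -
  have "(\<lambda>n. m\<tau> k * real (used_arr (s n) k)) \<lesssim>\<^sub>o (\<lambda>n. m\<tau> k * real (used_arr (s n) k - 1))"
    using means(1)[of k] by (intro sublinearly_leI[of _ _ "m\<tau> k"]) (auto simp: of_nat_diff_if algebra_simps)
  also have "\<dots> \<lesssim>\<^sub>o (\<lambda>n. \<Sum>i<used_arr (s n) k - 1. \<tau> k i)"
    using used_le(1)[of _ k] by (intro linear_growth_sublinearly growth) (meson diff_le_self le_trans)
  also have "\<dots> \<lesssim>\<^sub>o T"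
  proof (rule sublinearly_leI[of _ _ 0])
    fix n
    show "(\<Sum>i<used_arr (s n) k - 1. \<tau> k i) \<le> T n + 0"
    proof (cases "0 < used_arr (s n) k")
      case True
      then show ?thesis using last_arrival[of n k] admissible_chain[of 0] by (auto simp: admissible_def dest: spec[of _ k])
    qed (simp add: clock_nonneg)
  qed
  finally show ?thesis .
qed

lemma arrivals_ge: "T \<lesssim>\<^sub>o (\<lambda>n. m\<tau> k * real (used_arr (s n) k))"
proof -
  have "T \<lesssim>\<^sub>o (\<lambda>n. \<Sum>i<used_arr (s n) k. \<tau> k i)"
    using arrival_eq[of _ k] admissible_chain
    by (intro sublinearly_leI[of _ _ "arr (s 0) k"]) (smt (verit) admissible_def)
  also have "\<dots> \<lesssim>\<^sub>o (\<lambda>n. m\<tau> k * real (used_arr (s n) k))"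
    by (intro linear_growth_sublinearly growth used_le)
  finally show ?thesis .
qed

lemma rem_sublinear: "(\<lambda>n. rem (s n)) \<lesssim>\<^sub>o (\<lambda>_. 0)"
  unfolding sublinearly_le_def
proof (intro allI impI)
  fix \<epsilon> :: real assume \<epsilon>: "0 < \<epsilon>"
  have "\<forall>k. \<exists>c. \<forall>n. \<forall>i<n. \<sigma> k i \<le> \<epsilon> * real n + c" "\<forall>w. \<exists>c. \<forall>n. \<forall>i<n. \<xi> w i \<le> \<epsilon> * real n + c"
    using linear_growth_term[OF growth(2) \<epsilon>] linear_growth_term[OF growth(3) \<epsilon>] by auto
  then obtain c c' where c: "\<And>k n i. i < n \<Longrightarrow> \<sigma> k i \<le> \<epsilon> * real n + c k" and c': "\<And>w n i. i < n \<Longrightarrow> \<xi> w i \<le> \<epsilon> * real n + c' w"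
    by metis
  define b where "b = (\<Sum>k\<in>UNIV. \<bar>c k\<bar>) + (\<Sum>w\<in>UNIV. \<bar>c' w\<bar>)"
  have "\<bar>c k\<bar> \<le> (\<Sum>k\<in>UNIV. \<bar>c k\<bar>)" for k by (rule member_le_sum) auto
  moreover have "\<bar>c' w\<bar> \<le> (\<Sum>w\<in>UNIV. \<bar>c' w\<bar>)" for w by (rule member_le_sum) auto
  moreover have "0 \<le> (\<Sum>k\<in>UNIV. \<bar>c k\<bar>)" "0 \<le> (\<Sum>w\<in>UNIV. \<bar>c' w\<bar>)" by (auto intro: sum_nonneg)
  ultimately have b: "c k \<le> b" "c' w \<le> b" "0 \<le> b" for k w unfolding b_def by (smt (verit))+
  have "rem (s n) \<le> rem (s 0) + (\<epsilon> * real n + b)" for n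
  proof (rule rem_le)
    show "0 \<le> \<epsilon> * real n + b" using \<epsilon> b by simp
    fix k i assume "i < used_srv (s n) k"
    then have "\<sigma> k i \<le> \<epsilon> * real n + c k" using used_le(2)[of n k] by (intro c) simp
    then show "\<sigma> k i \<le> \<epsilon> * real n + b" using b(1)[of k] by simp
  next
    fix w i assume "i < used_walk (s n) w"
    then have "\<xi> w i \<le> \<epsilon> * real n + c' w" using used_le(3)[of n w] by (intro c') simp
    then show "\<xi> w i \<le> \<epsilon> * real n + b" using b(2)[of w] by simp
  qed
  then show "\<exists>c. \<forall>n. rem (s n) \<le> 0 + \<epsilon> * real n + c"
    by (intro exI[of _ "rem (s 0) + b"]) (simp add: algebra_simps)
qed

text \<open>
  The server is always serving or walking, so the elapsed time is the total of the service and walking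
  times used, up to a residual time of order \<open>o(n)\<close>.
\<close>

lemma work_le:
  "(\<lambda>n. (\<Sum>k\<in>UNIV. m\<sigma> k * real (used_srv (s n) k)) + (\<Sum>w\<in>UNIV. m\<xi> w * real (used_walk (s n) w))) \<lesssim>\<^sub>o T"
proof -
  have "(\<lambda>n. (\<Sum>k\<in>UNIV. m\<sigma> k * real (used_srv (s n) k)) + (\<Sum>w\<in>UNIV. m\<xi> w * real (used_walk (s n) w)))
      \<lesssim>\<^sub>o (\<lambda>n. (\<Sum>k\<in>UNIV. \<Sum>i<used_srv (s n) k. \<sigma> k i) + (\<Sum>w\<in>UNIV. \<Sum>i<used_walk (s n) w. \<xi> w i))"
    by (intro sublinearly_le_add sublinearly_le_sum linear_growth_sublinearly growth used_le finite)
  also have "\<dots> \<lesssim>\<^sub>o (\<lambda>n. T n + rem (s n))"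
    using time_eq by (intro sublinearly_leI[of _ _ "- rem (s 0)"]) (smt (verit))
  also have "\<dots> \<lesssim>\<^sub>o (\<lambda>n. T n + 0)"
    by (intro sublinearly_le_add rem_sublinear) (rule sublinearly_leI[of _ _ 0], simp)
  finally show ?thesis by simp
qed

text \<open>
  The number of events is the number of values used. Interarrival times bound the arrivals by a
  multiple of the elapsed time, arrivals bound services, and a standard cycle takes the positive mean
  time \<open>m\<xi> 1 + m\<xi> 2 + m\<xi> 3\<close>, while the walks of all links are at most about five times the standard
  cycles. In particular only finitely many events happen in finite time.
\<close>

lemma events_le_clock: "\<exists>a b. 0 \<le> a \<and> 0 \<le> b \<and> (\<forall>n. real n \<le> a * T n + b)"
proof -
  define z where "z = m\<xi> 1 + m\<xi> 2 + m\<xi> 3"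
  define q where "q = (\<Sum>k\<in>UNIV. real (queue (s 0) k + 1))"
  have z: "0 < z" using means(4) by (simp add: z_def)
  have A: "(\<lambda>n. 2 / m\<tau> k * (m\<tau> k * real (used_arr (s n) k))) \<lesssim>\<^sub>o (\<lambda>n. 2 / m\<tau> k * T n)" for k
    using means(1)[of k] by (intro sublinearly_le_scale arrivals_le) auto
  have "(\<lambda>n. z * real (used_walk (s n) 2)) \<lesssim>\<^sub>o (\<lambda>n. (\<Sum>k\<in>UNIV. m\<sigma> k * real (used_srv (s n) k)) + (\<Sum>w\<in>UNIV. m\<xi> w * real (used_walk (s n) w)))"
  proof (rule sublinearly_leI)
    fix n
    have "0 \<le> (\<Sum>k\<in>UNIV. m\<sigma> k * real (used_srv (s n) k))"
      by (intro sum_nonneg mult_nonneg_nonneg means) auto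
    moreover have "real (used_walk (s n) 2) \<le> real (used_walk (s n) 1) + 1" "real (used_walk (s n) 2) \<le> real (used_walk (s n) 3) + 1"
      using walks_eq[of n] by (auto split: if_splits)
    from this[THEN mult_left_mono, OF means(3)]
    have "m\<xi> 1 * real (used_walk (s n) 2) \<le> m\<xi> 1 * (real (used_walk (s n) 1) + 1)" "m\<xi> 3 * real (used_walk (s n) 2) \<le> m\<xi> 3 * (real (used_walk (s n) 3) + 1)"
      by blast+
    moreover have "0 \<le> m\<xi> 4 * real (used_walk (s n) 4)" using means(3) by simp
    ultimately show "z * real (used_walk (s n) 2) \<le> (\<Sum>k\<in>UNIV. m\<sigma> k * real (used_srv (s n) k)) + (\<Sum>w\<in>UNIV. m\<xi> w * real (used_walk (s n) w)) + (m\<xi> 1 + m\<xi> 3)"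
      by (simp add: sum_4 z_def algebra_simps)
  qed
  also note work_le
  finally have W: "(\<lambda>n. 5 / z * (z * real (used_walk (s n) 2))) \<lesssim>\<^sub>o (\<lambda>n. 5 / z * T n)"
    using z by (intro sublinearly_le_scale) auto
  define a where "a = (\<Sum>k\<in>UNIV. 2 / m\<tau> k) + 5 / z"
  have a: "0 \<le> a" unfolding a_def using z means(1) by (intro add_nonneg_nonneg sum_nonneg divide_nonneg_pos) auto
  have "real \<lesssim>\<^sub>o (\<lambda>n. (\<Sum>k\<in>UNIV. 2 / m\<tau> k * (m\<tau> k * real (used_arr (s n) k))) + 5 / z * (z * real (used_walk (s n) 2)))"
  proof (rule sublinearly_leI)
    fix n
    have "used_walk (s n) 1 \<le> used_walk (s n) 2 + 1" "used_walk (s n) 3 \<le> used_walk (s n) 2 + used_walk (s n) 4 + 1"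
      using walks_eq[of n] by (auto split: if_splits)
    with reduced_le[of n] have w: "(\<Sum>w\<in>UNIV. used_walk (s n) w) \<le> 5 * used_walk (s n) 2 + 4"
      by (simp add: sum_4)
    have "(\<Sum>k\<in>UNIV. used_srv (s n) k) \<le> (\<Sum>k\<in>UNIV. used_arr (s n) k) + (\<Sum>k\<in>UNIV. queue (s 0) k + 1)"
      using used_srv_le[of n] by (simp add: sum_mono flip: sum.distrib add.assoc)
    then have "n \<le> 2 * (\<Sum>k\<in>UNIV. used_arr (s n) k) + 5 * used_walk (s n) 2 + ((\<Sum>k\<in>UNIV. queue (s 0) k + 1) + 4)"
      using w balances_chain(5)[of n] unfolding used_total_def by linarith
    then have "real n \<le> 2 * (\<Sum>k\<in>UNIV. real (used_arr (s n) k)) + 5 * real (used_walk (s n) 2) + (q + 4)"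
      unfolding q_def of_nat_sum[symmetric] by linarith
    then show "real n \<le> (\<Sum>k\<in>UNIV. 2 / m\<tau> k * (m\<tau> k * real (used_arr (s n) k))) + 5 / z * (z * real (used_walk (s n) 2)) + (q + 4)"
      using z means(1) by (simp add: sum_distrib_left less_imp_neq[symmetric])
  qed
  also have "\<dots> \<lesssim>\<^sub>o (\<lambda>n. (\<Sum>k\<in>UNIV. 2 / m\<tau> k * T n) + 5 / z * T n)"
    by (intro sublinearly_le_add sublinearly_le_sum A W finite)
  finally obtain c where c: "\<And>n. real n \<le> (\<Sum>k\<in>UNIV. 2 / m\<tau> k * T n) + 5 / z * T n + 1 / 2 * real n + c"
    unfolding sublinearly_le_def by (meson half_gt_zero zero_less_one)
  have "real n \<le> 2 * a * T n + 2 * \<bar>c\<bar>" for n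
  proof -
    have "(\<Sum>k\<in>UNIV. 2 / m\<tau> k * T n) + 5 / z * T n = a * T n"
      unfolding a_def by (simp only: sum_distrib_right distrib_right)
    then show ?thesis using c[of n] by linarith
  qed
  then show ?thesis using a by (intro exI[of _ "2 * a"] exI[of _ "2 * \<bar>c\<bar>"]) auto
qed

text \<open>
  If the walking time exceeds \<open>\<Sum>k. \<gamma> k * D\<^sub>k\<close> by \<open>\<Delta>\<close>, where \<open>D\<^sub>k\<close> is the number of services at station
  \<open>k\<close>, then every customer of queue \<open>k\<close> costs the server the mean time \<open>m\<sigma> k + \<gamma> k\<close>. Customers arrive
  at rate \<open>1 / m\<tau> k\<close>, so all arrivals together cost \<open>L\<close> per unit of time, and only the cost of the
  customers that still wait is not yet paid.
\<close>

lemma load_balance: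
  assumes \<gamma>: "\<And>k. 0 \<le> \<gamma> k"
    and \<Delta>: "\<And>n. (\<Sum>k\<in>UNIV. \<gamma> k * real (used_srv (s n) k)) + \<Delta> n \<le> (\<Sum>w\<in>UNIV. m\<xi> w * real (used_walk (s n) w)) + b"
    and \<epsilon>: "0 < \<epsilon>"
  defines "L \<equiv> \<Sum>k\<in>UNIV. (m\<sigma> k + \<gamma> k) / m\<tau> k"
  shows "\<exists>c. \<forall>n. (L - 1) * T n + \<Delta> n \<le> \<epsilon> * T n + (\<Sum>k\<in>UNIV. (m\<sigma> k + \<gamma> k) * real (queue (s n) k)) + c"
proof -
  have g: "0 \<le> m\<sigma> k + \<gamma> k" for k using \<gamma> means(2) by (simp add: add_nonneg_nonneg)
  have "(\<lambda>n. (m\<sigma> k + \<gamma> k) / m\<tau> k * T n) \<lesssim>\<^sub>o (\<lambda>n. (m\<sigma> k + \<gamma> k) / m\<tau> k * (m\<tau> k * real (used_arr (s n) k)))" for k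
    using g[of k] means(1)[of k] by (intro sublinearly_le_scale arrivals_ge) auto
  then have "(\<lambda>n. \<Sum>k\<in>UNIV. (m\<sigma> k + \<gamma> k) / m\<tau> k * T n) \<lesssim>\<^sub>o (\<lambda>n. \<Sum>k\<in>UNIV. (m\<sigma> k + \<gamma> k) / m\<tau> k * (m\<tau> k * real (used_arr (s n) k)))"
    by (intro sublinearly_le_sum finite)
  also have "(\<lambda>n. \<Sum>k\<in>UNIV. (m\<sigma> k + \<gamma> k) / m\<tau> k * T n) = (\<lambda>n. L * T n)"
    by (simp only: L_def sum_distrib_right)
  also have "(\<lambda>n. \<Sum>k\<in>UNIV. (m\<sigma> k + \<gamma> k) / m\<tau> k * (m\<tau> k * real (used_arr (s n) k))) = (\<lambda>n. \<Sum>k\<in>UNIV. (m\<sigma> k + \<gamma> k) * real (used_arr (s n) k))"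
    using means(1) by (intro ext sum.cong) (auto simp: less_imp_neq[symmetric])
  also have "\<dots> \<lesssim>\<^sub>o (\<lambda>n. (\<Sum>k\<in>UNIV. (m\<sigma> k + \<gamma> k) * real (used_srv (s n) k)) + (\<Sum>k\<in>UNIV. (m\<sigma> k + \<gamma> k) * real (queue (s n) k)))"
  proof (rule sublinearly_leI)
    fix n
    have "real (used_arr (s n) k) \<le> real (used_srv (s n) k) + real (queue (s n) k) + 1" for k
      using used_arr_le[of n k] by linarith
    then have "(m\<sigma> k + \<gamma> k) * real (used_arr (s n) k) \<le> (m\<sigma> k + \<gamma> k) * (real (used_srv (s n) k) + real (queue (s n) k) + 1)" for k
      using g by (rule mult_left_mono)
    then have "(\<Sum>k\<in>UNIV. (m\<sigma> k + \<gamma> k) * real (used_arr (s n) k)) \<le> (\<Sum>k\<in>UNIV. (m\<sigma> k + \<gamma> k) * (real (used_srv (s n) k) + real (queue (s n) k) + 1))"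
      by (rule sum_mono)
    then show "(\<Sum>k\<in>UNIV. (m\<sigma> k + \<gamma> k) * real (used_arr (s n) k)) \<le> (\<Sum>k\<in>UNIV. (m\<sigma> k + \<gamma> k) * real (used_srv (s n) k)) + (\<Sum>k\<in>UNIV. (m\<sigma> k + \<gamma> k) * real (queue (s n) k)) + (\<Sum>k\<in>UNIV. m\<sigma> k + \<gamma> k)"
      by (simp add: sum.distrib[symmetric] algebra_simps)
  qed
  finally have 1: "(\<lambda>n. L * T n) \<lesssim>\<^sub>o \<dots>" .
  have "(\<lambda>n. (\<Sum>k\<in>UNIV. (m\<sigma> k + \<gamma> k) * real (used_srv (s n) k)) + \<Delta> n) \<lesssim>\<^sub>o
      (\<lambda>n. (\<Sum>k\<in>UNIV. m\<sigma> k * real (used_srv (s n) k)) + (\<Sum>w\<in>UNIV. m\<xi> w * real (used_walk (s n) w)))"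
    using \<Delta> by (intro sublinearly_leI[of _ _ b]) (simp add: distrib_right sum.distrib add.assoc)
  also note work_le
  finally have 2: "(\<lambda>n. (\<Sum>k\<in>UNIV. (m\<sigma> k + \<gamma> k) * real (used_srv (s n) k)) + \<Delta> n) \<lesssim>\<^sub>o T" .
  obtain a b' where ab: "0 \<le> a" "\<And>n. real n \<le> a * T n + b'" using events_le_clock by blast
  \<comment> \<open>Then \<open>e * n \<le> \<epsilon> * T n\<close> up to a constant, as \<open>n \<le> a * T n + b'\<close>.\<close>
  define e where "e = \<epsilon> / (a + 1)"
  have e: "0 < e" "e * a \<le> \<epsilon>" using \<epsilon> ab(1) by (auto simp: e_def field_simps)
  \<comment> \<open>The cost of the services begun occurs on both sides and cancels below.\<close>
  obtain c where c: "\<And>n. L * T n + ((\<Sum>k\<in>UNIV. (m\<sigma> k + \<gamma> k) * real (used_srv (s n) k)) + \<Delta> n)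
    \<le> (\<Sum>k\<in>UNIV. (m\<sigma> k + \<gamma> k) * real (used_srv (s n) k)) + (\<Sum>k\<in>UNIV. (m\<sigma> k + \<gamma> k) * real (queue (s n) k)) + T n + e * real n + c"
    using sublinearly_le_add[OF 1 2] e(1) unfolding sublinearly_le_def by meson
  have "(L - 1) * T n + \<Delta> n \<le> \<epsilon> * T n + (\<Sum>k\<in>UNIV. (m\<sigma> k + \<gamma> k) * real (queue (s n) k)) + (c + e * b')" for n
  proof -
    have "e * real n \<le> e * (a * T n + b')" using ab(2)[of n] e(1) by (intro mult_left_mono) auto
    also have "\<dots> = e * a * T n + e * b'" by (simp add: algebra_simps)
    also have "e * a * T n \<le> \<epsilon> * T n" using e(2) clock_nonneg by (rule mult_right_mono)
    finally have "e * real n \<le> \<epsilon> * T n + e * b'" by simp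
    then show ?thesis using c[of n] by (simp add: left_diff_distrib)
  qed
  then show ?thesis by blast
qed

end

section \<open>Walking time not consumed by services\<close>

definition event_index ::
  "discipline \<Rightarrow> (3 \<Rightarrow> nat \<Rightarrow> real) \<Rightarrow> (3 \<Rightarrow> nat \<Rightarrow> real) \<Rightarrow> (4 \<Rightarrow> nat \<Rightarrow> real) \<Rightarrow>
    state \<Rightarrow> real \<Rightarrow> nat" where
  "event_index d \<tau> \<sigma> \<xi> x t = (LEAST n. t < clock (chain d \<tau> \<sigma> \<xi> x (Suc n)))"

lemma path_eq:
  "path d \<tau> \<sigma> \<xi> x t = observe (advance (t - clock (chain d \<tau> \<sigma> \<xi> x (event_index d \<tau> \<sigma> \<xi> x t)))
     (chain d \<tau> \<sigma> \<xi> x (event_index d \<tau> \<sigma> \<xi> x t)))"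
  by (simp add: path_def chain_def event_index_def Let_def)

lemma queues_path:
  "queues (path d \<tau> \<sigma> \<xi> x t) = queue (chain d \<tau> \<sigma> \<xi> x (event_index d \<tau> \<sigma> \<xi> x t))"
  by (simp add: path_eq observe_def advance_def)

lemma used_step_le:
  "used_srv (step d \<tau> \<sigma> \<xi> s) k \<le> Suc (used_srv s k)" "used_walk (step d \<tau> \<sigma> \<xi> s) w \<le> Suc (used_walk s w)"
  by (auto simp: step_def server_event_def serve_or_leave_def event_defs)

context sample_path
begin

lemma spare_capacity_mono:
  assumes d: "d = Limited l" and "m \<le> n"
  shows "spare_capacity l k (s m) \<le> spare_capacity l k (s n)"
proof (rule lift_Suc_mono_le[OF _ \<open>m \<le> n\<close>])
  fix n
  have "1 \<le> l k" for k using limits d by (auto simp: has_limits_ge_1_def)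
  then show "spare_capacity l k (s n) \<le> spare_capacity l k (s (Suc n))"
    using spare_capacity_step[of l "s n" k] admissible_chain[of n] d by (simp add: chain_simps(2))
qed

lemma spare_capacity_bounds:
  assumes d: "d = Limited l"
  shows "int (l k) * busy_departures k (s n) \<le> spare_capacity l k (s n) + int (used_srv (s n) k)"
    and "spare_capacity l k (s n) + int (used_srv (s n) k) \<le> int (l k) * busy_departures k (s n) + int (l k)"
  using admissible_chain[of n] d by (auto simp: spare_capacity_def admissible_def)

text \<open>
  Departures add \<open>l k\<close> each to the permitted services; with \<open>S + 2\<close> departures these outweigh \<open>S\<close>
  services and the visit in progress at the beginning.
\<close>

lemma spare_capacity_increase:
  assumes d: "d = Limited l" and "used_srv (s n) k \<le> used_srv (s m) k + S"
    and "busy_departures k (s m) + int S + 2 \<le> busy_departures k (s n)"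
  shows "spare_capacity l k (s m) + 1 \<le> spare_capacity l k (s n)"
proof -
  have l: "1 \<le> int (l k)" using limits d by (auto simp: has_limits_ge_1_def)
  have "int (l k) * (busy_departures k (s m) + int S + 2) \<le> int (l k) * busy_departures k (s n)"
    using assms(3) by (intro mult_left_mono) auto
  moreover have "1 * int S \<le> int (l k) * int S" using l by (intro mult_right_mono) auto
  ultimately show ?thesis
    using spare_capacity_bounds(1)[OF d, of k n] spare_capacity_bounds(2)[OF d, of k m] assms(2) l
    by (simp add: distrib_left)
qed

text \<open>
  Every standard cycle uses links 1, 2 and 3 once, and every reduced cycle uses links 4 and 3 once.
  Therefore walks of all links together number at most five per standard cycle, up to a constant.
\<close>

lemma walks_diff:
  assumes "m \<le> n"
  shows "int (used_walk (s n) 2) - int (used_walk (s m) 2) \<le> int (used_walk (s n) 1) - int (used_walk (s m) 1) + 1"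
    and "int (used_walk (s n) 2) - int (used_walk (s m) 2) \<le> int (used_walk (s n) 3) - int (used_walk (s m) 3) + 1"
    and "int (\<Sum>w\<in>UNIV. used_walk (s n) w) - int (\<Sum>w\<in>UNIV. used_walk (s m) w)
      \<le> 5 * (int (used_walk (s n) 2) - int (used_walk (s m) 2)) + 4"
proof -
  note mono = used_chain_mono(3)[OF assms]
  show "int (used_walk (s n) 2) - int (used_walk (s m) 2) \<le> int (used_walk (s n) 1) - int (used_walk (s m) 1) + 1"
    "int (used_walk (s n) 2) - int (used_walk (s m) 2) \<le> int (used_walk (s n) 3) - int (used_walk (s m) 3) + 1"
    using walks_eq[of n] walks_eq[of m] mono[of 4] by (auto split: if_splits)
  have "int (used_walk (s n) 1) - int (used_walk (s m) 1) \<le> int (used_walk (s n) 2) - int (used_walk (s m) 2) + 1"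
    "int (used_walk (s n) 3) - int (used_walk (s m) 3) \<le> int (used_walk (s n) 2) - int (used_walk (s m) 2) + (int (used_walk (s n) 4) - int (used_walk (s m) 4)) + 1"
    using walks_eq[of n] walks_eq[of m] by (auto split: if_splits)
  moreover have "int (used_walk (s n) 4) - int (used_walk (s m) 4) \<le> int (used_walk (s n) 2) - int (used_walk (s m) 2) + 1"
    using reduced_le_diff[OF assms] switch_le[of m] by linarith
  ultimately show "int (\<Sum>w\<in>UNIV. used_walk (s n) w) - int (\<Sum>w\<in>UNIV. used_walk (s m) w)
      \<le> 5 * (int (used_walk (s n) 2) - int (used_walk (s m) 2)) + 4"
    by (simp add: sum_4)
qed

end

text \<open>
  A stretch with at most \<open>S\<close> services and at least \<open>W\<close> walks raises \<open>F\<close> by \<open>\<delta>\<close>.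
\<close>

definition gains_from_walking :: "discipline \<Rightarrow> (config \<Rightarrow> real) \<Rightarrow> nat \<Rightarrow> nat \<Rightarrow> real \<Rightarrow> bool" where
  "gains_from_walking d F S W \<delta> \<longleftrightarrow> (\<forall>\<tau> \<sigma> \<xi> x m n. sample_path d \<tau> \<sigma> \<xi> x \<longrightarrow> m \<le> n \<longrightarrow>
     (let s = chain d \<tau> \<sigma> \<xi> x in
       (\<Sum>k\<in>UNIV. used_srv (s n) k) \<le> (\<Sum>k\<in>UNIV. used_srv (s m) k) + S \<longrightarrow>
       (\<Sum>w\<in>UNIV. used_walk (s m) w) + W \<le> (\<Sum>w\<in>UNIV. used_walk (s n) w) \<longrightarrow>
       F (s m) + \<delta> \<le> F (s n)))"

lemma gains_from_walkingD:
  assumes "gains_from_walking d F S W \<delta>" "sample_path d \<tau> \<sigma> \<xi> x" "m \<le> n"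
    "(\<Sum>k\<in>UNIV. used_srv (chain d \<tau> \<sigma> \<xi> x n) k) \<le> (\<Sum>k\<in>UNIV. used_srv (chain d \<tau> \<sigma> \<xi> x m) k) + S"
    "(\<Sum>w\<in>UNIV. used_walk (chain d \<tau> \<sigma> \<xi> x m) w) + W \<le> (\<Sum>w\<in>UNIV. used_walk (chain d \<tau> \<sigma> \<xi> x n) w)"
  shows "F (chain d \<tau> \<sigma> \<xi> x m) + \<delta> \<le> F (chain d \<tau> \<sigma> \<xi> x n)"
  using assms(1)[unfolded gains_from_walking_def Let_def, THEN spec, THEN spec, THEN spec, THEN spec,
      THEN spec, THEN spec, THEN mp, THEN mp, THEN mp, THEN mp, OF assms(2-)] .

text \<open>
  \<open>F\<close> is a nondecreasing lower bound, up to a constant, for the mean walking time that is left when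
  every service at station \<open>k\<close> is charged \<open>\<gamma> k\<close>. Each of the inequalities of the theorem corresponds
  to one choice of \<open>\<gamma>\<close>. The final clause excludes that \<open>F\<close> stagnates while the server walks a lot.
\<close>

definition walking_surplus ::
  "discipline \<Rightarrow> (4 \<Rightarrow> real) \<Rightarrow> (3 \<Rightarrow> real) \<Rightarrow> (config \<Rightarrow> real) \<Rightarrow> bool" where
  "walking_surplus d m\<xi> \<gamma> F \<longleftrightarrow> (\<forall>k. 0 \<le> \<gamma> k) \<and>
     (\<forall>\<tau> \<sigma> \<xi> x. sample_path d \<tau> \<sigma> \<xi> x \<longrightarrow> (let s = chain d \<tau> \<sigma> \<xi> x in
        (\<forall>m n. m \<le> n \<longrightarrow> F (s m) \<le> F (s n)) \<and>
        (\<exists>b. \<forall>n. (\<Sum>k\<in>UNIV. \<gamma> k * real (used_srv (s n) k)) + F (s n)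
           \<le> (\<Sum>w\<in>UNIV. m\<xi> w * real (used_walk (s n) w)) + b))) \<and>
     (\<exists>\<delta>>0. \<forall>S. \<exists>W. gains_from_walking d F S W \<delta>)"

lemma walking_surplusI:
  assumes "\<And>k. 0 \<le> \<gamma> k" "0 < \<delta>"
    and "\<And>\<tau> \<sigma> \<xi> x m n. sample_path d \<tau> \<sigma> \<xi> x \<Longrightarrow> m \<le> n \<Longrightarrow> F (chain d \<tau> \<sigma> \<xi> x m) \<le> F (chain d \<tau> \<sigma> \<xi> x n)"
    and "\<And>\<tau> \<sigma> \<xi> x n. sample_path d \<tau> \<sigma> \<xi> x \<Longrightarrow>
      (\<Sum>k\<in>UNIV. \<gamma> k * real (used_srv (chain d \<tau> \<sigma> \<xi> x n) k)) + F (chain d \<tau> \<sigma> \<xi> x n)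
           \<le> (\<Sum>w\<in>UNIV. m\<xi> w * real (used_walk (chain d \<tau> \<sigma> \<xi> x n) w)) + b"
    and "\<And>\<tau> \<sigma> \<xi> x m n S. sample_path d \<tau> \<sigma> \<xi> x \<Longrightarrow> m \<le> n \<Longrightarrow>
      (\<And>k. used_srv (chain d \<tau> \<sigma> \<xi> x n) k \<le> used_srv (chain d \<tau> \<sigma> \<xi> x m) k + S) \<Longrightarrow>
      used_walk (chain d \<tau> \<sigma> \<xi> x m) 2 + S + 4 \<le> used_walk (chain d \<tau> \<sigma> \<xi> x n) 2 \<Longrightarrow>
      F (chain d \<tau> \<sigma> \<xi> x m) + \<delta> \<le> F (chain d \<tau> \<sigma> \<xi> x n)"
  shows "walking_surplus d m\<xi> \<gamma> F"
proof -
  \<comment> \<open>That many walks include \<open>S + 4\<close> walks on link 2, by \<open>walks_diff\<close>.\<close>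
  have "gains_from_walking d F S (5 * (S + 4) + 4) \<delta>" for S
    unfolding gains_from_walking_def Let_def
  proof (intro allI impI)
    fix \<tau> \<sigma> \<xi> x m n
    assume path: "sample_path d \<tau> \<sigma> \<xi> x" and mn: "m \<le> n"
      and srv: "(\<Sum>k\<in>UNIV. used_srv (chain d \<tau> \<sigma> \<xi> x n) k) \<le> (\<Sum>k\<in>UNIV. used_srv (chain d \<tau> \<sigma> \<xi> x m) k) + S"
      and walk: "(\<Sum>w\<in>UNIV. used_walk (chain d \<tau> \<sigma> \<xi> x m) w) + (5 * (S + 4) + 4) \<le> (\<Sum>w\<in>UNIV. used_walk (chain d \<tau> \<sigma> \<xi> x n) w)"
    interpret sample_path d \<tau> \<sigma> \<xi> x by (rule path)
    show "F (chain d \<tau> \<sigma> \<xi> x m) + \<delta> \<le> F (chain d \<tau> \<sigma> \<xi> x n)"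
    proof (rule assms(5)[OF path mn])
      show "used_srv (s n) k \<le> used_srv (s m) k + S" for k
        using srv used_chain_mono(2)[OF mn, of 1] used_chain_mono(2)[OF mn, of 2] used_chain_mono(2)[OF mn, of 3] exhaust_3[of k]
        by (auto simp: sum_3)
      show "used_walk (s m) 2 + S + 4 \<le> used_walk (s n) 2"
        using walks_diff(3)[OF mn] walk by (simp add: sum_4)
    qed
  qed
  then have "\<exists>\<delta>>0. \<forall>S. \<exists>W. gains_from_walking d F S W \<delta>" using assms(2) by blast
  then show ?thesis
    unfolding walking_surplus_def Let_def
    by (intro conjI allI impI) (use assms(1,3,4) in blast)+
qed

text \<open>
  Up to the cycle in progress, the mean walking time is \<open>\<zeta>\<close> per standard cycle plus \<open>\<zeta>*\<close> per reduced
  cycle.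
\<close>

lemma walks_ge:
  assumes "sample_path d \<tau> \<sigma> \<xi> x" "\<And>w. 0 \<le> (m\<xi> w :: real)"
  defines "s \<equiv> chain d \<tau> \<sigma> \<xi> x"
  shows "(m\<xi> 1 + m\<xi> 2 + m\<xi> 3) * real (used_walk (s n) 2) + (m\<xi> 3 + m\<xi> 4) * real (used_walk (s n) 4)
    \<le> (\<Sum>w\<in>UNIV. m\<xi> w * real (used_walk (s n) w)) + (m\<xi> 1 + m\<xi> 3)"
proof -
  interpret sample_path d \<tau> \<sigma> \<xi> x by fact
  have "m\<xi> 1 * real (used_walk (s n) 2) \<le> m\<xi> 1 * (real (used_walk (s n) 1) + 1)"
    "m\<xi> 3 * (real (used_walk (s n) 2) + real (used_walk (s n) 4)) \<le> m\<xi> 3 * (real (used_walk (s n) 3) + 1)"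
    using walks_eq[of n] by (intro mult_left_mono assms(2); auto simp: s_def split: if_splits)+
  then show ?thesis by (simp add: sum_4 algebra_simps)
qed

context
  fixes m\<xi> :: "4 \<Rightarrow> real"
  assumes m\<xi>: "\<And>w. 0 \<le> m\<xi> w"
begin

text \<open>
  All walking is surplus if nothing is charged to the services; this yields the load \<open>\<rho>\<^sub>0\<close>.
\<close>

lemma walking_surplus_unlimited:
  assumes "0 < m\<xi> 1 + m\<xi> 2 + m\<xi> 3"
  shows "walking_surplus d m\<xi> (\<lambda>_. 0)
    (\<lambda>s. (m\<xi> 1 + m\<xi> 2 + m\<xi> 3) * real (used_walk s 2) + (m\<xi> 3 + m\<xi> 4) * real (used_walk s 4))"
proof (rule walking_surplusI[where \<delta> = "m\<xi> 1 + m\<xi> 2 + m\<xi> 3" and b = "m\<xi> 1 + m\<xi> 3"])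
  fix \<tau> \<sigma> \<xi> x m n S assume path: "sample_path d \<tau> \<sigma> \<xi> x" and mn: "m \<le> (n::nat)"
  interpret sample_path d \<tau> \<sigma> \<xi> x by (rule path)
  note mono = used_chain_mono(3)[OF mn]
  have c4: "(m\<xi> 3 + m\<xi> 4) * real (used_walk (s m) 4) \<le> (m\<xi> 3 + m\<xi> 4) * real (used_walk (s n) 4)"
    using mono[of 4] m\<xi> by (intro mult_left_mono) auto
  have c2: "(m\<xi> 1 + m\<xi> 2 + m\<xi> 3) * real (used_walk (s m) 2) \<le> (m\<xi> 1 + m\<xi> 2 + m\<xi> 3) * real (used_walk (s n) 2)"
    using mono[of 2] m\<xi> by (intro mult_left_mono) auto
  show "(m\<xi> 1 + m\<xi> 2 + m\<xi> 3) * real (used_walk (s m) 2) + (m\<xi> 3 + m\<xi> 4) * real (used_walk (s m) 4)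
      \<le> (m\<xi> 1 + m\<xi> 2 + m\<xi> 3) * real (used_walk (s n) 2) + (m\<xi> 3 + m\<xi> 4) * real (used_walk (s n) 4)"
    using c2 c4 by linarith
  assume "used_walk (s m) 2 + S + 4 \<le> used_walk (s n) 2"
  then have "(m\<xi> 1 + m\<xi> 2 + m\<xi> 3) * (real (used_walk (s m) 2) + 1) \<le> (m\<xi> 1 + m\<xi> 2 + m\<xi> 3) * real (used_walk (s n) 2)"
    using m\<xi> by (intro mult_left_mono) auto
  then show "(m\<xi> 1 + m\<xi> 2 + m\<xi> 3) * real (used_walk (s m) 2) + (m\<xi> 3 + m\<xi> 4) * real (used_walk (s m) 4) + (m\<xi> 1 + m\<xi> 2 + m\<xi> 3)
      \<le> (m\<xi> 1 + m\<xi> 2 + m\<xi> 3) * real (used_walk (s n) 2) + (m\<xi> 3 + m\<xi> 4) * real (used_walk (s n) 4)"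
    using c4 by (simp add: algebra_simps)
qed (use assms walks_ge[of d _ _ _ _ m\<xi>] m\<xi> in auto)


text \<open>
  Each departure pays \<open>g\<close>, which is shared equally by the \<open>l k\<close> services that the limit permits.
\<close>

lemma spare_capacity_plus_services:
  assumes path: "sample_path (Limited l) \<tau> \<sigma> \<xi> x" and g: "0 \<le> g" "g' = g / real (l k)"
  defines "s \<equiv> chain (Limited l) \<tau> \<sigma> \<xi> x"
  shows "g' * real (used_srv (s n) k) + g' * real_of_int (spare_capacity l k (s n)) \<le> g * real_of_int (busy_departures k (s n)) + g"
proof -
  interpret sample_path "Limited l" \<tau> \<sigma> \<xi> x by (rule path)
  have l: "1 \<le> l k" using limits by (simp add: has_limits_ge_1_def)
  have "real_of_int (spare_capacity l k (s n) + int (used_srv (s n) k)) \<le> real_of_int (int (l k) * busy_departures k (s n) + int (l k))"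
    unfolding s_def of_int_le_iff by (rule spare_capacity_bounds(2)) simp
  then have "g' * (real_of_int (spare_capacity l k (s n)) + real (used_srv (s n) k)) \<le> g' * (real (l k) * real_of_int (busy_departures k (s n)) + real (l k))"
    using g by (intro mult_left_mono) auto
  also have "\<dots> = g * real_of_int (busy_departures k (s n)) + g"
    using g(2) l by (simp add: field_simps)
  finally show ?thesis by (simp add: algebra_simps)
qed

text \<open>
  With \<open>S\<close> standard and \<open>R\<close> reduced cycles, the walking time \<open>\<zeta> S + \<zeta>* R = \<zeta> (S - R) + (\<zeta> + \<zeta>*) R\<close> pays
  \<open>\<zeta>\<close> for each of the \<open>S - R\<close> visits that find customers at station 2. The surplus consists of the
  permitted services not given there and of the reduced cycles. It grows with walking, since either
  there are reduced cycles, or else visits to station 2 that serve few customers.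
\<close>

lemma walking_surplus_queue_2:
  assumes l: "\<And>k. 1 \<le> l k" and z: "0 < m\<xi> 1 + m\<xi> 2 + m\<xi> 3"
  shows "walking_surplus (Limited l) m\<xi> (\<lambda>k. if k = 2 then (m\<xi> 1 + m\<xi> 2 + m\<xi> 3) / real (l 2) else 0)
    (\<lambda>s. (m\<xi> 1 + m\<xi> 2 + m\<xi> 3) / real (l 2) * real_of_int (spare_capacity l 2 s)
       + ((m\<xi> 1 + m\<xi> 2 + m\<xi> 3) + (m\<xi> 3 + m\<xi> 4)) * real (used_walk s 4))"
proof -
  define z where "z = m\<xi> 1 + m\<xi> 2 + m\<xi> 3"
  define zs where "zs = m\<xi> 3 + m\<xi> 4"
  define g where "g = z / real (l 2)"
  have g: "0 < z" "0 \<le> zs" "0 < g" using assms(2) l[of 2] m\<xi> by (auto simp: g_def z_def zs_def)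
  have "walking_surplus (Limited l) m\<xi> (\<lambda>k. if k = 2 then g else 0)
    (\<lambda>s. g * real_of_int (spare_capacity l 2 s) + (z + zs) * real (used_walk s 4))"
  proof (rule walking_surplusI[where \<delta> = "min g (z + zs)" and b = "z + (m\<xi> 1 + m\<xi> 3)"])
    fix \<tau> \<sigma> \<xi> x m n S assume path: "sample_path (Limited l) \<tau> \<sigma> \<xi> x"
    interpret sample_path "Limited l" \<tau> \<sigma> \<xi> x by (rule path)
    have "g * real (used_srv (s n) 2) + g * real_of_int (spare_capacity l 2 (s n)) \<le> z * real_of_int (busy_departures 2 (s n)) + z"
      using g by (intro spare_capacity_plus_services[OF path]) (auto simp: g_def)
    also have "z * real_of_int (busy_departures 2 (s n)) \<le> z * (real (used_walk (s n) 2) - real (used_walk (s n) 4))"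
      using g by (intro mult_left_mono) (auto simp: busy_departures_def)
    finally show "(\<Sum>k\<in>UNIV. (if k = 2 then g else 0) * real (used_srv (s n) k)) + (g * real_of_int (spare_capacity l 2 (s n)) + (z + zs) * real (used_walk (s n) 4))
           \<le> (\<Sum>w\<in>UNIV. m\<xi> w * real (used_walk (s n) w)) + (z + (m\<xi> 1 + m\<xi> 3))"
      using walks_ge[where m\<xi> = m\<xi>, OF path m\<xi>, of n, folded z_def zs_def] by (simp add: sum_3 algebra_simps)
    assume mn: "m \<le> (n::nat)"
    have c4: "(z + zs) * real (used_walk (s m) 4) \<le> (z + zs) * real (used_walk (s n) 4)"
      using used_chain_mono(3)[OF mn, of 4] g by (intro mult_left_mono) auto
    have c2: "g * real_of_int (spare_capacity l 2 (s m)) \<le> g * real_of_int (spare_capacity l 2 (s n))"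
      using spare_capacity_mono[OF refl mn] g by (intro mult_left_mono) auto
    show "g * real_of_int (spare_capacity l 2 (s m)) + (z + zs) * real (used_walk (s m) 4)
        \<le> g * real_of_int (spare_capacity l 2 (s n)) + (z + zs) * real (used_walk (s n) 4)"
      using c2 c4 by linarith
    assume srv: "\<And>k. used_srv (s n) k \<le> used_srv (s m) k + S" and walk: "used_walk (s m) 2 + S + 4 \<le> used_walk (s n) 2"
    show "g * real_of_int (spare_capacity l 2 (s m)) + (z + zs) * real (used_walk (s m) 4) + min g (z + zs)
        \<le> g * real_of_int (spare_capacity l 2 (s n)) + (z + zs) * real (used_walk (s n) 4)"
    proof (cases "used_walk (s n) 4 = used_walk (s m) 4")
      case True
      have "spare_capacity l 2 (s m) + 1 \<le> spare_capacity l 2 (s n)"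
        using walk True switch_le[of n]
        by (intro spare_capacity_increase[OF refl srv]) (auto simp: busy_departures_def)
      then have "g * (real_of_int (spare_capacity l 2 (s m)) + 1) \<le> g * real_of_int (spare_capacity l 2 (s n))"
        using g by (intro mult_left_mono) auto
      then show ?thesis using c4 by (simp add: distrib_left)
    next
      case False
      then have "(z + zs) * (real (used_walk (s m) 4) + 1) \<le> (z + zs) * real (used_walk (s n) 4)"
        using used_chain_mono(3)[OF mn, of 4] g by (intro mult_left_mono) auto
      then show ?thesis using c2 by (simp add: distrib_left)
    qed
  qed (use g in auto)
  then show ?thesis unfolding g_def z_def zs_def .
qed

text \<open>
  Here the walking time is split as
  \<open>\<zeta> S + \<zeta>* R = (\<zeta> + \<zeta>*) / 2 * (S + R) + (\<zeta> - \<zeta>*) / 2 * (S - R)\<close>; stations 1 and 3 are visited \<open>S + R\<close>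
  times, and station 2 is found non-empty \<open>S - R\<close> times. The assumption \<open>\<zeta> > \<zeta>*\<close> makes the second
  coefficient positive.
\<close>

lemma walking_surplus_queue_1_3:
  assumes l: "\<And>k. 1 \<le> l k" and j: "j \<noteq> 2"
    and z: "0 < m\<xi> 1 + m\<xi> 2 + m\<xi> 3" "m\<xi> 3 + m\<xi> 4 < m\<xi> 1 + m\<xi> 2 + m\<xi> 3"
  defines "\<gamma> \<equiv> \<lambda>k. if k = j then ((m\<xi> 1 + m\<xi> 2 + m\<xi> 3) + (m\<xi> 3 + m\<xi> 4)) / 2 / real (l j)
      else if k = 2 then ((m\<xi> 1 + m\<xi> 2 + m\<xi> 3) - (m\<xi> 3 + m\<xi> 4)) / 2 / real (l 2) else 0"
  shows "walking_surplus (Limited l) m\<xi> \<gamma>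
    (\<lambda>s. \<gamma> j * real_of_int (spare_capacity l j s) + \<gamma> 2 * real_of_int (spare_capacity l 2 s))"
proof -
  define z where "z = m\<xi> 1 + m\<xi> 2 + m\<xi> 3"
  define zs where "zs = m\<xi> 3 + m\<xi> 4"
  have g: "0 < z" "0 \<le> zs" "zs < z" using z m\<xi> by (auto simp: z_def zs_def)
  have \<gamma>: "\<gamma> j = (z + zs) / 2 / real (l j)" "\<gamma> 2 = (z - zs) / 2 / real (l 2)" "k \<noteq> j \<Longrightarrow> k \<noteq> 2 \<Longrightarrow> \<gamma> k = 0" for k
    using j by (auto simp: \<gamma>_def z_def zs_def)
  have \<gamma>_nonneg: "0 \<le> \<gamma> k" for k using g by (auto simp: \<gamma>_def z_def zs_def)
  have \<gamma>_pos: "0 < \<gamma> j" using g l[of j] by (simp add: \<gamma>(1))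
  define h h' where "h = (z + zs) / 2" and "h' = (z - zs) / 2"
  have zz: "z = h + h'" "zs = h - h'" by (simp_all add: h_def h'_def field_simps)
  have h: "0 \<le> h" "0 \<le> h'" using g by (auto simp: h_def h'_def)
  have j13: "j = 1 \<or> j = 3" using j exhaust_3[of j] by auto
  show ?thesis
  proof (rule walking_surplusI[where \<delta> = "\<gamma> j" and b = "(z + zs) + z + (m\<xi> 1 + m\<xi> 3)"])
    fix \<tau> \<sigma> \<xi> x m n S assume path: "sample_path (Limited l) \<tau> \<sigma> \<xi> x"
    interpret sample_path "Limited l" \<tau> \<sigma> \<xi> x by (rule path)
    have "\<gamma> j * real (used_srv (s n) j) + \<gamma> j * real_of_int (spare_capacity l j (s n)) \<le> h * real_of_int (busy_departures j (s n)) + h"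
      using h by (intro spare_capacity_plus_services[OF path]) (auto simp: \<gamma> h_def h'_def)
    moreover have "\<gamma> 2 * real (used_srv (s n) 2) + \<gamma> 2 * real_of_int (spare_capacity l 2 (s n)) \<le> h' * real_of_int (busy_departures 2 (s n)) + h'"
      using h by (intro spare_capacity_plus_services[OF path]) (auto simp: \<gamma> h_def h'_def)
    moreover have "h' * real_of_int (busy_departures 2 (s n)) \<le> h' * (real (used_walk (s n) 2) - real (used_walk (s n) 4))"
      using h by (intro mult_left_mono) (auto simp: busy_departures_def)
    moreover have "h * real_of_int (busy_departures j (s n)) \<le> h * (real (used_walk (s n) 2) + real (used_walk (s n) 4) + 1)"
      using h walks_eq[of n] j13 by (intro mult_left_mono) (auto simp: busy_departures_def split: if_splits)
    moreover have "(\<Sum>k\<in>UNIV. \<gamma> k * real (used_srv (s n) k)) = \<gamma> j * real (used_srv (s n) j) + \<gamma> 2 * real (used_srv (s n) 2)"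
      using j13 by (auto simp: sum_3 \<gamma>(3))
    ultimately show "(\<Sum>k\<in>UNIV. \<gamma> k * real (used_srv (s n) k)) + (\<gamma> j * real_of_int (spare_capacity l j (s n)) + \<gamma> 2 * real_of_int (spare_capacity l 2 (s n)))
           \<le> (\<Sum>w\<in>UNIV. m\<xi> w * real (used_walk (s n) w)) + ((z + zs) + z + (m\<xi> 1 + m\<xi> 3))"
      using walks_ge[where m\<xi> = m\<xi>, OF path m\<xi>, of n, folded z_def zs_def] h unfolding zz by (simp add: algebra_simps)
    assume mn: "m \<le> (n::nat)"
    have c: "\<gamma> k * real_of_int (spare_capacity l k (s m)) \<le> \<gamma> k * real_of_int (spare_capacity l k (s n))" for k
      using spare_capacity_mono[OF refl mn] \<gamma>_nonneg by (intro mult_left_mono) auto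
    show "\<gamma> j * real_of_int (spare_capacity l j (s m)) + \<gamma> 2 * real_of_int (spare_capacity l 2 (s m))
        \<le> \<gamma> j * real_of_int (spare_capacity l j (s n)) + \<gamma> 2 * real_of_int (spare_capacity l 2 (s n))"
      using c[of j] c[of 2] by linarith
    assume srv: "\<And>k. used_srv (s n) k \<le> used_srv (s m) k + S" and walk: "used_walk (s m) 2 + S + 4 \<le> used_walk (s n) 2"
    have "spare_capacity l j (s m) + 1 \<le> spare_capacity l j (s n)"
      using walk walks_diff[OF mn] used_chain_mono(3)[OF mn, of 4] j13
      by (intro spare_capacity_increase[OF refl srv]) (auto simp: busy_departures_def)
    then have "\<gamma> j * (real_of_int (spare_capacity l j (s m)) + 1) \<le> \<gamma> j * real_of_int (spare_capacity l j (s n))"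
      using \<gamma>_nonneg by (intro mult_left_mono) auto
    then show "\<gamma> j * real_of_int (spare_capacity l j (s m)) + \<gamma> 2 * real_of_int (spare_capacity l 2 (s m)) + \<gamma> j
        \<le> \<gamma> j * real_of_int (spare_capacity l j (s n)) + \<gamma> 2 * real_of_int (spare_capacity l 2 (s n))"
      using c[of 2] by (simp add: distrib_left)
  qed (use \<gamma>_nonneg \<gamma>_pos in auto)
qed

end

context sample_path
begin

text \<open>
  Suppose that at time \<open>u\<close> the queues and the residual time are small, that the next interarrival
  times exceed \<open>\<kappa> (M + 1)\<close>, and that the next \<open>M\<close> service and walking times are at most \<open>\<kappa>\<close>. Then the
  next \<open>M\<close> events happen within \<open>\<kappa> (M + 1)\<close> time units, each queue receives at most one further
  customer, namely the one whose interarrival time already runs, and so few services are possible: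
  almost all events start walks.
\<close>

lemma few_services_many_walks:
  assumes n: "clock (s n) \<le> u" "u < clock (s (Suc n))"
    and queue: "\<And>k. queue (s n) k \<le> q" and rem: "rem (s n) - (u - clock (s n)) \<le> \<kappa>" and "0 \<le> \<kappa>"
    and arr: "\<And>k. \<kappa> * real (M + 1) < \<tau> k (used_arr (s n) k)"
    and srv: "\<And>k i. i < M \<Longrightarrow> \<sigma> k (used_srv (s n) k + i) \<le> \<kappa>"
    and walk: "\<And>w i. i < M \<Longrightarrow> \<xi> w (used_walk (s n) w + i) \<le> \<kappa>"
  shows "clock (s (n + M)) \<le> u + \<kappa> * real (M + 1)"
    and "(\<Sum>k\<in>UNIV. used_srv (s (n + M)) k) \<le> (\<Sum>k\<in>UNIV. used_srv (s n) k) + 3 * (q + 2)"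
    and "(\<Sum>w\<in>UNIV. used_walk (s n) w) + M \<le> (\<Sum>w\<in>UNIV. used_walk (s (n + M)) w) + (3 * (q + 2) + 3)"
proof -
  have used: "used_srv (s (n + i)) k \<le> used_srv (s n) k + i" "used_walk (s (n + i)) w \<le> used_walk (s n) w + i" for i k w
    by (induction i) (auto simp: chain_simps(2) intro: order_trans[OF used_step_le(1)] order_trans[OF used_step_le(2)])
  have time: "i \<le> M \<Longrightarrow> clock (s (n + i)) + rem (s (n + i)) \<le> u + \<kappa> * real (i + 1)" for i
  proof (induction i)
    case 0
    then show ?case using rem by simp
  next
    case (Suc i)
    note adm = admissible_chain[of "n + i"]
    have IH: "clock (s (n + i)) + rem (s (n + i)) \<le> u + \<kappa> * real (i + 1)" using Suc by simp
    have 1: "\<sigma> k (used_srv (s (n + i)) k) \<le> \<kappa>" for k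
      using srv[of "used_srv (s (n + i)) k - used_srv (s n) k" k] used(1)[of i k] used_chain_mono(2)[of n "n + i" k] Suc.prems by simp
    have 2: "\<xi> w (used_walk (s (n + i)) w) \<le> \<kappa>" for w
      using walk[of "used_walk (s (n + i)) w - used_walk (s n) w" w] used(2)[of i w] used_chain_mono(3)[of n "n + i" w] Suc.prems by simp
    from adm limits
    have "clock (s (n + Suc i)) + rem (s (n + Suc i)) \<le> clock (s (n + i)) + rem (s (n + i)) + \<kappa>"
    proof (cases rule: step_cases[where \<tau> = \<tau> and \<sigma> = \<sigma> and \<xi> = \<xi>])
      case (arrival j)
      then show ?thesis using \<open>0 \<le> \<kappa>\<close> by (simp add: chain_simps(2) event_defs)
    qed (use 1 2 in \<open>simp add: chain_simps(2) event_defs\<close>)+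
    then show ?case using IH by (simp add: algebra_simps)
  qed
  show clk: "clock (s (n + M)) \<le> u + \<kappa> * real (M + 1)"
    using time[of M] admissible_chain[of "n + M"] by (simp add: admissible_def)
  \<comment> \<open>A second arrival would come later than one full interarrival time after \<open>u\<close>.\<close>
  have arrivals: "used_arr (s (n + M)) k \<le> used_arr (s n) k + 1" for k
  proof (rule ccontr)
    assume "\<not> ?thesis"
    then have *: "used_arr (s n) k + 2 \<le> used_arr (s (n + M)) k" by simp
    have "u < clock (s n) + arr (s n) k"
      using n(2) next_event_le(2)[of "s n" k] by (simp add: chain_simps(2) clock_step)
    also have "\<dots> = arr (s 0) k + (\<Sum>i<used_arr (s n) k. \<tau> k i)" by (rule arrival_eq)
    finally have "u + \<kappa> * real (M + 1) < arr (s 0) k + (\<Sum>i<Suc (used_arr (s n) k). \<tau> k i)"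
      using arr[of k] by simp
    also have "\<dots> \<le> arr (s 0) k + (\<Sum>i<used_arr (s (n + M)) k - 1. \<tau> k i)"
      using * nonneg(1) by (intro add_left_mono sum_mono2) auto
    also have "\<dots> \<le> clock (s (n + M))" using * by (intro last_arrival) auto
    finally show False using clk by simp
  qed
  have srv_le: "used_srv (s (n + M)) k \<le> used_srv (s n) k + (q + 2)" for k
  proof -
    have "int (used_srv (s (n + M)) k) \<le> int (used_srv (s n) k) + int (queue (s n) k) + 2"
      using customer_eq[of "n + M" k] customer_eq[of n k] arrivals[of k] by (auto split: if_splits)
    then show ?thesis using queue[of k] by linarith
  qed
  show srv_sum: "(\<Sum>k\<in>UNIV. used_srv (s (n + M)) k) \<le> (\<Sum>k\<in>UNIV. used_srv (s n) k) + 3 * (q + 2)"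
    using srv_le[of 1] srv_le[of 2] srv_le[of 3] by (simp add: sum_3)
  show "(\<Sum>w\<in>UNIV. used_walk (s n) w) + M \<le> (\<Sum>w\<in>UNIV. used_walk (s (n + M)) w) + (3 * (q + 2) + 3)"
    using srv_sum arrivals[of 1] arrivals[of 2] arrivals[of 3] balances_chain(5)[of n] balances_chain(5)[of "n + M"]
    by (simp add: used_total_def sum_3)
qed

end

section \<open>Growth of the queues and of the surplus\<close>

text \<open>
  Interarrival, service and walking times under one index set, so that the values below \<open>used s\<close> and
  those from \<open>used s\<close> on become two disjoint parts of a single independent family.
\<close>

definition used :: "config \<Rightarrow> 3 + 3 + 4 \<Rightarrow> nat" where
  "used s = case_sum (used_arr s) (case_sum (used_srv s) (used_walk s))"

definition calm_values :: "real \<Rightarrow> nat \<Rightarrow> 3 + 3 + 4 \<Rightarrow> real set" where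
  "calm_values \<kappa> M j = (case j of Inl _ \<Rightarrow> {\<kappa> * real (M + 1) <..} | Inr _ \<Rightarrow> {..\<kappa>})"

text \<open>
  The \<open>M\<close> values of each sequence from index \<open>u\<close> on are as \<open>few_services_many_walks\<close> requires; \<open>u\<close> is
  meant to be the number of values used so far.
\<close>

definition calm ::
  "real \<Rightarrow> nat \<Rightarrow> (3 \<Rightarrow> nat \<Rightarrow> real) \<Rightarrow> (3 \<Rightarrow> nat \<Rightarrow> real) \<Rightarrow> (4 \<Rightarrow> nat \<Rightarrow> real) \<Rightarrow> (3 + 3 + 4 \<Rightarrow> nat) \<Rightarrow> bool" where
  "calm \<kappa> M \<tau> \<sigma> \<xi> u \<longleftrightarrow> (\<forall>j. \<forall>i<M. case_sum \<tau> (case_sum \<sigma> \<xi>) j (u j + i) \<in> calm_values \<kappa> M j)"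

definition small_states :: "nat \<Rightarrow> real \<Rightarrow> state set" where
  "small_states q \<kappa> = {(n, a, b, b0, h, i, c). (\<forall>k. n k \<le> q) \<and> b \<le> \<kappa> \<and> b0 \<le> \<kappa>}"

lemma walking_surplusD:
  assumes "walking_surplus d m\<xi> \<gamma> F" "sample_path d \<tau> \<sigma> \<xi> x"
  shows "m \<le> n \<Longrightarrow> F (chain d \<tau> \<sigma> \<xi> x m) \<le> F (chain d \<tau> \<sigma> \<xi> x n)"
    and "\<exists>b. \<forall>n. (\<Sum>k\<in>UNIV. \<gamma> k * real (used_srv (chain d \<tau> \<sigma> \<xi> x n) k)) + F (chain d \<tau> \<sigma> \<xi> x n)
           \<le> (\<Sum>w\<in>UNIV. m\<xi> w * real (used_walk (chain d \<tau> \<sigma> \<xi> x n) w)) + b"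
proof -
  note * = assms(1)[unfolded walking_surplus_def Let_def, THEN conjunct2, THEN conjunct1,
    THEN spec, THEN spec, THEN spec, THEN spec, THEN mp, OF assms(2)]
  from *[THEN conjunct1] show "m \<le> n \<Longrightarrow> F (chain d \<tau> \<sigma> \<xi> x m) \<le> F (chain d \<tau> \<sigma> \<xi> x n)" by blast
  from *[THEN conjunct2] show "\<exists>b. \<forall>n. (\<Sum>k\<in>UNIV. \<gamma> k * real (used_srv (chain d \<tau> \<sigma> \<xi> x n) k)) + F (chain d \<tau> \<sigma> \<xi> x n)
           \<le> (\<Sum>w\<in>UNIV. m\<xi> w * real (used_walk (chain d \<tau> \<sigma> \<xi> x n) w)) + b" .
qed

context lln_path
begin

abbreviation index :: "real \<Rightarrow> nat" where "index \<equiv> event_index d \<tau> \<sigma> \<xi> x"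

lemma clock_unbounded: "\<exists>n. t < T n"
proof -
  obtain a b where ab: "0 \<le> a" "\<And>n. real n \<le> a * T n + b" using events_le_clock by blast
  obtain n where n: "a * \<bar>t\<bar> + b < real n" using reals_Archimedean2 by blast
  have "a * \<bar>t\<bar> < a * T n" using ab(2)[of n] n by linarith
  then have "\<bar>t\<bar> < T n" using ab(1) by (simp add: mult_less_cancel_left)
  then show ?thesis by (intro exI[of _ n]) linarith
qed

lemma index_bounds:
  assumes "0 \<le> t"
  shows "T (index t) \<le> t" "t < T (Suc (index t))"
proof -
  obtain n where "t < T n" using clock_unbounded by blast
  then have "t < T (Suc n)" using clock_chain_mono[of n "Suc n"] by simp
  then show "t < T (Suc (index t))" unfolding event_index_def by (rule LeastI)
  show "T (index t) \<le> t"
  proof (cases "index t")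
    case 0
    then show ?thesis using assms by (simp add: clock_chain_0)
  next
    case (Suc m)
    then show ?thesis using not_less_Least[of m "\<lambda>n. t < T (Suc n)"] by (simp add: event_index_def)
  qed
qed

lemma index_ge:
  assumes "T n \<le> t" shows "n \<le> index t"
proof (rule ccontr)
  assume "\<not> n \<le> index t"
  then have "T (Suc (index t)) \<le> T n" by (intro clock_chain_mono) simp
  then show False using index_bounds(2)[of t] assms clock_nonneg[of n] by linarith
qed

lemma sum_queues_le:
  assumes "\<And>k. 0 \<le> g k"
  shows "(\<Sum>k\<in>UNIV. g k * real (queue c k)) \<le> ((\<Sum>k\<in>UNIV. g k) + 1) * real (\<Sum>k\<in>UNIV. queue c k)"
proof -
  have "g k \<le> (\<Sum>k\<in>UNIV. g k) + 1" for k
    using member_le_sum[of k UNIV g] assms by simp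
  then have "(\<Sum>k\<in>UNIV. g k * real (queue c k)) \<le> (\<Sum>k\<in>UNIV. ((\<Sum>k\<in>UNIV. g k) + 1) * real (queue c k))"
    by (intro sum_mono mult_right_mono) auto
  then show ?thesis by (simp only: sum_distrib_left[symmetric] of_nat_sum)
qed

lemma surplus_le_queues:
  assumes F: "walking_surplus d m\<xi> \<gamma> F" and \<epsilon>: "0 < \<epsilon>"
  defines "L \<equiv> \<Sum>k\<in>UNIV. (m\<sigma> k + \<gamma> k) / m\<tau> k"
  defines "G \<equiv> (\<Sum>k\<in>UNIV. m\<sigma> k + \<gamma> k) + 1"
  shows "\<exists>c. \<forall>n. (L - 1) * T n + F (s n) \<le> \<epsilon> * T n + G * real (\<Sum>k\<in>UNIV. queue (s n) k) + c"
proof -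
  have \<gamma>: "0 \<le> \<gamma> k" for k using F by (simp add: walking_surplus_def)
  have "\<exists>b. \<forall>n. (\<Sum>k\<in>UNIV. \<gamma> k * real (used_srv (s n) k)) + F (s n) \<le> (\<Sum>w\<in>UNIV. m\<xi> w * real (used_walk (s n) w)) + b"
    by (rule walking_surplusD(2)[OF F sample_path_axioms])
  then obtain b where b: "\<And>n. (\<Sum>k\<in>UNIV. \<gamma> k * real (used_srv (s n) k)) + F (s n) \<le> (\<Sum>w\<in>UNIV. m\<xi> w * real (used_walk (s n) w)) + b"
    by (elim exE) (rule that, erule spec)
  obtain c where c: "\<forall>n. (L - 1) * T n + F (s n) \<le> \<epsilon> * T n + (\<Sum>k\<in>UNIV. (m\<sigma> k + \<gamma> k) * real (queue (s n) k)) + c"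
    using load_balance[where \<gamma> = \<gamma> and \<Delta> = "\<lambda>n. F (s n)", OF \<gamma> b \<epsilon>, folded L_def] by (elim exE) (rule that)
  have "(L - 1) * T n + F (s n) \<le> \<epsilon> * T n + G * real (\<Sum>k\<in>UNIV. queue (s n) k) + c" for n
    using spec[OF c, of n] sum_queues_le[of "\<lambda>k. m\<sigma> k + \<gamma> k" "s n"] \<gamma> means(2) unfolding G_def by (simp add: add_nonneg_nonneg)
  then show ?thesis by blast
qed

lemma surplus_mono: "walking_surplus d m\<xi> \<gamma> F \<Longrightarrow> m \<le> n \<Longrightarrow> F (s m) \<le> F (s n)"
  by (rule walking_surplusD(1)[OF _ sample_path_axioms])

text \<open>
  As \<open>F\<close> is bounded below, the surplus inequality bounds the queues below by a multiple of the time.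
\<close>

lemma queues_diverge:
  assumes F: "walking_surplus d m\<xi> \<gamma> F" and L: "1 < (\<Sum>k\<in>UNIV. (m\<sigma> k + \<gamma> k) / m\<tau> k)"
  shows "filterlim (\<lambda>t. \<Sum>k\<in>UNIV. queues (path d \<tau> \<sigma> \<xi> x t) k) at_top at_top"
proof -
  define L where "L = (\<Sum>k\<in>UNIV. (m\<sigma> k + \<gamma> k) / m\<tau> k)"
  define G where "G = (\<Sum>k\<in>UNIV. m\<sigma> k + \<gamma> k) + 1"
  have \<gamma>: "0 \<le> \<gamma> k" for k using F by (simp add: walking_surplus_def)
  have G: "0 < G" unfolding G_def using \<gamma> means(2) by (intro add_nonneg_pos sum_nonneg add_nonneg_nonneg) auto
  have e: "0 < (L - 1) / 2" using L by (simp add: L_def)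
  obtain c where c: "\<forall>n. (L - 1) * T n + F (s n) \<le> (L - 1) / 2 * T n + G * real (\<Sum>k\<in>UNIV. queue (s n) k) + c"
    using surplus_le_queues[OF F e, folded L_def G_def] by (elim exE) (rule that)
  show ?thesis
    unfolding filterlim_at_top
  proof
    fix z :: nat
    obtain n where n: "(G * real z + c - F (s 0)) / ((L - 1) / 2) < T n" using clock_unbounded by blast
    show "eventually (\<lambda>t. z \<le> (\<Sum>k\<in>UNIV. queues (path d \<tau> \<sigma> \<xi> x t) k)) at_top"
    proof (rule eventually_at_top_linorderI[of "T n"])
      fix t assume "T n \<le> t"
      then have "T n \<le> T (index t)" by (intro clock_chain_mono index_ge)
      with n have "(G * real z + c - F (s 0)) / ((L - 1) / 2) < T (index t)" by simp
      then have 1: "G * real z + c - F (s 0) < T (index t) * ((L - 1) / 2)"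
        by (rule pos_divide_less_eq[THEN iffD1, OF e])
      define y where "y = T (index t) * ((L - 1) / 2)"
      have 2: "(L - 1) * T (index t) = 2 * y" "(L - 1) / 2 * T (index t) = y" by (simp_all add: y_def)
      have "G * real z \<le> G * real (\<Sum>k\<in>UNIV. queue (s (index t)) k)"
        using spec[OF c, of "index t"] surplus_mono[OF F, of 0 "index t"] 1 unfolding 2 y_def[symmetric] by linarith
      then have "z \<le> (\<Sum>k\<in>UNIV. queue (s (index t)) k)" using G by (simp add: mult_le_cancel_left del: of_nat_sum)
      then show "z \<le> (\<Sum>k\<in>UNIV. queues (path d \<tau> \<sigma> \<xi> x t) k)" by (simp add: queues_path)
    qed
  qed
qed

text \<open>
  Time is cut into blocks of length \<open>\<kappa> (M + 1)\<close>, and a block counts if it begins in a small state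
  with calm values ahead.
\<close>

definition calm_blocks :: "nat \<Rightarrow> real \<Rightarrow> nat \<Rightarrow> nat \<Rightarrow> nat set" where
  "calm_blocks q \<kappa> M N = {j. j < N \<and> path d \<tau> \<sigma> \<xi> x (real j * (\<kappa> * real (M + 1))) \<in> small_states q \<kappa> \<and>
     calm \<kappa> M \<tau> \<sigma> \<xi> (used (s (index (real j * (\<kappa> * real (M + 1))))))}"

text \<open>
  Each counted block contains a stretch of few services and many walks, which lies inside the block;
  as \<open>F\<close> never decreases, the gains of different blocks add up.
\<close>

lemma surplus_calm_blocks:
  assumes F: "walking_surplus d m\<xi> \<gamma> F" and \<kappa>: "0 < \<kappa>"
    and inc: "gains_from_walking d F (3 * (q + 2)) W \<delta>"
    and M: "M = W + (3 * (q + 2) + 3)"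
  shows "\<delta> * real (card (calm_blocks q \<kappa> M N)) \<le> F (s (index (real N * (\<kappa> * real (M + 1))))) - F (s 0)"
proof (induction N)
  case 0
  then show ?case using surplus_mono[OF F, of 0 "index 0"] by (simp add: calm_blocks_def)
next
  case (Suc N)
  define K where "K = \<kappa> * real (M + 1)"
  have K: "0 < K" using \<kappa> by (simp add: K_def)
  define n where "n = index (real N * K)"
  define n' where "n' = index (real (Suc N) * K)"
  have NK: "0 \<le> real N * K" "real (Suc N) * K = real N * K + K" using K by (auto simp: algebra_simps)
  have bounds: "T n \<le> real N * K" "real N * K < T (Suc n)" unfolding n_def by (intro index_bounds NK)+
  have "n \<le> n'" unfolding n'_def using bounds(1) K NK by (intro index_ge) simp
  have fin: "finite (calm_blocks q \<kappa> M N)" by (simp add: calm_blocks_def)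
  show ?case
  proof (cases "N \<in> calm_blocks q \<kappa> M (Suc N)")
    case False
    then have "calm_blocks q \<kappa> M (Suc N) = calm_blocks q \<kappa> M N" by (auto simp: calm_blocks_def less_Suc_eq)
    then show ?thesis using Suc surplus_mono[OF F \<open>n \<le> n'\<close>] by (simp add: n_def n'_def K_def)
  next
    case True
    then have eq: "calm_blocks q \<kappa> M (Suc N) = insert N (calm_blocks q \<kappa> M N)" "N \<notin> calm_blocks q \<kappa> M N"
      by (auto simp: calm_blocks_def less_Suc_eq)
    from True have small: "path d \<tau> \<sigma> \<xi> x (real N * K) \<in> small_states q \<kappa>" and calm: "calm \<kappa> M \<tau> \<sigma> \<xi> (used (s n))"
      by (auto simp: calm_blocks_def n_def K_def)
    have q: "queue (s n) k \<le> q" for k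
      using small by (simp add: path_eq observe_def advance_def small_states_def n_def)
    have r: "rem (s n) - (real N * K - T n) \<le> \<kappa>"
      using small by (simp add: path_eq observe_def advance_def small_states_def n_def split: if_splits)
    have M0: "0 < M" using M by simp
    have calm': "\<And>j i. i < M \<Longrightarrow> case_sum \<tau> (case_sum \<sigma> \<xi>) j (used (s n) j + i) \<in> calm_values \<kappa> M j"
      using calm by (simp add: calm_def)
    have fresh: "\<kappa> * real (M + 1) < \<tau> k (used_arr (s n) k)" "i < M \<Longrightarrow> \<sigma> k (used_srv (s n) k + i) \<le> \<kappa>"
       "i < M \<Longrightarrow> \<xi> w (used_walk (s n) w + i) \<le> \<kappa>" for k w i
      using calm'[of 0 "Inl k"] calm'[of i "Inr (Inl k)"] calm'[of i "Inr (Inr w)"] M0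
      by (simp_all add: calm_values_def used_def)
    note block = few_services_many_walks[OF bounds q r less_imp_le[OF \<kappa>] fresh]
    have "F (s n) + \<delta> \<le> F (s (n + M))"
    proof (rule gains_from_walkingD[OF inc sample_path_axioms])
      show "(\<Sum>w\<in>UNIV. used_walk (s n) w) + W \<le> (\<Sum>w\<in>UNIV. used_walk (s (n + M)) w)"
        using block(3) M by linarith
    qed (simp, rule block(2))
    also have "\<dots> \<le> F (s n')"
      unfolding n'_def
    proof (intro surplus_mono[OF F] index_ge)
      show "T (n + M) \<le> real (Suc N) * K" using block(1) NK(2) by (simp only: K_def)
    qed
    finally have "F (s n) + \<delta> \<le> F (s n')" .
    then show ?thesis using Suc fin eq by (simp add: n_def n'_def K_def distrib_left)
  qed
qed

text \<open>
  By the surplus inequality with load at least 1, \<open>F\<close> is \<open>o(N)\<close> whenever the queues are bounded, and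
  the number of counted blocks is at most a multiple of \<open>F\<close>.
\<close>

lemma calm_blocks_rare:
  assumes F: "walking_surplus d m\<xi> \<gamma> F" and L: "1 \<le> (\<Sum>k\<in>UNIV. (m\<sigma> k + \<gamma> k) / m\<tau> k)" and \<kappa>: "0 < \<kappa>"
    and \<delta>: "0 < \<delta>"
    and inc: "gains_from_walking d F (3 * (q + 2)) W \<delta>"
    and M: "M = W + (3 * (q + 2) + 3)"
  shows "(\<lambda>N. if (\<Sum>k\<in>UNIV. queues (path d \<tau> \<sigma> \<xi> x (real N * (\<kappa> * real (M + 1)))) k) \<le> r
      then real (card (calm_blocks q \<kappa> M N)) / real N else 0) \<longlonglongrightarrow> 0" (is "?f \<longlonglongrightarrow> 0")
proof (rule LIMSEQ_I)
  fix e :: real assume e: "0 < e"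
  define K where "K = \<kappa> * real (M + 1)"
  have K: "0 < K" using \<kappa> by (simp add: K_def)
  define L where "L = (\<Sum>k\<in>UNIV. (m\<sigma> k + \<gamma> k) / m\<tau> k)"
  define G where "G = (\<Sum>k\<in>UNIV. m\<sigma> k + \<gamma> k) + 1"
  have \<gamma>: "0 \<le> \<gamma> k" for k using F by (simp add: walking_surplus_def)
  have G: "0 < G" unfolding G_def using \<gamma> means(2) by (intro add_nonneg_pos sum_nonneg add_nonneg_nonneg) auto
  have e': "0 < e * \<delta> / (2 * K)" using e \<delta> K by simp
  obtain c where c: "\<forall>n. (L - 1) * T n + F (s n) \<le> e * \<delta> / (2 * K) * T n + G * real (\<Sum>k\<in>UNIV. queue (s n) k) + c"
    using surplus_le_queues[OF F e', folded L_def G_def] by (elim exE) (rule that)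
  define b where "b = G * real r + \<bar>c - F (s 0)\<bar>"
  obtain N0 :: nat where N0: "2 * b / (e * \<delta>) < real N0" using reals_Archimedean2 by blast
  show "\<exists>n0. \<forall>n\<ge>n0. norm (?f n - 0) < e"
  proof (intro exI[of _ "Suc N0"] allI impI)
    fix N assume N: "Suc N0 \<le> N"
    have "norm ((if (\<Sum>k\<in>UNIV. queues (path d \<tau> \<sigma> \<xi> x (real N * K)) k) \<le> r
      then real (card (calm_blocks q \<kappa> M N)) / real N else 0) - 0) < e"
    proof (cases "(\<Sum>k\<in>UNIV. queues (path d \<tau> \<sigma> \<xi> x (real N * K)) k) \<le> r")
      case True
      define n where "n = index (real N * K)"
      have Q: "(\<Sum>k\<in>UNIV. queue (s n) k) \<le> r" using True by (simp add: queues_path n_def)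
      have Tn: "T n \<le> real N * K" unfolding n_def using K by (intro index_bounds) simp
      have "\<delta> * real (card (calm_blocks q \<kappa> M N)) \<le> F (s n) - F (s 0)"
        unfolding n_def K_def by (rule surplus_calm_blocks[OF F \<kappa> inc M])
      also have "F (s n) \<le> e * \<delta> / (2 * K) * T n + G * real (\<Sum>k\<in>UNIV. queue (s n) k) + c"
      proof -
        have "0 \<le> (L - 1) * T n" using L clock_nonneg by (intro mult_nonneg_nonneg) (simp_all add: L_def)
        then show ?thesis using spec[OF c, of n] by linarith
      qed
      also have "e * \<delta> / (2 * K) * T n \<le> e * \<delta> / (2 * K) * (real N * K)"
        using Tn e' by (intro mult_left_mono) auto
      also have "\<dots> = e * \<delta> / 2 * real N" using K by (simp add: field_simps)
      also have "G * real (\<Sum>k\<in>UNIV. queue (s n) k) \<le> G * real r"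
        using Q G by (intro mult_left_mono) (simp_all del: of_nat_sum)
      finally have "\<delta> * real (card (calm_blocks q \<kappa> M N)) \<le> e * \<delta> / 2 * real N + b"
        by (simp add: b_def)
      also have "b < e * \<delta> / 2 * real N"
      proof -
        have "2 * b / (e * \<delta>) < real N" using N0 N by linarith
        then show ?thesis using e \<delta> by (simp add: field_simps)
      qed
      finally have "\<delta> * real (card (calm_blocks q \<kappa> M N)) < \<delta> * (e * real N)" by (simp add: algebra_simps)
      then have "real (card (calm_blocks q \<kappa> M N)) < e * real N" using \<delta> by simp
      then show ?thesis using N True e by (simp add: divide_less_eq)
    qed (use e in simp)
    then show "norm (?f N - 0) < e" by (simp only: K_def)
  qed
qed

end

section \<open>Measurability of the path\<close>

lemma countable_finite_type: "countable (I :: 'i::finite set)"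
  by (rule countable_finite) simp

text \<open>
  Configurations are records without a measurable space of their own; componentwise measurability
  suffices for every quantity that is read off a configuration.
\<close>

definition measurable_config :: "'z measure \<Rightarrow> ('z \<Rightarrow> config) \<Rightarrow> bool" where
  "measurable_config N f \<longleftrightarrow>
     (\<lambda>z. clock (f z)) \<in> borel_measurable N \<and> (\<forall>k. (\<lambda>z. queue (f z) k) \<in> measurable N (count_space UNIV)) \<and>
     (\<forall>k. (\<lambda>z. arr (f z) k) \<in> borel_measurable N) \<and> (\<lambda>z. serving (f z)) \<in> measurable N (count_space UNIV) \<and>
     (\<lambda>z. rem (f z)) \<in> borel_measurable N \<and> (\<lambda>z. pos (f z)) \<in> measurable N (count_space UNIV) \<and>
     (\<lambda>z. switch (f z)) \<in> measurable N (count_space UNIV) \<and> (\<lambda>z. count (f z)) \<in> measurable N (count_space UNIV) \<and>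
     (\<forall>k. (\<lambda>z. used_arr (f z) k) \<in> measurable N (count_space UNIV)) \<and>
     (\<forall>k. (\<lambda>z. used_srv (f z) k) \<in> measurable N (count_space UNIV)) \<and>
     (\<forall>w. (\<lambda>z. used_walk (f z) w) \<in> measurable N (count_space UNIV))"

lemma measurable_configD:
  assumes "measurable_config N f"
  shows "(\<lambda>z. clock (f z)) \<in> borel_measurable N" "(\<lambda>z. queue (f z) k) \<in> measurable N (count_space UNIV)"
     "(\<lambda>z. arr (f z) k) \<in> borel_measurable N" "(\<lambda>z. serving (f z)) \<in> measurable N (count_space UNIV)"
     "(\<lambda>z. rem (f z)) \<in> borel_measurable N" "(\<lambda>z. pos (f z)) \<in> measurable N (count_space UNIV)"
     "(\<lambda>z. switch (f z)) \<in> measurable N (count_space UNIV)" "(\<lambda>z. count (f z)) \<in> measurable N (count_space UNIV)"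
     "(\<lambda>z. used_arr (f z) k) \<in> measurable N (count_space UNIV)"
     "(\<lambda>z. used_srv (f z) k) \<in> measurable N (count_space UNIV)"
     "(\<lambda>z. used_walk (f z) w) \<in> measurable N (count_space UNIV)"
  using assms unfolding measurable_config_def by blast+

lemma measurable_config_if:
  assumes [measurable]: "Measurable.pred N P" and f: "measurable_config N f" and g: "measurable_config N g"
  shows "measurable_config N (\<lambda>z. if P z then f z else g z)"
proof -
  note [measurable] = measurable_configD[OF f] measurable_configD[OF g]
  show ?thesis unfolding measurable_config_def if_distrib if_distribR by (intro conjI allI) measurable
qed

text \<open>
  Stations and links are finitely many, so a family may be evaluated at a random one of them.
\<close>

lemma measurable_apply_random_index:
  assumes "\<And>k. (\<lambda>z. f z k) \<in> measurable N L" "(\<lambda>z. p z) \<in> measurable N (count_space (UNIV :: 'i::finite set))"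
  shows "(\<lambda>z. f z (p z)) \<in> measurable N L"
  using measurable_compose_countable'[of UNIV "\<lambda>i z. f z i", OF assms(1) assms(2)] countable_finite_type by simp

lemma measurable_config_random_index:
  fixes p :: "'z \<Rightarrow> nat"
  assumes f: "\<And>n. measurable_config N (f n)" and p: "p \<in> measurable N (count_space UNIV)"
  shows "measurable_config N (\<lambda>z. f (p z) z)"
proof -
  have c: "(\<lambda>z. F (f (p z) z)) \<in> measurable N L" if "\<And>n. (\<lambda>z. F (f n z)) \<in> measurable N L" for L and F :: "config \<Rightarrow> 'c"
    by (rule measurable_compose_countable[of "\<lambda>n z. F (f n z)", OF that p])
  note m = measurable_configD[OF f]
  show ?thesis
    unfolding measurable_config_def
    using c[of clock, OF m(1)] c[of "\<lambda>s. queue s k" for k, OF m(2)] c[of "\<lambda>s. arr s k" for k, OF m(3)]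
      c[of serving, OF m(4)] c[of rem, OF m(5)] c[of pos, OF m(6)] c[of switch, OF m(7)] c[of count, OF m(8)]
      c[of "\<lambda>s. used_arr s k" for k, OF m(9)] c[of "\<lambda>s. used_srv s k" for k, OF m(10)]
      c[of "\<lambda>s. used_walk s k" for k, OF m(11)]
    by blast
qed

lemma measurable_next_event:
  assumes f: "measurable_config N f"
  shows "(\<lambda>z. next_event (f z)) \<in> borel_measurable N"
proof -
  note [measurable] = measurable_configD[OF f]
  have "next_event (f z) = min (rem (f z)) (min (arr (f z) 1) (min (arr (f z) 2) (arr (f z) 3)))" for z
    by (simp add: next_event_def UNIV_3)
  then show ?thesis by simp
qed

lemma measurable_config_advance:
  assumes f: "measurable_config N f" and [measurable]: "u \<in> borel_measurable N"
  shows "measurable_config N (\<lambda>z. advance (u z) (f z))"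
proof -
  note [measurable] = measurable_configD[OF f]
  show ?thesis unfolding measurable_config_def advance_def by simp
qed

context
  fixes N :: "'z measure" and \<tau> \<sigma> :: "'z \<Rightarrow> 3 \<Rightarrow> nat \<Rightarrow> real" and \<xi> :: "'z \<Rightarrow> 4 \<Rightarrow> nat \<Rightarrow> real"
  assumes inputs: "\<And>k n. (\<lambda>z. \<tau> z k n) \<in> borel_measurable N" "\<And>k n. (\<lambda>z. \<sigma> z k n) \<in> borel_measurable N"
    "\<And>w n. (\<lambda>z. \<xi> z w n) \<in> borel_measurable N"
begin

lemma measurable_config_arrival:
  assumes f: "measurable_config N f"
  shows "measurable_config N (\<lambda>z. arrival d (\<tau> z) k (f z))"
proof -
  note [measurable] = measurable_configD[OF f] inputs
  have [measurable]: "(\<lambda>z. \<tau> z k (used_arr (f z) k)) \<in> borel_measurable N"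
    by (rule measurable_compose_countable[of "\<lambda>n z. \<tau> z k n"]) measurable
  show ?thesis unfolding measurable_config_def arrival_def by simp
qed

lemma measurable_config_start_service:
  assumes f: "measurable_config N f"
  shows "measurable_config N (\<lambda>z. start_service (\<sigma> z) (f z))"
proof -
  note [measurable] = measurable_configD[OF f] inputs
  have [measurable]: "(\<lambda>z. used_srv (f z) (pos (f z))) \<in> measurable N (count_space UNIV)"
    by (rule measurable_apply_random_index) measurable
  have "(\<lambda>z. \<sigma> z k (used_srv (f z) (pos (f z)))) \<in> borel_measurable N" for k
    by (rule measurable_compose_countable[of "\<lambda>n z. \<sigma> z k n"]) measurable
  then have [measurable]: "(\<lambda>z. \<sigma> z (pos (f z)) (used_srv (f z) (pos (f z)))) \<in> borel_measurable N"
    by (rule measurable_apply_random_index[of "\<lambda>z k. \<sigma> z k (used_srv (f z) (pos (f z)))"]) measurable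
  show ?thesis unfolding measurable_config_def start_service_def Let_def by simp
qed

lemma measurable_config_leave:
  assumes f: "measurable_config N f"
  shows "measurable_config N (\<lambda>z. leave (\<xi> z) (f z))"
proof -
  note [measurable] = measurable_configD[OF f] inputs
  have [measurable]: "(\<lambda>z. link (pos (f z)) (switch (f z))) \<in> measurable N (count_space UNIV)"
    unfolding link_def by measurable
  have [measurable]: "(\<lambda>z. used_walk (f z) (link (pos (f z)) (switch (f z)))) \<in> measurable N (count_space UNIV)"
    by (rule measurable_apply_random_index) measurable
  have "(\<lambda>z. \<xi> z w (used_walk (f z) (link (pos (f z)) (switch (f z))))) \<in> borel_measurable N" for w
    by (rule measurable_compose_countable[of "\<lambda>n z. \<xi> z w n"]) measurable
  then have [measurable]: "(\<lambda>z. \<xi> z (link (pos (f z)) (switch (f z))) (used_walk (f z) (link (pos (f z)) (switch (f z))))) \<in> borel_measurable N"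
    by (rule measurable_apply_random_index[of "\<lambda>z w. \<xi> z w (used_walk (f z) (link (pos (f z)) (switch (f z))))"]) measurable
  have [measurable]: "(\<lambda>z. pos (f z) + 1) \<in> measurable N (count_space UNIV)"
    by (rule measurable_compose[OF measurable_configD(6)[OF f], of "\<lambda>k. k + 1"]) simp
  show ?thesis unfolding measurable_config_def leave_def Let_def by simp
qed

lemma measurable_may_serve:
  assumes f: "measurable_config N f"
  shows "Measurable.pred N (\<lambda>z. may_serve d (pos (f z)) (queue (f z) (pos (f z))) (count (f z)))"
proof -
  note [measurable] = measurable_configD[OF f]
  have [measurable]: "(\<lambda>z. queue (f z) (pos (f z))) \<in> measurable N (count_space UNIV)"
    by (rule measurable_apply_random_index) measurable
  have "Measurable.pred N (\<lambda>z. may_serve d k n (count (f z)))" for k n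
    by (rule measurable_compose[OF measurable_configD(8)[OF f]]) simp
  then have "Measurable.pred N (\<lambda>z. may_serve d k (queue (f z) (pos (f z))) (count (f z)))" for k
    by (rule measurable_compose_countable[of "\<lambda>n z. may_serve d k n (count (f z))"]) measurable
  then show ?thesis
    by (rule measurable_apply_random_index[of "\<lambda>z k. may_serve d k (queue (f z) (pos (f z))) (count (f z))"]) measurable
qed

lemma measurable_config_step:
  assumes f: "measurable_config N f"
  shows "measurable_config N (\<lambda>z. step d (\<tau> z) (\<sigma> z) (\<xi> z) (f z))"
proof -
  define g where "g z = advance (next_event (f z)) (f z)" for z
  have g: "measurable_config N g"
    unfolding g_def by (intro measurable_config_advance f measurable_next_event)
  note [measurable] = measurable_configD[OF g]
  define h where "h z = (if serving (g z) then complete_service d (g z) else reach_station (g z))" for z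
  have q: "(\<lambda>z. queue (g z) (pos (g z)) - 1) \<in> measurable N (count_space UNIV)"
    by (rule measurable_apply_random_index[of "\<lambda>z k. queue (g z) k - 1"]) measurable
  have c: "measurable_config N (\<lambda>z. complete_service d (g z))"
    using q by (cases d) (simp_all add: measurable_config_def complete_service_def)
  have r: "measurable_config N (\<lambda>z. reach_station (g z))"
    by (simp add: measurable_config_def reach_station_def)
  have h: "measurable_config N h"
    unfolding h_def by (intro measurable_config_if c r) measurable
  have srv: "measurable_config N (\<lambda>z. server_event d (\<sigma> z) (\<xi> z) (g z))"
    unfolding server_event_def serve_or_leave_def h_def[symmetric]
    by (intro measurable_config_if measurable_may_serve measurable_config_start_service measurable_config_leave h)
  have eq: "step d (\<tau> z) (\<sigma> z) (\<xi> z) (f z) = (if arr (g z) 1 = 0 then arrival d (\<tau> z) 1 (g z)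
      else if arr (g z) 2 = 0 then arrival d (\<tau> z) 2 (g z)
      else if arr (g z) 3 = 0 then arrival d (\<tau> z) 3 (g z)
      else server_event d (\<sigma> z) (\<xi> z) (g z))" for z
    by (simp only: step_def Let_def g_def next_event_def)
  show ?thesis
    unfolding eq by (intro measurable_config_if measurable_config_arrival g srv) measurable
qed

lemma measurable_config_chain:
  assumes x: "measurable_config N (\<lambda>z. init (x z))"
  shows "measurable_config N (\<lambda>z. chain d (\<tau> z) (\<sigma> z) (\<xi> z) (x z) n)"
  by (induction n) (simp_all add: chain_simps x measurable_config_step)

lemma measurable_event_index:
  assumes x: "measurable_config N (\<lambda>z. init (x z))"
  shows "(\<lambda>z. event_index d (\<tau> z) (\<sigma> z) (\<xi> z) (x z) t) \<in> measurable N (count_space UNIV)"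
proof -
  note [measurable] = measurable_configD(1)[OF measurable_config_chain[OF x]]
  show ?thesis unfolding event_index_def by measurable
qed

lemma measurable_config_at_event_index:
  assumes x: "measurable_config N (\<lambda>z. init (x z))"
  shows "measurable_config N (\<lambda>z. chain d (\<tau> z) (\<sigma> z) (\<xi> z) (x z) (event_index d (\<tau> z) (\<sigma> z) (\<xi> z) (x z) t))"
  by (rule measurable_config_random_index[OF measurable_config_chain[OF x] measurable_event_index[OF x]])

end

lemma measurable_used:
  assumes f: "measurable_config N f"
  shows "(\<lambda>z. used (f z)) \<in> measurable N (count_space UNIV)"
proof -
  have *: "(\<lambda>z. used (f z) j) \<in> measurable N (count_space UNIV)" for j
  proof (cases j)
    case (Inr j')
    then show ?thesis using measurable_configD[OF f] by (cases j') (simp_all add: used_def)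
  qed (use measurable_configD[OF f] in \<open>simp add: used_def\<close>)
  have "Measurable.pred N (\<lambda>z. \<forall>j\<in>UNIV. used (f z) j = u j)" for u
    using * by (intro pred_intros_finite) simp_all
  then have "{z \<in> space N. \<forall>j\<in>UNIV. used (f z) j = u j} \<in> sets N" for u
    by (simp add: pred_def)
  moreover have "{z \<in> space N. used (f z) = u} = {z \<in> space N. \<forall>j\<in>UNIV. used (f z) j = u j}" for u
    by auto
  ultimately have "(\<lambda>z. used (f z)) -` {u} \<inter> space N \<in> sets N" for u
    by (simp add: vimage_def Int_def conj_commute)
  then show ?thesis
    by (intro measurable_count_space_eq_countable[THEN iffD2]) auto
qed

lemma measurable_small_states:
  assumes f: "measurable_config N f" and [measurable]: "u \<in> borel_measurable N"
  shows "Measurable.pred N (\<lambda>z. observe (advance (u z) (f z)) \<in> small_states q \<kappa>)"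
proof -
  note [measurable] = measurable_configD[OF f]
  have "Measurable.pred N (\<lambda>z. (\<forall>k. queue (f z) k \<le> q) \<and> (if serving (f z) then rem (f z) - u z else 0) \<le> \<kappa>
      \<and> (if serving (f z) then 0 else rem (f z) - u z) \<le> \<kappa>)"
    unfolding forall_3 by measurable
  then show ?thesis by (simp add: observe_def advance_def small_states_def cong: if_cong)
qed

lemma init_eq: "init x = \<lparr>clock = 0, queue = fst x, arr = fst (snd x), serving = (0 < fst (snd (snd x))),
    rem = (if 0 < fst (snd (snd x)) then fst (snd (snd x)) else fst (snd (snd (snd x)))),
      pos = fst (snd (snd (snd (snd x)))), switch = fst (snd (snd (snd (snd (snd x))))), count = snd (snd (snd (snd (snd (snd x))))),
      used_arr = (\<lambda>_. 0), used_srv = (\<lambda>_. 0), used_walk = (\<lambda>_. 0)\<rparr>"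
  by (cases x) simp

lemma measurable_config_init: "measurable_config (state_space d) init"
proof -
  let ?B = "(\<Pi>\<^sub>M k\<in>UNIV. count_space UNIV) \<Otimes>\<^sub>M (\<Pi>\<^sub>M k\<in>UNIV. borel) \<Otimes>\<^sub>M borel \<Otimes>\<^sub>M borel \<Otimes>\<^sub>M
      count_space UNIV \<Otimes>\<^sub>M count_space UNIV \<Otimes>\<^sub>M count_space UNIV :: state measure"
  have [measurable]: "(\<lambda>x. fst x k) \<in> measurable ?B (count_space UNIV)" for k
    by (rule measurable_compose[OF measurable_fst measurable_component_singleton]) simp
  have "snd \<in> measurable ?B ((\<Pi>\<^sub>M k\<in>UNIV. borel) \<Otimes>\<^sub>M borel \<Otimes>\<^sub>M borel \<Otimes>\<^sub>M
      count_space UNIV \<Otimes>\<^sub>M count_space UNIV \<Otimes>\<^sub>M count_space UNIV)" by simp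
  from measurable_compose[OF this measurable_fst]
  have [measurable]: "(\<lambda>x. fst (snd x) k) \<in> measurable ?B borel" for k
    by (rule measurable_compose[OF _ measurable_component_singleton]) simp
  have "measurable_config ?B init"
    unfolding measurable_config_def init_eq config.simps by (intro conjI allI) measurable
  then show ?thesis
    unfolding measurable_config_def state_space_def by (auto intro: measurable_restrict_space1)
qed

lemma small_states_in_sets: "small_states q \<kappa> \<inter> states d \<in> sets (state_space d)"
proof -
  let ?B = "(\<Pi>\<^sub>M k\<in>UNIV. count_space UNIV) \<Otimes>\<^sub>M (\<Pi>\<^sub>M k\<in>UNIV. borel) \<Otimes>\<^sub>M borel \<Otimes>\<^sub>M borel \<Otimes>\<^sub>M
      count_space UNIV \<Otimes>\<^sub>M count_space UNIV \<Otimes>\<^sub>M count_space UNIV :: state measure"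
  have [measurable]: "(\<lambda>x. fst x k) \<in> measurable ?B (count_space UNIV)" for k
    by (rule measurable_compose[OF measurable_fst measurable_component_singleton]) simp
  have "{x \<in> space ?B. (\<forall>k. fst x k \<le> q) \<and> fst (snd (snd x)) \<le> \<kappa> \<and> fst (snd (snd (snd x))) \<le> \<kappa>} \<in> sets ?B"
    unfolding forall_3 by measurable
  also have "{x \<in> space ?B. (\<forall>k. fst x k \<le> q) \<and> fst (snd (snd x)) \<le> \<kappa> \<and> fst (snd (snd (snd x))) \<le> \<kappa>} = small_states q \<kappa>"
  proof (rule set_eqI)
    fix x :: state
    show "x \<in> {x \<in> space ?B. (\<forall>k. fst x k \<le> q) \<and> fst (snd (snd x)) \<le> \<kappa> \<and> fst (snd (snd (snd x))) \<le> \<kappa>} \<longleftrightarrow> x \<in> small_states q \<kappa>"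
      by (cases x) (simp add: small_states_def space_pair_measure space_PiM)
  qed
  finally have "small_states q \<kappa> \<in> sets ?B" .
  then show ?thesis
    unfolding state_space_def sets_restrict_space by (rule image_eqI[rotated]) (simp add: Int_commute)
qed

lemma space_state_space: "space (state_space d) = states d"
  by (auto simp: state_space_def space_restrict_space space_pair_measure space_PiM)

section \<open>Past and fresh values are independent\<close>

abbreviation input_chain :: "discipline \<Rightarrow> (3 + 3 + 4 \<Rightarrow> nat \<Rightarrow> real) \<Rightarrow> state \<Rightarrow> nat \<Rightarrow> config" where
  "input_chain d y \<equiv> chain d (\<lambda>k. y (Inl k)) (\<lambda>k. y (Inr (Inl k))) (\<lambda>w. y (Inr (Inr w)))"

abbreviation input_step :: "discipline \<Rightarrow> (3 + 3 + 4 \<Rightarrow> nat \<Rightarrow> real) \<Rightarrow> config \<Rightarrow> config" where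
  "input_step d y \<equiv> step d (\<lambda>k. y (Inl k)) (\<lambda>k. y (Inr (Inl k))) (\<lambda>w. y (Inr (Inr w)))"

lemma used_simps [simp]:
  "used s (Inl k) = used_arr s k" "used s (Inr (Inl k)) = used_srv s k" "used s (Inr (Inr w)) = used_walk s w"
  by (simp_all add: used_def)

lemma used_step: "used s j \<le> used (step d \<tau> \<sigma> \<xi> s) j"
proof (cases j)
  case (Inr j')
  then show ?thesis by (cases j') (simp_all add: used_mono_step)
qed (simp add: used_mono_step)

text \<open>
  An event reads only those values whose use it records.
\<close>

lemma step_local:
  assumes "\<And>j. used s j < used (input_step d y s) j \<Longrightarrow> y j (used s j) = y' j (used s j)"
  shows "input_step d y' s = input_step d y s"
proof -
  define s' where "s' = advance (min (rem s) (Min (range (arr s)))) s"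
  have used': "used_arr s' = used_arr s" "used_srv s' = used_srv s" "used_walk s' = used_walk s"
    by (simp_all add: s'_def advance_def)
  have arrival: "arrival d (\<lambda>k. y' (Inl k)) k s' = arrival d (\<lambda>k. y (Inl k)) k s'"
    if "input_step d y s = arrival d (\<lambda>k. y (Inl k)) k s'" for k
    using assms[of "Inl k"] that used' by (simp add: arrival_def)
  have server: "server_event d (\<lambda>k. y' (Inr (Inl k))) (\<lambda>w. y' (Inr (Inr w))) s' = server_event d (\<lambda>k. y (Inr (Inl k))) (\<lambda>w. y (Inr (Inr w))) s'"
    if *: "input_step d y s = server_event d (\<lambda>k. y (Inr (Inl k))) (\<lambda>w. y (Inr (Inr w))) s'"
  proof -
    define s'' where "s'' = (if serving s' then complete_service d s' else reach_station s')"
    have used'': "used_srv s'' = used_srv s" "used_walk s'' = used_walk s"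
      using used' by (simp_all add: s''_def complete_service_def reach_station_def)
    show ?thesis
    proof (cases "may_serve d (pos s'') (queue s'' (pos s'')) (count s'')")
      case True
      then have "input_step d y s = start_service (\<lambda>k. y (Inr (Inl k))) s''"
        by (simp add: * server_event_def serve_or_leave_def s''_def[symmetric])
      then show ?thesis
        using assms[of "Inr (Inl (pos s''))"] used'' True
        by (simp add: server_event_def serve_or_leave_def s''_def[symmetric] start_service_def Let_def)
    next
      case False
      then have "input_step d y s = leave (\<lambda>w. y (Inr (Inr w))) s''"
        by (simp add: * server_event_def serve_or_leave_def s''_def[symmetric])
      then show ?thesis
        using assms[of "Inr (Inr (link (pos s'') (switch s'')))"] used'' False
        by (simp add: server_event_def serve_or_leave_def s''_def[symmetric] leave_def Let_def)
    qed
  qed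
  have eq: "input_step d z s = (if arr s' 1 = 0 then arrival d (\<lambda>k. z (Inl k)) 1 s'
      else if arr s' 2 = 0 then arrival d (\<lambda>k. z (Inl k)) 2 s'
      else if arr s' 3 = 0 then arrival d (\<lambda>k. z (Inl k)) 3 s'
      else server_event d (\<lambda>k. z (Inr (Inl k))) (\<lambda>w. z (Inr (Inr w))) s')" for z
    by (simp only: step_def Let_def s'_def)
  show ?thesis
  proof (cases "arr s' 1 = 0")
    case True
    then show ?thesis using arrival[of 1] by (simp add: eq)
  next
    case 1: False
    show ?thesis
    proof (cases "arr s' 2 = 0")
      case True
      then show ?thesis using arrival[of 2] 1 by (simp add: eq)
    next
      case 2: False
      show ?thesis
      proof (cases "arr s' 3 = 0")
        case True
        then show ?thesis using arrival[of 3] 1 2 by (simp add: eq)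
      next
        case False
        then show ?thesis using server 1 2 by (simp add: eq)
      qed
    qed
  qed
qed

lemma chain_local:
  assumes "\<And>j n. n < used (input_chain d y x m) j \<Longrightarrow> y j n = y' j n" "i \<le> m"
  shows "input_chain d y' x i = input_chain d y x i"
  using assms
proof (induction m arbitrary: i)
  case 0
  then show ?case by (simp add: chain_simps)
next
  case (Suc m)
  have agree: "y j n = y' j n" if "n < used (input_chain d y x m) j" for j n
  proof (rule Suc.prems(1))
    show "n < used (input_chain d y x (Suc m)) j"
      unfolding chain_simps using that used_step by (rule less_le_trans)
  qed
  note IH = Suc.IH[OF agree]
  show ?case
  proof (cases "i = Suc m")
    case True
    have "input_step d y' (input_chain d y x m) = input_step d y (input_chain d y x m)"
      by (rule step_local, rule Suc.prems(1)) (simp only: chain_simps)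
    then show ?thesis using IH[of m] True by (simp add: chain_simps)
  next
    case False
    then show ?thesis using IH[of i] Suc.prems(2) by simp
  qed
qed

text \<open>
  At time \<open>t\<close> exactly \<open>n\<close> events have happened, they have used the values below \<open>u\<close>, and the state
  lies in \<open>G\<close>. Whether \<open>t\<close> precedes event \<open>n + 1\<close> is read off the clocks after event \<open>n\<close>, so that
  only values below \<open>u\<close> matter.
\<close>

definition observed_at ::
  "discipline \<Rightarrow> state \<Rightarrow> real \<Rightarrow> state set \<Rightarrow> nat \<Rightarrow> (3 + 3 + 4 \<Rightarrow> nat) \<Rightarrow> (3 + 3 + 4 \<Rightarrow> nat \<Rightarrow> real) \<Rightarrow> bool" where
  "observed_at d x t G n u y \<longleftrightarrow> (let c = input_chain d y x in
     (\<forall>i<n. clock (c i) + next_event (c i) \<le> t) \<and> t < clock (c n) + next_event (c n) \<and>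
     used (c n) = u \<and> observe (advance (t - clock (c n)) (c n)) \<in> G)"

text \<open>
  By locality of the chain; the hypothesis is symmetric in \<open>y\<close> and \<open>y'\<close>, because \<open>u\<close> is the number of
  values used in either run.
\<close>

lemma observed_at_local:
  assumes "\<And>j i. i < u j \<Longrightarrow> y j i = y' j i"
  shows "observed_at d x t G n u y \<longleftrightarrow> observed_at d x t G n u y'"
proof -
  have "observed_at d x t G n u z'" if obs: "observed_at d x t G n u z" and agree: "\<And>j i. i < u j \<Longrightarrow> z j i = z' j i" for z z'
  proof -
    have used: "used (input_chain d z x n) = u" using obs by (simp add: observed_at_def Let_def)
    have "input_chain d z' x i = input_chain d z x i" if "i \<le> n" for i
      by (rule chain_local[OF _ that], rule agree) (simp only: used)
    then show ?thesis using obs by (simp add: observed_at_def Let_def)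
  qed
  from this[of y y'] this[of y' y] assms show ?thesis by auto
qed

lemma observed_at_event_index:
  assumes "observed_at d x t G n u y"
  shows "event_index d (\<lambda>k. y (Inl k)) (\<lambda>k. y (Inr (Inl k))) (\<lambda>w. y (Inr (Inr w))) x t = n"
  unfolding event_index_def
proof (rule Least_equality)
  show "t < clock (input_chain d y x (Suc n))" using assms by (simp add: observed_at_def Let_def chain_simps clock_step)
  fix i assume "t < clock (input_chain d y x (Suc i))"
  then show "n \<le> i" using assms by (auto simp: observed_at_def Let_def chain_simps clock_step not_le[symmetric])
qed

lemma observed_atI:
  assumes "t < clock (input_chain d y x (Suc m))"
  defines "n \<equiv> event_index d (\<lambda>k. y (Inl k)) (\<lambda>k. y (Inr (Inl k))) (\<lambda>w. y (Inr (Inr w))) x t"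
  assumes "observe (advance (t - clock (input_chain d y x n)) (input_chain d y x n)) \<in> G"
  shows "observed_at d x t G n (used (input_chain d y x n)) y"
proof -
  have "t < clock (input_chain d y x (Suc n))"
    unfolding n_def event_index_def using assms(1) by (rule LeastI)
  moreover have "clock (input_chain d y x (Suc i)) \<le> t" if "i < n" for i
    using that not_less_Least[of i "\<lambda>n. t < clock (input_chain d y x (Suc n))"] by (simp add: n_def event_index_def)
  ultimately show ?thesis
    using assms(3) by (simp add: observed_at_def Let_def chain_simps clock_step)
qed

lemma measurable_observed_at:
  assumes y: "\<And>j n. (\<lambda>z. y z j n) \<in> borel_measurable N"
  shows "Measurable.pred N (\<lambda>z. observed_at d x t (small_states q \<kappa>) n u (y z))"
proof -
  have "measurable_config N (\<lambda>z. init x)" by (simp add: measurable_config_def)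
  then have c: "measurable_config N (\<lambda>z. input_chain d (y z) x i)" for i
    using y by (intro measurable_config_chain)
  note [measurable] = measurable_configD(1)[OF c] measurable_next_event[OF c] measurable_used[OF c]
    measurable_small_states[OF c, of "\<lambda>z. t - clock (input_chain d (y z) x n)" n]
  show ?thesis unfolding observed_at_def Let_def by measurable
qed

context adaptive_polling
begin

definition input :: "'a \<Rightarrow> 3 + 3 + 4 \<Rightarrow> nat \<Rightarrow> real" where
  "input \<omega> j n = (case j of Inl k \<Rightarrow> \<tau> k n \<omega> | Inr (Inl k) \<Rightarrow> \<sigma> k n \<omega> | Inr (Inr k) \<Rightarrow> \<xi> k n \<omega>)"

lemma input_simps [simp]:
  "input \<omega> (Inl k) = (\<lambda>n. \<tau> k n \<omega>)" "input \<omega> (Inr (Inl k)) = (\<lambda>n. \<sigma> k n \<omega>)" "input \<omega> (Inr (Inr w)) = (\<lambda>n. \<xi> w n \<omega>)"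
  by (auto simp: input_def)

lemma indep_input: "indep_vars (\<lambda>_. borel) (\<lambda>i \<omega>. input \<omega> (fst i) (snd i)) UNIV"
proof -
  have "(\<lambda>i \<omega>. input \<omega> (fst i) (snd i)) = (\<lambda>(j, n). case j of Inl k \<Rightarrow> \<tau> k n | Inr (Inl k) \<Rightarrow> \<sigma> k n | Inr (Inr k) \<Rightarrow> \<xi> k n)"
    by (auto simp: fun_eq_iff input_def split: sum.split)
  then show ?thesis using independent by simp
qed

lemma measurable_input [measurable]: "(\<lambda>\<omega>. input \<omega> j n) \<in> borel_measurable M"
  using indep_input unfolding indep_vars_def by (auto dest: bspec[of _ _ "(j, n)"])

lemma distr_input: "distr M borel (\<lambda>\<omega>. input \<omega> j n) = distr M borel (\<lambda>\<omega>. input \<omega> j 0)"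
proof (cases j)
  case (Inl k)
  then show ?thesis using iid_arr[of k] by (simp add: iid_times_def)
next
  case (Inr j')
  then show ?thesis using iid_srv iid_walk by (cases j') (simp_all add: iid_times_def)
qed

lemma prob_input:
  assumes "B \<in> sets borel"
  shows "prob {\<omega>\<in>space M. input \<omega> j n \<in> B} = prob {\<omega>\<in>space M. input \<omega> j 0 \<in> B}"
proof -
  have "prob {\<omega>\<in>space M. input \<omega> j n \<in> B} = measure (distr M borel (\<lambda>\<omega>. input \<omega> j n)) B" for n
    using assms by (subst measure_distr) (auto intro!: arg_cong[where f = prob])
  then show ?thesis using distr_input[of j n] by simp
qed

text \<open>
  The probability of calm values from any fixed index \<open>u\<close> on: by independence and identical
  distribution it does not depend on \<open>u\<close>.
\<close>

definition prob_calm :: "real \<Rightarrow> nat \<Rightarrow> real" where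
  "prob_calm \<kappa> m = (\<Prod>(j, i)\<in>UNIV \<times> {..<m}. prob {\<omega>\<in>space M. input \<omega> j 0 \<in> calm_values \<kappa> m j})"

abbreviation calm_from :: "real \<Rightarrow> nat \<Rightarrow> (3 + 3 + 4 \<Rightarrow> nat) \<Rightarrow> 'a \<Rightarrow> bool" where
  "calm_from \<kappa> m u \<omega> \<equiv> calm \<kappa> m (\<lambda>k n. \<tau> k n \<omega>) (\<lambda>k n. \<sigma> k n \<omega>) (\<lambda>w n. \<xi> w n \<omega>) u"

lemma calm_iff:
  "calm_from \<kappa> m u \<omega> \<longleftrightarrow> (\<forall>j. \<forall>i<m. input \<omega> j (u j + i) \<in> calm_values \<kappa> m j)"
proof -
  have "case_sum (\<lambda>k n. \<tau> k n \<omega>) (case_sum (\<lambda>k n. \<sigma> k n \<omega>) (\<lambda>w n. \<xi> w n \<omega>)) j n = input \<omega> j n" for j n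
    by (auto simp: input_def split: sum.split)
  then show ?thesis by (simp add: calm_def)
qed

lemma calm_values_borel [measurable]: "calm_values \<kappa> m j \<in> sets borel"
  by (auto simp: calm_values_def split: sum.split)

text \<open>
  What has been observed by time \<open>t\<close> depends on the values below \<open>u\<close>, and calmness on values from
  \<open>u\<close> on, so the two events are independent.
\<close>

lemma prob_observed_calm:
  assumes m: "0 < m"
  shows "{\<omega>\<in>space M. observed_at d x t (small_states q \<kappa>') n u (input \<omega>)} \<in> events"
    and "{\<omega>\<in>space M. calm_from \<kappa> m u \<omega>} \<in> events"
    and "prob ({\<omega>\<in>space M. observed_at d x t (small_states q \<kappa>') n u (input \<omega>)} \<inter>
        {\<omega>\<in>space M. calm_from \<kappa> m u \<omega>})
      = prob {\<omega>\<in>space M. observed_at d x t (small_states q \<kappa>') n u (input \<omega>)} * prob_calm \<kappa> m"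
proof -
  let ?Y = "\<lambda>i \<omega>. input \<omega> (fst i) (snd i)"
  \<comment> \<open>\<open>J\<close> indexes the values used, \<open>H\<close> the next \<open>m\<close> values of every sequence.\<close>
  define J where "J = {i :: (3 + 3 + 4) \<times> nat. snd i < u (fst i)}"
  define f where "f = (\<lambda>(j, i). (j, u j + i) :: (3 + 3 + 4) \<times> nat)"
  define H where "H = f ` (UNIV \<times> {..<m})"
  \<comment> \<open>Values outside \<open>J\<close> are replaced by 0, which does not affect the observation.\<close>
  define A where "A = {v \<in> space (Pi\<^sub>M J (\<lambda>_. borel)). observed_at d x t (small_states q \<kappa>') n u (\<lambda>j i. if i < u j then v (j, i) else 0 :: real)}"
  define B where "B = Pi\<^sub>E H (\<lambda>i. calm_values \<kappa> m (fst i))"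
  have inj: "inj_on f (UNIV \<times> {..<m})" by (auto simp: inj_on_def f_def)
  have H: "finite H" "H \<noteq> {}" using m by (auto simp: H_def)
  have JH: "J \<inter> H = {}" by (auto simp: J_def H_def f_def)
  have A: "A \<in> sets (Pi\<^sub>M J (\<lambda>_. borel))"
    unfolding A_def
  proof (rule predE, rule measurable_observed_at)
    fix j i
    show "(\<lambda>v. if i < u j then v (j, i) else 0) \<in> borel_measurable (Pi\<^sub>M J (\<lambda>_. borel))"
      by (cases "i < u j") (simp_all add: J_def)
  qed
  have B: "B \<in> sets (Pi\<^sub>M H (\<lambda>_. borel))"
    unfolding B_def using H by (intro sets_PiM_I_finite) auto
  have indep: "indep_var (Pi\<^sub>M J (\<lambda>_. borel)) (\<lambda>\<omega>. \<lambda>i\<in>J. ?Y i \<omega>) (Pi\<^sub>M H (\<lambda>_. borel)) (\<lambda>\<omega>. \<lambda>i\<in>H. ?Y i \<omega>)"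
    using indep_input JH by (intro indep_var_restrict) auto
  have obs: "{\<omega>\<in>space M. observed_at d x t (small_states q \<kappa>') n u (input \<omega>)} = (\<lambda>\<omega>. \<lambda>i\<in>J. ?Y i \<omega>) -` A \<inter> space M"
  proof -
    have "observed_at d x t (small_states q \<kappa>') n u (input \<omega>) \<longleftrightarrow> (\<lambda>i\<in>J. ?Y i \<omega>) \<in> A" for \<omega>
    proof -
      have "(\<lambda>i\<in>J. ?Y i \<omega>) \<in> space (Pi\<^sub>M J (\<lambda>_. borel))" by (simp add: space_PiM)
      then have "(\<lambda>i\<in>J. ?Y i \<omega>) \<in> A \<longleftrightarrow>
          observed_at d x t (small_states q \<kappa>') n u (\<lambda>j i. if i < u j then (\<lambda>i\<in>J. ?Y i \<omega>) (j, i) else 0)"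
        by (simp add: A_def)
      also have "\<dots> \<longleftrightarrow> observed_at d x t (small_states q \<kappa>') n u (input \<omega>)"
        by (rule observed_at_local) (simp add: J_def)
      finally show ?thesis by simp
    qed
    then show ?thesis by auto
  qed
  have calm: "{\<omega>\<in>space M. calm_from \<kappa> m u \<omega>} = (\<lambda>\<omega>. \<lambda>i\<in>H. ?Y i \<omega>) -` B \<inter> space M"
    unfolding calm_iff by (auto simp: B_def H_def f_def PiE_iff)
  show "{\<omega>\<in>space M. observed_at d x t (small_states q \<kappa>') n u (input \<omega>)} \<in> events"
    unfolding obs using A by (rule measurable_sets[rotated]) (use indep in \<open>auto dest: indep_var_rv1\<close>)
  show "{\<omega>\<in>space M. calm_from \<kappa> m u \<omega>} \<in> events"
    unfolding calm using B by (rule measurable_sets[rotated]) (use indep in \<open>auto dest: indep_var_rv2\<close>)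
  have pB: "prob ((\<lambda>\<omega>. \<lambda>i\<in>H. ?Y i \<omega>) -` B \<inter> space M) = prob_calm \<kappa> m"
  proof -
    have "(\<lambda>\<omega>. \<lambda>i\<in>H. ?Y i \<omega>) -` B \<inter> space M = (\<Inter>i\<in>H. ?Y i -` calm_values \<kappa> m (fst i) \<inter> space M)"
    proof (rule set_eqI)
      fix \<omega>
      have "\<omega> \<in> (\<lambda>\<omega>. \<lambda>i\<in>H. ?Y i \<omega>) -` B \<inter> space M \<longleftrightarrow> (\<forall>i\<in>H. ?Y i \<omega> \<in> calm_values \<kappa> m (fst i)) \<and> \<omega> \<in> space M"
        by (simp only: B_def Int_iff vimage_eq restrict_PiE_iff)
      also have "\<dots> \<longleftrightarrow> \<omega> \<in> (\<Inter>i\<in>H. ?Y i -` calm_values \<kappa> m (fst i) \<inter> space M)"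
        using H(2) by (simp only: INT_iff Int_iff vimage_eq) blast
      finally show "\<omega> \<in> (\<lambda>\<omega>. \<lambda>i\<in>H. ?Y i \<omega>) -` B \<inter> space M \<longleftrightarrow> \<omega> \<in> (\<Inter>i\<in>H. ?Y i -` calm_values \<kappa> m (fst i) \<inter> space M)" .
    qed
    also have "prob \<dots> = (\<Prod>i\<in>H. prob (?Y i -` calm_values \<kappa> m (fst i) \<inter> space M))"
      using H by (intro indep_varsD_finite[OF indep_vars_subset[OF indep_input]]) auto
    also have "\<dots> = (\<Prod>i\<in>H. prob {\<omega>\<in>space M. input \<omega> (fst i) (snd i) \<in> calm_values \<kappa> m (fst i)})"
      by (intro prod.cong arg_cong[where f = prob]) auto
    also have "\<dots> = (\<Prod>i\<in>H. prob {\<omega>\<in>space M. input \<omega> (fst i) 0 \<in> calm_values \<kappa> m (fst i)})"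
      by (intro prod.cong refl prob_input) simp
    also have "\<dots> = prob_calm \<kappa> m"
      unfolding H_def prob_calm_def by (subst prod.reindex[OF inj]) (auto simp: f_def intro!: prod.cong)
    finally show ?thesis .
  qed
  have "prob ((\<lambda>\<omega>. (\<lambda>i\<in>J. ?Y i \<omega>, \<lambda>i\<in>H. ?Y i \<omega>)) -` (A \<times> B) \<inter> space M) =
      prob ((\<lambda>\<omega>. \<lambda>i\<in>J. ?Y i \<omega>) -` A \<inter> space M) * prob ((\<lambda>\<omega>. \<lambda>i\<in>H. ?Y i \<omega>) -` B \<inter> space M)"
    by (rule indep_varD[OF indep A B])
  also have "(\<lambda>\<omega>. (\<lambda>i\<in>J. ?Y i \<omega>, \<lambda>i\<in>H. ?Y i \<omega>)) -` (A \<times> B) \<inter> space M =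
      ((\<lambda>\<omega>. \<lambda>i\<in>J. ?Y i \<omega>) -` A \<inter> space M) \<inter> ((\<lambda>\<omega>. \<lambda>i\<in>H. ?Y i \<omega>) -` B \<inter> space M)"
    by auto
  finally show "prob ({\<omega>\<in>space M. observed_at d x t (small_states q \<kappa>') n u (input \<omega>)} \<inter>
        {\<omega>\<in>space M. calm_from \<kappa> m u \<omega>})
      = prob {\<omega>\<in>space M. observed_at d x t (small_states q \<kappa>') n u (input \<omega>)} * prob_calm \<kappa> m"
    by (simp only: obs calm pB)
qed

end

context adaptive_polling
begin

abbreviation run :: "discipline \<Rightarrow> state \<Rightarrow> 'a \<Rightarrow> nat \<Rightarrow> config" where
  "run d x \<omega> \<equiv> chain d (\<lambda>k n. \<tau> k n \<omega>) (\<lambda>k n. \<sigma> k n \<omega>) (\<lambda>w n. \<xi> w n \<omega>) x"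

abbreviation run_index :: "discipline \<Rightarrow> state \<Rightarrow> 'a \<Rightarrow> real \<Rightarrow> nat" where
  "run_index d x \<omega> \<equiv> event_index d (\<lambda>k n. \<tau> k n \<omega>) (\<lambda>k n. \<sigma> k n \<omega>) (\<lambda>w n. \<xi> w n \<omega>) x"

abbreviation calm_after :: "real \<Rightarrow> nat \<Rightarrow> discipline \<Rightarrow> state \<Rightarrow> 'a \<Rightarrow> real \<Rightarrow> bool" where
  "calm_after \<kappa> m d x \<omega> t \<equiv> calm_from \<kappa> m (used (run d x \<omega> (run_index d x \<omega> t))) \<omega>"

lemma X_eq: "X d \<tau> \<sigma> \<xi> x t \<omega> = observe (advance (t - clock (run d x \<omega> (run_index d x \<omega> t))) (run d x \<omega> (run_index d x \<omega> t)))"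
  by (simp add: X_def path_eq)

lemma queues_X: "queues (X d \<tau> \<sigma> \<xi> x t \<omega>) = queue (run d x \<omega> (run_index d x \<omega> t))"
  by (simp add: X_def queues_path)

lemma measurable_inputs [measurable]:
  "\<tau> k n \<in> borel_measurable M" "\<sigma> k n \<in> borel_measurable M" "\<xi> w n \<in> borel_measurable M"
  using measurable_input[of "Inl k" n] measurable_input[of "Inr (Inl k)" n] measurable_input[of "Inr (Inr w)" n] by simp_all

context
  fixes N :: "'z measure" and g :: "'z \<Rightarrow> 'a" and x :: "'z \<Rightarrow> state" and d :: discipline
  assumes g: "g \<in> measurable N M" and x: "measurable_config N (\<lambda>z. init (x z))"
begin

lemma measurable_run_at: "measurable_config N (\<lambda>z. run d (x z) (g z) (run_index d (x z) (g z) t))"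
  using g x
  by (intro measurable_config_at_event_index measurable_compose[OF g] measurable_inputs)

lemma measurable_X_small: "Measurable.pred N (\<lambda>z. X d \<tau> \<sigma> \<xi> (x z) t (g z) \<in> small_states q \<kappa>)"
  unfolding X_eq using measurable_configD(1)[OF measurable_run_at]
  by (intro measurable_small_states[OF measurable_run_at]) simp

lemma measurable_X_queues: "(\<lambda>z. \<Sum>k\<in>UNIV. queues (X d \<tau> \<sigma> \<xi> (x z) t (g z)) k) \<in> measurable N (count_space UNIV)"
proof -
  note [measurable] = measurable_configD(2)[OF measurable_run_at]
  show ?thesis unfolding queues_X sum_3 by measurable
qed

lemma measurable_calm_after: "Measurable.pred N (\<lambda>z. calm_after \<kappa> m d (x z) (g z) t)"
proof (rule measurable_compose_countable[OF _ measurable_used[OF measurable_run_at]])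
  fix u :: "3 + 3 + 4 \<Rightarrow> nat"
  have single: "Measurable.pred N (\<lambda>z. input (g z) j n \<in> calm_values \<kappa> m j)" for j n
    using measurable_compose[OF g measurable_input[of j n]] by measurable
  have "Measurable.pred N (\<lambda>z. \<forall>j\<in>UNIV. \<forall>i\<in>{..<m}. input (g z) j (u j + i) \<in> calm_values \<kappa> m j)"
    by (rule pred_intros_finite(3)[OF finite], rule pred_intros_finite(3)[OF finite_lessThan], rule single)
  then show "Measurable.pred N (\<lambda>z. calm_from \<kappa> m u (g z))"
    by (simp only: calm_iff Ball_def UNIV_I lessThan_iff simp_thms)
qed

end

lemma measurable_config_const: "measurable_config N (\<lambda>_. c)"
  by (simp add: measurable_config_def)

lemma nonneg_AE: "AE \<omega> in M. \<forall>k n. 0 \<le> \<tau> k n \<omega> \<and> 0 \<le> \<sigma> k n \<omega>" "AE \<omega> in M. \<forall>w n. 0 \<le> \<xi> w n \<omega>"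
proof -
  have "AE \<omega> in M. \<forall>n. 0 \<le> \<tau> k n \<omega> \<and> 0 \<le> \<sigma> k n \<omega>" for k
    using iid_arr[of k] iid_srv[of k] by (simp add: AE_all_countable iid_times_def)
  then show "AE \<omega> in M. \<forall>k n. 0 \<le> \<tau> k n \<omega> \<and> 0 \<le> \<sigma> k n \<omega>"
    unfolding forall_3 by (intro AE_conjI)
  have "AE \<omega> in M. \<forall>n. 0 \<le> \<xi> w n \<omega>" for w
    using iid_walk[of w] by (simp add: AE_all_countable iid_times_def)
  then show "AE \<omega> in M. \<forall>w n. 0 \<le> \<xi> w n \<omega>"
    unfolding forall_4 by (intro AE_conjI)
qed

lemma mean_eq: "expectation (\<tau> k 0) = 1 / rate M (\<tau> k)" "expectation (\<sigma> k 0) = 1 / rate M (\<sigma> k)"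
    "expectation (\<xi> w 0) = 1 / rate M (\<xi> w)"
  by (simp_all add: rate_def)

lemma mean_bounds: "0 < expectation (\<tau> k 0)" "0 < expectation (\<sigma> k 0)" "0 \<le> expectation (\<xi> w 0)"
  using arr_rate_pos[of k] srv_rate_pos[of k] nonneg_AE(2)
  by (auto simp: mean_eq(1,2) intro!: integral_nonneg_AE)

lemma zeta_eq: "zeta M \<xi> = expectation (\<xi> 1 0) + expectation (\<xi> 2 0) + expectation (\<xi> 3 0)"
    "zeta_star M \<xi> = expectation (\<xi> 3 0) + expectation (\<xi> 4 0)"
  by (simp_all add: zeta_def zeta_star_def mean_eq)

lemma zeta_pos: "0 < zeta M \<xi>"
  using walk_means mean_bounds(3) by (smt (verit) zeta_eq(2))

text \<open>
  The strong law holds in each of the ten sequences.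
\<close>

lemma AE_lln_path:
  assumes "has_limits_ge_1 d" "x \<in> states d"
  shows "AE \<omega> in M. lln_path d (\<lambda>k n. \<tau> k n \<omega>) (\<lambda>k n. \<sigma> k n \<omega>) (\<lambda>w n. \<xi> w n \<omega>) x
    (\<lambda>k. expectation (\<tau> k 0)) (\<lambda>k. expectation (\<sigma> k 0)) (\<lambda>w. expectation (\<xi> w 0))"
proof -
  have lln: "AE \<omega> in M. linear_growth (expectation (Y 0)) (\<lambda>n. Y n \<omega>)" if "iid_times M Y" for Y
    using that by (intro AE_linear_growth) (auto simp: iid_times_def)
  have "AE \<omega> in M. \<forall>k. linear_growth (expectation (\<tau> k 0)) (\<lambda>n. \<tau> k n \<omega>)"
    unfolding forall_3 by (intro AE_conjI lln iid_arr)
  moreover have "AE \<omega> in M. \<forall>k. linear_growth (expectation (\<sigma> k 0)) (\<lambda>n. \<sigma> k n \<omega>)"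
    unfolding forall_3 by (intro AE_conjI lln iid_srv)
  moreover have "AE \<omega> in M. \<forall>w. linear_growth (expectation (\<xi> w 0)) (\<lambda>n. \<xi> w n \<omega>)"
    unfolding forall_4 by (intro AE_conjI lln iid_walk)
  ultimately show ?thesis
    using nonneg_AE
  proof eventually_elim
    case (elim \<omega>)
    show ?case
    proof
      show "0 < expectation (\<xi> 1 0) + expectation (\<xi> 2 0) + expectation (\<xi> 3 0)"
        using zeta_pos by (simp add: zeta_eq)
    qed (use elim assms mean_bounds in \<open>auto intro: less_imp_le\<close>)
  qed
qed

text \<open>
  Decompose according to the number \<open>n\<close> of events and the numbers \<open>u\<close> of values used by time \<open>t\<close>; for
  each pair \<open>(n, u)\<close> the observation is independent of calmness from \<open>u\<close> on. Almost surely only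
  finitely many events happen by time \<open>t\<close>, so that the pairs exhaust the probability space.
\<close>

lemma prob_calm_after:
  assumes d: "has_limits_ge_1 d" and x: "x \<in> states d" and t: "0 \<le> t" and m: "0 < m"
  shows "ennreal (prob_calm \<kappa> m) * emeasure M {\<omega>\<in>space M. X d \<tau> \<sigma> \<xi> x t \<omega> \<in> small_states q \<kappa>'}
    \<le> emeasure M {\<omega>\<in>space M. X d \<tau> \<sigma> \<xi> x t \<omega> \<in> small_states q \<kappa>' \<and> calm_after \<kappa> m d x \<omega> t}"
proof -
  define A where "A = (\<lambda>(n, u). {\<omega>\<in>space M. observed_at d x t (small_states q \<kappa>') n u (input \<omega>)})"
  define C where "C = (\<lambda>(n :: nat, u). {\<omega>\<in>space M. calm_from \<kappa> m u \<omega>})"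
  have [measurable]: "A i \<in> sets M" "C i \<in> sets M" for i
    using prob_observed_calm(1,2)[OF m] by (auto simp: A_def C_def split: prod.split)
  note [measurable] = measurable_X_small[OF measurable_ident measurable_config_const[of M "init x"], of d t q \<kappa>', unfolded id_apply]
    measurable_calm_after[OF measurable_ident measurable_config_const[of M "init x"], of \<kappa> m d t, unfolded id_apply]
  have obs: "run_index d x \<omega> t = n" "used (run d x \<omega> n) = u" "X d \<tau> \<sigma> \<xi> x t \<omega> \<in> small_states q \<kappa>'"
    if "\<omega> \<in> A (n, u)" for \<omega> n u
  proof -
    have *: "observed_at d x t (small_states q \<kappa>') n u (input \<omega>)" using that by (simp add: A_def)
    show 1: "run_index d x \<omega> t = n" using observed_at_event_index[OF *] by simp
    show "used (run d x \<omega> n) = u" using * by (simp add: observed_at_def Let_def)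
    show "X d \<tau> \<sigma> \<xi> x t \<omega> \<in> small_states q \<kappa>'" unfolding X_eq 1 using * by (simp add: observed_at_def Let_def)
  qed
  have disj: "disjoint_family_on A UNIV"
    unfolding disjoint_family_on_def
  proof (intro ballI impI)
    fix i j :: "nat \<times> (3 + 3 + 4 \<Rightarrow> nat)" assume "i \<noteq> j"
    have False if "\<omega> \<in> A i" "\<omega> \<in> A j" for \<omega>
    proof -
      have i: "\<omega> \<in> A (fst i, snd i)" and j: "\<omega> \<in> A (fst j, snd j)" using that by simp_all
      have "fst i = fst j" using obs(1)[OF i] obs(1)[OF j] by simp
      moreover have "snd i = snd j" using obs(2)[OF i] obs(2)[OF j] calculation by simp
      ultimately show False using \<open>i \<noteq> j\<close> by (simp add: prod_eq_iff)
    qed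
    then show "A i \<inter> A j = {}" by blast
  qed
  have "emeasure M {\<omega>\<in>space M. X d \<tau> \<sigma> \<xi> x t \<omega> \<in> small_states q \<kappa>'} \<le> emeasure M (\<Union>i. A i)"
  proof (rule emeasure_mono_AE)
    show "AE \<omega> in M. \<omega> \<in> {\<omega>\<in>space M. X d \<tau> \<sigma> \<xi> x t \<omega> \<in> small_states q \<kappa>'} \<longrightarrow> \<omega> \<in> (\<Union>i. A i)"
      using AE_lln_path[OF d x]
    proof eventually_elim
      case (elim \<omega>)
      interpret lln_path d "\<lambda>k n. \<tau> k n \<omega>" "\<lambda>k n. \<sigma> k n \<omega>" "\<lambda>w n. \<xi> w n \<omega>" x
        "\<lambda>k. expectation (\<tau> k 0)" "\<lambda>k. expectation (\<sigma> k 0)" "\<lambda>w. expectation (\<xi> w 0)" by (rule elim)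
      show ?case
      proof
        assume \<omega>: "\<omega> \<in> {\<omega>\<in>space M. X d \<tau> \<sigma> \<xi> x t \<omega> \<in> small_states q \<kappa>'}"
        have "observed_at d x t (small_states q \<kappa>') (run_index d x \<omega> t) (used (run d x \<omega> (run_index d x \<omega> t))) (input \<omega>)"
          using observed_atI[of t d "input \<omega>" x "run_index d x \<omega> t" "small_states q \<kappa>'"] index_bounds(2)[OF t] \<omega>
          by (simp add: X_eq)
        then have "\<omega> \<in> A (run_index d x \<omega> t, used (run d x \<omega> (run_index d x \<omega> t)))" using \<omega> by (simp add: A_def)
        then show "\<omega> \<in> (\<Union>i. A i)" by blast
      qed
    qed
  qed (auto intro!: sets.countable_UN'')
  then have "ennreal (prob_calm \<kappa> m) * emeasure M {\<omega>\<in>space M. X d \<tau> \<sigma> \<xi> x t \<omega> \<in> small_states q \<kappa>'}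
      \<le> ennreal (prob_calm \<kappa> m) * emeasure M (\<Union>i. A i)" by (rule mult_left_mono) simp
  also have "emeasure M (\<Union>i. A i) = (\<integral>\<^sup>+i. emeasure M (A i) \<partial>count_space UNIV)"
    using disj by (intro emeasure_UN_countable) auto
  also have "ennreal (prob_calm \<kappa> m) * \<dots> = (\<integral>\<^sup>+i. ennreal (prob_calm \<kappa> m) * emeasure M (A i) \<partial>count_space UNIV)"
    by (rule nn_integral_cmult[symmetric]) simp
  also have "\<dots> = (\<integral>\<^sup>+i. emeasure M (A i \<inter> C i) \<partial>count_space UNIV)"
  proof (rule nn_integral_cong)
    fix i :: "nat \<times> (3 + 3 + 4 \<Rightarrow> nat)"
    have "0 \<le> prob_calm \<kappa> m" by (auto simp: prob_calm_def intro: prod_nonneg)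
    then show "ennreal (prob_calm \<kappa> m) * emeasure M (A i) = emeasure M (A i \<inter> C i)"
      using prob_observed_calm(3)[OF m, of d x t q \<kappa>' "fst i" "snd i" \<kappa>]
      by (simp add: emeasure_eq_measure A_def C_def case_prod_beta mult.commute flip: ennreal_mult')
  qed
  also have "\<dots> = emeasure M (\<Union>i. A i \<inter> C i)"
  proof (rule emeasure_UN_countable[symmetric])
    show "disjoint_family_on (\<lambda>i. A i \<inter> C i) UNIV"
      using disj unfolding disjoint_family_on_def by blast
  qed auto
  also have "\<dots> \<le> emeasure M {\<omega>\<in>space M. X d \<tau> \<sigma> \<xi> x t \<omega> \<in> small_states q \<kappa>' \<and> calm_after \<kappa> m d x \<omega> t}"
  proof (rule emeasure_mono)
    show "(\<Union>i. A i \<inter> C i) \<subseteq> {\<omega>\<in>space M. X d \<tau> \<sigma> \<xi> x t \<omega> \<in> small_states q \<kappa>' \<and> calm_after \<kappa> m d x \<omega> t}"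
    proof
      fix \<omega> assume "\<omega> \<in> (\<Union>i. A i \<inter> C i)"
      then obtain n u where A: "\<omega> \<in> A (n, u)" and C: "\<omega> \<in> C (n, u)" by auto
      show "\<omega> \<in> {\<omega>\<in>space M. X d \<tau> \<sigma> \<xi> x t \<omega> \<in> small_states q \<kappa>' \<and> calm_after \<kappa> m d x \<omega> t}"
        using obs[OF A] C by (simp add: C_def)
    qed
  qed measurable
  finally show ?thesis .
qed

end

section \<open>Instability and transience\<close>

lemma measurable_config_compose:
  assumes "measurable_config N' f" and g: "g \<in> measurable N N'"
  shows "measurable_config N (\<lambda>z. f (g z))"
  unfolding measurable_config_def
  by (intro conjI allI measurable_compose[OF g] measurable_configD[OF assms(1)])

lemma (in prob_space) eventually_prob_le_pos:
  assumes [measurable]: "Y \<in> borel_measurable M"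
  shows "eventually (\<lambda>q. 0 < prob {\<omega>\<in>space M. Y \<omega> \<le> real q}) sequentially"
proof -
  have "(\<lambda>q. prob {\<omega>\<in>space M. Y \<omega> \<le> real q}) \<longlonglongrightarrow> prob (\<Union>q. {\<omega>\<in>space M. Y \<omega> \<le> real q})"
    by (rule finite_Lim_measure_incseq) (force simp: incseq_def)+
  also have "(\<Union>q. {\<omega>\<in>space M. Y \<omega> \<le> real q}) = space M"
    using real_arch_simple by auto
  finally show ?thesis by (rule order_tendstoD) (simp add: prob_space)
qed

lemma small_states_mono: "q \<le> q' \<Longrightarrow> \<kappa> \<le> \<kappa>' \<Longrightarrow> small_states q \<kappa> \<subseteq> small_states q' \<kappa>'"
  unfolding small_states_def by clarsimp (meson order_trans)

lemma Union_small_states: "(\<Union>q. small_states q (real q)) = UNIV"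
proof -
  have "\<exists>q. x \<in> small_states q (real q)" for x
  proof (cases x)
    case (fields n a b b0 h i c)
    obtain q1 where "b \<le> real q1" using real_arch_simple by blast
    moreover obtain q2 where "b0 \<le> real q2" using real_arch_simple by blast
    moreover have "n k \<le> n 1 + n 2 + n 3" for k using exhaust_3[of k] by auto
    ultimately show ?thesis
      using fields by (intro exI[of _ "q1 + q2 + (n 1 + n 2 + n 3)"]) (auto simp: small_states_def intro: le_trans trans_le_add2)
  qed
  then show ?thesis by blast
qed

context adaptive_polling
begin

text \<open>
  For interarrival times this is the assumption of unbounded support.
\<close>

lemma prob_calm_pos:
  assumes "0 < \<kappa>" "\<And>k. 0 < prob {\<omega>\<in>space M. \<sigma> k 0 \<omega> \<le> \<kappa>}" "\<And>w. 0 < prob {\<omega>\<in>space M. \<xi> w 0 \<omega> \<le> \<kappa>}"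
  shows "0 < prob_calm \<kappa> m"
proof -
  have "0 < prob {\<omega>\<in>space M. input \<omega> j 0 \<in> calm_values \<kappa> m j}" for j
  proof (cases j)
    case (Inl k)
    then show ?thesis using arr_unbounded[of "\<kappa> * real (m + 1)" k] assms(1) by (simp add: calm_values_def)
  next
    case (Inr j')
    then show ?thesis using assms(2,3) by (cases j') (simp_all add: calm_values_def)
  qed
  then show ?thesis by (auto simp: prob_calm_def intro!: prod_pos)
qed

lemma AE_queues_diverge:
  assumes d: "has_limits_ge_1 d" and x: "x \<in> states d"
    and F: "walking_surplus d (\<lambda>w. expectation (\<xi> w 0)) \<gamma> F"
    and L: "1 < (\<Sum>k\<in>UNIV. (expectation (\<sigma> k 0) + \<gamma> k) / expectation (\<tau> k 0))"
  shows "AE \<omega> in M. filterlim (\<lambda>t. \<Sum>k\<in>UNIV. queues (X d \<tau> \<sigma> \<xi> x t \<omega>) k) at_top at_top"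
  using AE_lln_path[OF d x]
proof eventually_elim
  case (elim \<omega>)
  interpret lln_path d "\<lambda>k n. \<tau> k n \<omega>" "\<lambda>k n. \<sigma> k n \<omega>" "\<lambda>w n. \<xi> w n \<omega>" x
    "\<lambda>k. expectation (\<tau> k 0)" "\<lambda>k. expectation (\<sigma> k 0)" "\<lambda>w. expectation (\<xi> w 0)" by (rule elim)
  show ?case using queues_diverge[OF F L] by (simp add: X_def)
qed

lemma AE_calm_blocks_rare:
  assumes d: "has_limits_ge_1 d" and x: "x \<in> states d"
    and F: "walking_surplus d (\<lambda>w. expectation (\<xi> w 0)) \<gamma> F"
    and L: "1 \<le> (\<Sum>k\<in>UNIV. (expectation (\<sigma> k 0) + \<gamma> k) / expectation (\<tau> k 0))"
    and \<kappa>: "0 < \<kappa>" and \<delta>: "0 < \<delta>"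
    and inc: "gains_from_walking d F (3 * (q + 2)) W \<delta>"
    and m: "m = W + (3 * (q + 2) + 3)"
  defines "h \<equiv> \<kappa> * real (m + 1)"
  shows "AE \<omega> in M. (\<lambda>N. if (\<Sum>k\<in>UNIV. queues (X d \<tau> \<sigma> \<xi> x (real N * h) \<omega>) k) \<le> r
      then (\<Sum>j<N. of_bool (X d \<tau> \<sigma> \<xi> x (real j * h) \<omega> \<in> small_states q \<kappa> \<and> calm_after \<kappa> m d x \<omega> (real j * h))) / real N
      else 0 :: real) \<longlonglongrightarrow> 0"
  using AE_lln_path[OF d x]
proof eventually_elim
  case (elim \<omega>)
  interpret lln_path d "\<lambda>k n. \<tau> k n \<omega>" "\<lambda>k n. \<sigma> k n \<omega>" "\<lambda>w n. \<xi> w n \<omega>" x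
    "\<lambda>k. expectation (\<tau> k 0)" "\<lambda>k. expectation (\<sigma> k 0)" "\<lambda>w. expectation (\<xi> w 0)" by (rule elim)
  have *: "(\<Sum>j<N. of_bool (X d \<tau> \<sigma> \<xi> x (real j * h) \<omega> \<in> small_states q \<kappa> \<and> calm_after \<kappa> m d x \<omega> (real j * h)))
      = real (card (calm_blocks q \<kappa> m N))" for N
  proof -
    have "calm_blocks q \<kappa> m N = {..<N} \<inter> {j. X d \<tau> \<sigma> \<xi> x (real j * h) \<omega> \<in> small_states q \<kappa> \<and> calm_after \<kappa> m d x \<omega> (real j * h)}"
      by (auto simp only: calm_blocks_def X_def h_def Int_iff mem_Collect_eq lessThan_iff)
    then show ?thesis by simp
  qed
  show ?case
    unfolding * unfolding X_def h_def
    by (rule calm_blocks_rare[OF F L \<kappa> \<delta> inc m])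
qed

text \<open>
  Start with \<open>X\<close> distributed according to \<open>\<pi>\<close>. Small states have positive probability at every time,
  and calm values follow with probability \<open>p\<close> independently, so a fixed positive fraction of the
  blocks counts on average. By stationarity the queues are bounded by one constant with high
  probability at any time, and then the fraction of counted blocks tends to 0 almost surely: a
  contradiction, by dominated convergence in \<open>\<omega>\<close> and then in the initial state.
\<close>

lemma no_stationary_distribution:
  assumes d: "has_limits_ge_1 d"
    and F: "walking_surplus d (\<lambda>w. expectation (\<xi> w 0)) \<gamma> F"
    and L: "1 \<le> (\<Sum>k\<in>UNIV. (expectation (\<sigma> k 0) + \<gamma> k) / expectation (\<tau> k 0))"
  shows "\<not> stationary d M \<tau> \<sigma> \<xi> \<pi>"
proof
  assume stat: "stationary d M \<tau> \<sigma> \<xi> \<pi>"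
  then interpret \<pi>: prob_space \<pi> by (simp add: stationary_def)
  have sets_\<pi>: "sets \<pi> = sets (state_space d)" using stat by (simp add: stationary_def)
  have space_\<pi>: "space \<pi> = states d" using sets_eq_imp_space_eq[OF sets_\<pi>] by (simp add: space_state_space)
  define E where "E q = small_states q (real q) \<inter> states d" for q
  have E [measurable]: "E q \<in> sets \<pi>" for q by (simp add: E_def sets_\<pi> small_states_in_sets)
  have stat': "\<forall>t\<ge>0. \<forall>B\<in>sets (state_space d). (\<integral>\<^sup>+x. emeasure M {\<omega>\<in>space M. X d \<tau> \<sigma> \<xi> x t \<omega> \<in> B} \<partial>\<pi>) = emeasure \<pi> B"
    using stat unfolding stationary_def by (elim conjE)
  have inv: "(\<integral>\<^sup>+x. emeasure M {\<omega>\<in>space M. X d \<tau> \<sigma> \<xi> x t \<omega> \<in> E q} \<partial>\<pi>) = emeasure \<pi> (E q)" if "0 \<le> t" for t q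
    by (rule stat'[THEN spec, THEN mp, OF that, THEN bspec]) (simp add: E_def small_states_in_sets)
  have E_lim: "(\<lambda>q. \<pi>.prob (E q)) \<longlonglongrightarrow> 1"
  proof -
    have "(\<lambda>q. \<pi>.prob (E q)) \<longlonglongrightarrow> \<pi>.prob (\<Union>q. E q)"
    proof (rule \<pi>.finite_Lim_measure_incseq)
      show "range E \<subseteq> sets \<pi>" using E by blast
      show "incseq E"
        unfolding incseq_def E_def by (intro allI impI Int_mono small_states_mono) simp_all
    qed
    also have "(\<Union>q. E q) = space \<pi>" using Union_small_states by (auto simp: E_def space_\<pi>)
    finally show ?thesis by (simp add: \<pi>.prob_space)
  qed
  have ev_q: "eventually (\<lambda>q. 0 < q \<and> 0 < \<pi>.prob (E q) \<and> (\<forall>k. 0 < prob {\<omega>\<in>space M. \<sigma> k 0 \<omega> \<le> real q}) \<and>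
      (\<forall>w. 0 < prob {\<omega>\<in>space M. \<xi> w 0 \<omega> \<le> real q})) sequentially"
    unfolding forall_3 forall_4
    by (intro eventually_conj eventually_prob_le_pos measurable_inputs eventually_gt_at_top order_tendstoD(1)[OF E_lim]) simp
  obtain q where q: "0 < q" "0 < \<pi>.prob (E q)" "\<And>k. 0 < prob {\<omega>\<in>space M. \<sigma> k 0 \<omega> \<le> real q}"
      "\<And>w. 0 < prob {\<omega>\<in>space M. \<xi> w 0 \<omega> \<le> real q}"
    using eventually_happens'[OF sequentially_bot ev_q] by (elim exE conjE) (rule that, auto)
  define \<kappa> where "\<kappa> = real q"
  have \<kappa>: "0 < \<kappa>" using q by (simp add: \<kappa>_def)
  obtain \<delta> where \<delta>: "0 < \<delta>" and gains: "\<forall>S. \<exists>W. gains_from_walking d F S W \<delta>"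
    using F unfolding walking_surplus_def by blast
  obtain W where W: "gains_from_walking d F (3 * (q + 2)) W \<delta>"
    using gains by blast
  \<comment> \<open>At most \<open>3 * (q + 2)\<close> of the \<open>m\<close> events start services and at most 3 are arrivals, so that \<open>W\<close> walks remain.\<close>
  define m where "m = W + (3 * (q + 2) + 3)"
  have m: "0 < m" by (simp add: m_def)
  define h where "h = \<kappa> * real (m + 1)"
  have h: "0 \<le> real j * h" for j using \<kappa> by (simp add: h_def)
  define p where "p = prob_calm \<kappa> m"
  have p: "0 < p" unfolding p_def \<kappa>_def using q by (intro prob_calm_pos) auto
  define c where "c = p * \<pi>.prob (E q)"
  have c: "0 < c" using p q by (simp add: c_def)
  have ev_q': "eventually (\<lambda>q'. 1 - c / 2 < \<pi>.prob (E q')) sequentially"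
    using c by (intro order_tendstoD(1)[OF E_lim]) simp
  \<comment> \<open>A bound for the queues that is violated with probability less than half of the expected fraction \<open>c\<close>.\<close>
  obtain q' where q': "1 - c / 2 < \<pi>.prob (E q')"
    using eventually_happens'[OF sequentially_bot ev_q'] by (elim exE) (rule that)
  interpret P: pair_prob_space \<pi> M ..
  let ?P = "\<pi> \<Otimes>\<^sub>M M"
  have "fst \<in> measurable ?P (state_space d)"
    using measurable_fst[of \<pi> M] measurable_cong_sets[OF refl sets_\<pi>, of ?P] by blast
  then have init_P: "measurable_config ?P (\<lambda>z. init (fst z))"
    by (rule measurable_config_compose[OF measurable_config_init])
  define A where "A j z \<longleftrightarrow> X d \<tau> \<sigma> \<xi> (fst z) (real j * h) (snd z) \<in> small_states q \<kappa> \<and> calm_after \<kappa> m d (fst z) (snd z) (real j * h)"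
    for j :: nat and z
  define R where "R N z \<longleftrightarrow> (\<Sum>k\<in>UNIV. queues (X d \<tau> \<sigma> \<xi> (fst z) (real N * h) (snd z)) k) \<le> 3 * q'" for N :: nat and z
  note mX = measurable_X_small[OF measurable_snd init_P]
  have predA [measurable]: "Measurable.pred ?P (A j)" for j
    using mX measurable_calm_after[OF measurable_snd init_P] unfolding A_def by (intro pred_intros_logic) auto
  have [measurable]: "Measurable.pred ?P (R N)" for N
    unfolding R_def by (rule measurable_compose[OF measurable_X_queues[OF measurable_snd init_P]]) simp
  have often: "c \<le> P.prob {z\<in>space ?P. A j z}" for j
  proof -
    define S where "S = {z\<in>space ?P. X d \<tau> \<sigma> \<xi> (fst z) (real j * h) (snd z) \<in> small_states q \<kappa>}"
    have S: "S \<in> sets ?P" unfolding S_def by (rule predE[OF mX])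
    have sec: "Pair x -` S = {\<omega>\<in>space M. X d \<tau> \<sigma> \<xi> x (real j * h) \<omega> \<in> small_states q \<kappa>}"
        "Pair x -` {z\<in>space ?P. A j z} = {\<omega>\<in>space M. X d \<tau> \<sigma> \<xi> x (real j * h) \<omega> \<in> small_states q \<kappa> \<and> calm_after \<kappa> m d x \<omega> (real j * h)}"
      if "x \<in> space \<pi>" for x using that by (auto simp: S_def A_def space_pair_measure)
    have "ennreal c = ennreal p * emeasure \<pi> (E q)"
      using p by (simp add: c_def \<pi>.emeasure_eq_measure ennreal_mult')
    also have "\<dots> = ennreal p * (\<integral>\<^sup>+x. emeasure M {\<omega>\<in>space M. X d \<tau> \<sigma> \<xi> x (real j * h) \<omega> \<in> E q} \<partial>\<pi>)"
      using inv[OF h] by simp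
    also have "\<dots> \<le> ennreal p * (\<integral>\<^sup>+x. emeasure M (Pair x -` S) \<partial>\<pi>)"
    proof (intro mult_left_mono nn_integral_mono)
      fix x assume x: "x \<in> space \<pi>"
      show "emeasure M {\<omega>\<in>space M. X d \<tau> \<sigma> \<xi> x (real j * h) \<omega> \<in> E q} \<le> emeasure M (Pair x -` S)"
        using S by (intro emeasure_mono sets_Pair1) (auto simp: sec(1)[OF x] E_def \<kappa>_def)
    qed simp
    also have "\<dots> = (\<integral>\<^sup>+x. ennreal p * emeasure M (Pair x -` S) \<partial>\<pi>)"
      using S by (intro nn_integral_cmult[symmetric] measurable_emeasure_Pair)
    also have "\<dots> \<le> (\<integral>\<^sup>+x. emeasure M (Pair x -` {z\<in>space ?P. A j z}) \<partial>\<pi>)"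
    proof (rule nn_integral_mono)
      fix x assume x: "x \<in> space \<pi>"
      then show "ennreal p * emeasure M (Pair x -` S) \<le> emeasure M (Pair x -` {z\<in>space ?P. A j z})"
        unfolding sec[OF x] p_def by (intro prob_calm_after d h m) (simp add: space_\<pi>)
    qed
    also have "\<dots> = emeasure ?P {z\<in>space ?P. A j z}"
      by (rule emeasure_pair_measure_alt[symmetric]) measurable
    finally show ?thesis by (simp add: P.emeasure_eq_measure)
  qed
  have tight: "P.prob {z\<in>space ?P. \<not> R N z} \<le> c / 2" for N
  proof -
    have sec: "Pair x -` {z\<in>space ?P. R N z} = {\<omega>\<in>space M. (\<Sum>k\<in>UNIV. queues (X d \<tau> \<sigma> \<xi> x (real N * h) \<omega>) k) \<le> 3 * q'}"
      if "x \<in> space \<pi>" for x using that by (auto simp: R_def space_pair_measure)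
    have "ennreal (\<pi>.prob (E q')) = emeasure \<pi> (E q')" by (simp add: \<pi>.emeasure_eq_measure)
    also have "\<dots> = (\<integral>\<^sup>+x. emeasure M {\<omega>\<in>space M. X d \<tau> \<sigma> \<xi> x (real N * h) \<omega> \<in> E q'} \<partial>\<pi>)"
      using inv[OF h] by simp
    also have "\<dots> \<le> (\<integral>\<^sup>+x. emeasure M (Pair x -` {z\<in>space ?P. R N z}) \<partial>\<pi>)"
    proof (rule nn_integral_mono)
      fix x assume x: "x \<in> space \<pi>"
      have bound: "(\<Sum>k\<in>UNIV. queues s k) \<le> 3 * q'" if "s \<in> E q'" for s
        using that sum_bounded_above[of UNIV "queues s" q'] by (cases s) (auto simp: E_def small_states_def)
      show "emeasure M {\<omega>\<in>space M. X d \<tau> \<sigma> \<xi> x (real N * h) \<omega> \<in> E q'} \<le> emeasure M (Pair x -` {z\<in>space ?P. R N z})"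
      proof (rule emeasure_mono)
        show "{\<omega>\<in>space M. X d \<tau> \<sigma> \<xi> x (real N * h) \<omega> \<in> E q'} \<subseteq> Pair x -` {z\<in>space ?P. R N z}"
          unfolding sec[OF x] by (intro subsetI CollectI conjI bound) (simp_all only: mem_Collect_eq)
        have "{z\<in>space ?P. R N z} \<in> sets ?P" by measurable
        then show "Pair x -` {z\<in>space ?P. R N z} \<in> events" by (rule sets_Pair1)
      qed
    qed
    also have "\<dots> = emeasure ?P {z\<in>space ?P. R N z}"
      by (rule emeasure_pair_measure_alt[symmetric]) measurable
    finally have "\<pi>.prob (E q') \<le> P.prob {z\<in>space ?P. R N z}" by (simp add: P.emeasure_eq_measure)
    moreover have "P.prob {z\<in>space ?P. \<not> R N z} = 1 - P.prob {z\<in>space ?P. R N z}"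
      by (rule P.prob_neg) measurable
    ultimately show ?thesis using q' by simp
  qed
  \<comment> \<open>The fraction of counted blocks, set to 0 if the queues are large at the end.\<close>
  define f where "f N z = (if R N z then (\<Sum>j<N. of_bool (A j z)) / real N else 0 :: real)" for N z
  have [measurable]: "f N \<in> borel_measurable ?P" for N unfolding f_def by measurable
  have f01: "0 \<le> f N z" "f N z \<le> 1" for N z
  proof -
    have "(\<Sum>j<N. of_bool (A j z)) \<le> (\<Sum>j<N. 1 :: real)" by (intro sum_mono) simp
    then show "f N z \<le> 1" by (auto simp: f_def divide_le_eq_1)
    show "0 \<le> f N z" by (auto simp: f_def intro!: divide_nonneg_nonneg sum_nonneg)
  qed
  have lim_f: "(\<lambda>N. \<integral>\<^sup>+z. ennreal (f N z) \<partial>?P) \<longlonglongrightarrow> 0"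
  proof -
    have inner: "(\<lambda>N. \<integral>\<^sup>+\<omega>. ennreal (f N (x, \<omega>)) \<partial>M) \<longlonglongrightarrow> (\<integral>\<^sup>+\<omega>. 0 \<partial>M)" if x: "x \<in> space \<pi>" for x
    proof (rule nn_integral_dominated_convergence[where w = "\<lambda>_. 1"])
      have "AE \<omega> in M. (\<lambda>N. f N (x, \<omega>)) \<longlonglongrightarrow> 0"
        unfolding f_def R_def A_def fst_conv snd_conv h_def
        using x by (intro AE_calm_blocks_rare[OF d _ F L \<kappa> \<delta> W m_def]) (simp add: space_\<pi>)
      then show "AE \<omega> in M. (\<lambda>N. ennreal (f N (x, \<omega>))) \<longlonglongrightarrow> 0"
        by (rule AE_mp) (intro AE_I2 impI, drule tendsto_ennrealI, simp)
      show "(\<lambda>\<omega>. ennreal (f N (x, \<omega>))) \<in> borel_measurable M" for N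
        using x by measurable
      show "AE \<omega> in M. ennreal (f N (x, \<omega>)) \<le> 1" for N using f01(2) by (simp add: ennreal_le_1)
      show "(\<integral>\<^sup>+\<omega>. 1 \<partial>M) < \<infinity>" by (simp add: emeasure_space_1)
    qed auto
    have "(\<lambda>N. \<integral>\<^sup>+x. (\<integral>\<^sup>+\<omega>. ennreal (f N (x, \<omega>)) \<partial>M) \<partial>\<pi>) \<longlonglongrightarrow> (\<integral>\<^sup>+x. 0 \<partial>\<pi>)"
    proof (rule nn_integral_dominated_convergence[where w = "\<lambda>_. 1"])
      show "AE x in \<pi>. (\<lambda>N. \<integral>\<^sup>+\<omega>. ennreal (f N (x, \<omega>)) \<partial>M) \<longlonglongrightarrow> 0"
        using inner by (intro AE_I2) simp
      show "(\<lambda>x. \<integral>\<^sup>+\<omega>. ennreal (f N (x, \<omega>)) \<partial>M) \<in> borel_measurable \<pi>" for N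
        by (rule borel_measurable_nn_integral_fst) measurable
      show "AE x in \<pi>. (\<integral>\<^sup>+\<omega>. ennreal (f N (x, \<omega>)) \<partial>M) \<le> 1" for N
      proof (rule AE_I2)
        fix x
        have "(\<integral>\<^sup>+\<omega>. ennreal (f N (x, \<omega>)) \<partial>M) \<le> (\<integral>\<^sup>+\<omega>. 1 \<partial>M)"
          using f01(2) by (intro nn_integral_mono) (simp add: ennreal_le_1)
        then show "(\<integral>\<^sup>+\<omega>. ennreal (f N (x, \<omega>)) \<partial>M) \<le> 1" by (simp add: emeasure_space_1)
      qed
      show "(\<integral>\<^sup>+x. 1 \<partial>\<pi>) < \<infinity>" by (simp add: \<pi>.emeasure_space_1)
    qed auto
    moreover have "(\<integral>\<^sup>+x. (\<integral>\<^sup>+\<omega>. ennreal (f N (x, \<omega>)) \<partial>M) \<partial>\<pi>) = (\<integral>\<^sup>+z. ennreal (f N z) \<partial>?P)" for N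
      by (rule nn_integral_fst) measurable
    ultimately show ?thesis by simp
  qed
  have int_f: "integrable ?P (f N)" for N
    using f01 by (intro P.integrable_const_bound[of _ 1]) auto
  have "(\<integral>\<^sup>+z. ennreal (f N z) \<partial>?P) = ennreal (P.expectation (f N))" for N
    using f01(1) int_f by (intro nn_integral_eq_integral) auto
  then have lim: "(\<lambda>N. P.expectation (f N)) \<longlonglongrightarrow> 0"
    using lim_f f01(1) by (simp add: ennreal_tendsto_0_iff integral_nonneg_AE)
  have of_bool: "integrable ?P (\<lambda>z. of_bool (Q z) :: real)" "P.expectation (\<lambda>z. of_bool (Q z) :: real) = P.prob {z\<in>space ?P. Q z}"
    if [measurable]: "Measurable.pred ?P Q" for Q
  proof -
    show "integrable ?P (\<lambda>z. of_bool (Q z) :: real)" by (intro P.integrable_const_bound[of _ 1]) auto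
    have "P.expectation (\<lambda>z. of_bool (Q z) :: real) = P.expectation (indicator {z\<in>space ?P. Q z})"
      by (intro Bochner_Integration.integral_cong) (auto simp: indicator_def)
    then show "P.expectation (\<lambda>z. of_bool (Q z) :: real) = P.prob {z\<in>space ?P. Q z}" by simp
  qed
  have "c / 2 \<le> P.expectation (f N)" if N: "1 \<le> N" for N
  proof -
    have "c = (\<Sum>j<N. c) / real N" using N by simp
    also have "\<dots> \<le> (\<Sum>j<N. P.prob {z\<in>space ?P. A j z}) / real N"
      by (intro divide_right_mono sum_mono often) simp
    also have "\<dots> = P.expectation (\<lambda>z. (\<Sum>j<N. of_bool (A j z)) / real N)"
      by (simp only: integral_divide_zero Bochner_Integration.integral_sum[OF of_bool(1)[OF predA]] of_bool(2)[OF predA])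
    also have "\<dots> \<le> P.expectation (\<lambda>z. f N z + of_bool (\<not> R N z))"
    proof (rule integral_mono)
      show "integrable ?P (\<lambda>z. (\<Sum>j<N. of_bool (A j z)) / real N)"
        by (intro integrable_divide_zero impI Bochner_Integration.integrable_sum of_bool(1) predA)
      show "integrable ?P (\<lambda>z. f N z + of_bool (\<not> R N z))"
        by (intro Bochner_Integration.integrable_add int_f of_bool(1)) measurable
      fix z
      have "(\<Sum>j<N. of_bool (A j z)) \<le> (\<Sum>j<N. 1 :: real)" by (intro sum_mono) simp
      then show "(\<Sum>j<N. of_bool (A j z)) / real N \<le> f N z + of_bool (\<not> R N z)"
        by (auto simp: f_def divide_le_eq_1 simp del: sum_of_bool_eq)
    qed
    also have "\<dots> = P.expectation (f N) + P.prob {z\<in>space ?P. \<not> R N z}"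
    proof -
      have [measurable]: "Measurable.pred ?P (\<lambda>z. \<not> R N z)" by measurable
      show ?thesis
        using int_f of_bool[of "\<lambda>z. \<not> R N z"] by (simp del: of_bool_not_iff)
    qed
    also have "\<dots> \<le> P.expectation (f N) + c / 2" using tight by simp
    finally show ?thesis by simp
  qed
  then have "c / 2 \<le> 0" by (intro LIMSEQ_le_const[OF lim]) auto
  then show False using c by simp
qed

lemma unstable_if_overloaded:
  assumes d: "has_limits_ge_1 d"
    and F: "walking_surplus d (\<lambda>w. expectation (\<xi> w 0)) \<gamma> F"
    and L: "1 \<le> (\<Sum>k\<in>UNIV. (expectation (\<sigma> k 0) + \<gamma> k) / expectation (\<tau> k 0))"
  shows "unstable d M \<tau> \<sigma> \<xi>"
  using no_stationary_distribution[OF assms] by (auto simp: unstable_def positive_harris_recurrent_def)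

lemma transient_if_overloaded:
  assumes d: "has_limits_ge_1 d"
    and F: "walking_surplus d (\<lambda>w. expectation (\<xi> w 0)) \<gamma> F"
    and L: "1 < (\<Sum>k\<in>UNIV. (expectation (\<sigma> k 0) + \<gamma> k) / expectation (\<tau> k 0))"
  shows "transient d M \<tau> \<sigma> \<xi>"
  unfolding transient_def
  using unstable_if_overloaded[OF d F] AE_queues_diverge[OF d _ F L] L by simp

lemma rho0_eq: "rho0 M \<tau> \<sigma> = (\<Sum>k\<in>UNIV. expectation (\<sigma> k 0) / expectation (\<tau> k 0))"
  by (simp add: rho0_def rate_def)

lemma load_eq:
  "(\<Sum>k\<in>UNIV. (expectation (\<sigma> k 0) + \<gamma> k) / expectation (\<tau> k 0)) = rho0 M \<tau> \<sigma> + (\<Sum>k\<in>UNIV. rate M (\<tau> k) * \<gamma> k)"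
  by (simp add: rho0_eq rate_def add_divide_distrib sum.distrib)

text \<open>
  The left-hand sides of the three inequalities are the loads that belong to the surplus functionals;
  the second and the third one are the cases \<open>j = 1\<close> and \<open>j = 3\<close>.
\<close>

lemma limited_overloaded:
  assumes l: "\<And>k. 1 \<le> l k"
  shows "\<exists>\<gamma> F. walking_surplus (Limited l) (\<lambda>w. expectation (\<xi> w 0)) \<gamma> F \<and>
      (\<Sum>k\<in>UNIV. (expectation (\<sigma> k 0) + \<gamma> k) / expectation (\<tau> k 0)) = rho0 M \<tau> \<sigma> + rate M (\<tau> 2) / l 2 * zeta M \<xi>"
    and "j \<noteq> 2 \<Longrightarrow> \<exists>\<gamma> F. walking_surplus (Limited l) (\<lambda>w. expectation (\<xi> w 0)) \<gamma> F \<and>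
      (\<Sum>k\<in>UNIV. (expectation (\<sigma> k 0) + \<gamma> k) / expectation (\<tau> k 0))
        = rho0 M \<tau> \<sigma> + rate M (\<tau> j) / l j * ((zeta M \<xi> + zeta_star M \<xi>) / 2)
          + rate M (\<tau> 2) / l 2 * ((zeta M \<xi> - zeta_star M \<xi>) / 2)"
proof -
  note pos = zeta_pos[unfolded zeta_eq] and less = walk_means[unfolded zeta_eq]
  show "\<exists>\<gamma> F. walking_surplus (Limited l) (\<lambda>w. expectation (\<xi> w 0)) \<gamma> F \<and>
      (\<Sum>k\<in>UNIV. (expectation (\<sigma> k 0) + \<gamma> k) / expectation (\<tau> k 0)) = rho0 M \<tau> \<sigma> + rate M (\<tau> 2) / l 2 * zeta M \<xi>"
    unfolding load_eq
    by (rule exI, rule exI, rule conjI, rule walking_surplus_queue_2[where m\<xi> = "\<lambda>w. expectation (\<xi> w 0)", OF mean_bounds(3) l pos]) (simp add: sum_3 zeta_eq)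
  assume j: "j \<noteq> 2"
  then have j13: "j = 1 \<or> j = 3" using exhaust_3[of j] by auto
  show "\<exists>\<gamma> F. walking_surplus (Limited l) (\<lambda>w. expectation (\<xi> w 0)) \<gamma> F \<and>
      (\<Sum>k\<in>UNIV. (expectation (\<sigma> k 0) + \<gamma> k) / expectation (\<tau> k 0))
        = rho0 M \<tau> \<sigma> + rate M (\<tau> j) / l j * ((zeta M \<xi> + zeta_star M \<xi>) / 2)
          + rate M (\<tau> 2) / l 2 * ((zeta M \<xi> - zeta_star M \<xi>) / 2)"
    unfolding load_eq
    by (rule exI, rule exI, rule conjI, rule walking_surplus_queue_1_3[where m\<xi> = "\<lambda>w. expectation (\<xi> w 0)", OF mean_bounds(3) l j pos less])
      (use j13 in \<open>auto simp: sum_3 zeta_eq\<close>)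
qed

end

theorem theorem2:
  fixes M :: "'a measure"
    and \<tau> \<sigma> :: "3 \<Rightarrow> nat \<Rightarrow> 'a \<Rightarrow> real"
    and \<xi> :: "4 \<Rightarrow> nat \<Rightarrow> 'a \<Rightarrow> real"
  assumes "adaptive_polling M \<tau> \<sigma> \<xi>"
  shows
    "(\<forall>l :: 3 \<Rightarrow> nat. (\<forall>k. 1 \<le> l k) \<longrightarrow>
       (rho0 M \<tau> \<sigma> + rate M (\<tau> 2) / l 2 * zeta M \<xi> \<ge> 1 \<or>
        rho0 M \<tau> \<sigma> + rate M (\<tau> 1) / l 1 * ((zeta M \<xi> + zeta_star M \<xi>) / 2)
          + rate M (\<tau> 2) / l 2 * ((zeta M \<xi> - zeta_star M \<xi>) / 2) \<ge> 1 \<or>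
        rho0 M \<tau> \<sigma> + rate M (\<tau> 3) / l 3 * ((zeta M \<xi> + zeta_star M \<xi>) / 2)
          + rate M (\<tau> 2) / l 2 * ((zeta M \<xi> - zeta_star M \<xi>) / 2) \<ge> 1
        \<longrightarrow> unstable (Limited l) M \<tau> \<sigma> \<xi>) \<and>
       (rho0 M \<tau> \<sigma> + rate M (\<tau> 2) / l 2 * zeta M \<xi> > 1 \<or>
        rho0 M \<tau> \<sigma> + rate M (\<tau> 1) / l 1 * ((zeta M \<xi> + zeta_star M \<xi>) / 2)
          + rate M (\<tau> 2) / l 2 * ((zeta M \<xi> - zeta_star M \<xi>) / 2) > 1 \<or>
        rho0 M \<tau> \<sigma> + rate M (\<tau> 3) / l 3 * ((zeta M \<xi> + zeta_star M \<xi>) / 2)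
          + rate M (\<tau> 2) / l 2 * ((zeta M \<xi> - zeta_star M \<xi>) / 2) > 1
        \<longrightarrow> transient (Limited l) M \<tau> \<sigma> \<xi>)) \<and>
     (\<forall>d\<in>{Gated, Exhaustive}.
       (rho0 M \<tau> \<sigma> \<ge> 1 \<longrightarrow> unstable d M \<tau> \<sigma> \<xi>) \<and>
       (rho0 M \<tau> \<sigma> > 1 \<longrightarrow> transient d M \<tau> \<sigma> \<xi>))"
proof -
  interpret adaptive_polling M \<tau> \<sigma> \<xi> by (rule assms)
  have limited: "(1 \<le> L \<longrightarrow> unstable (Limited l) M \<tau> \<sigma> \<xi>) \<and> (1 < L \<longrightarrow> transient (Limited l) M \<tau> \<sigma> \<xi>)"
    if l: "\<forall>k. 1 \<le> l k" and ex: "\<exists>\<gamma> F. walking_surplus (Limited l) (\<lambda>w. expectation (\<xi> w 0)) \<gamma> F \<and>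
      (\<Sum>k\<in>UNIV. (expectation (\<sigma> k 0) + \<gamma> k) / expectation (\<tau> k 0)) = L" for l L
  proof -
    obtain \<gamma> F where F: "walking_surplus (Limited l) (\<lambda>w. expectation (\<xi> w 0)) \<gamma> F"
      and L: "(\<Sum>k\<in>UNIV. (expectation (\<sigma> k 0) + \<gamma> k) / expectation (\<tau> k 0)) = L"
      using ex by (elim exE conjE) (rule that)
    have "has_limits_ge_1 (Limited l)" using l by (simp add: has_limits_ge_1_def)
    then show ?thesis using unstable_if_overloaded[OF _ F] transient_if_overloaded[OF _ F] unfolding L by blast
  qed
  have unlimited: "(1 \<le> rho0 M \<tau> \<sigma> \<longrightarrow> unstable d M \<tau> \<sigma> \<xi>) \<and> (1 < rho0 M \<tau> \<sigma> \<longrightarrow> transient d M \<tau> \<sigma> \<xi>)"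
    if "d \<in> {Gated, Exhaustive}" for d
  proof -
    have "has_limits_ge_1 d" using that by (auto simp: has_limits_ge_1_def)
    moreover note walking_surplus_unlimited[where m\<xi> = "\<lambda>w. expectation (\<xi> w 0)", OF mean_bounds(3) zeta_pos[unfolded zeta_eq], of d]
    ultimately show ?thesis
      using unstable_if_overloaded[of d "\<lambda>_. 0"] transient_if_overloaded[of d "\<lambda>_. 0"] unfolding load_eq by simp
  qed
  have "(1 :: 3) \<noteq> 2" "(3 :: 3) \<noteq> 2" by simp_all
  then show ?thesis
    using limited limited_overloaded unlimited by (smt (verit))
qed

end
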